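(* Let $\mathfrak g=\mathfrak g_{-1}\oplus\mathfrak g_0\oplus\mathfrak g_1$ be as in the context (commutative case, $\mathfrak g_2=\{0\}$), and let $N=\exp\big(\mathrm{ad}\big(\bigoplus_{\alpha\in\Delta_0^+}\mathfrak g^\alpha\big)\big)$. For every $x\in\mathfrak g_1$ (resp. $x\in\mathfrak g_{-1}$) there exists a set $S$ of strongly orthogonal roots of $\Delta_1$ (resp. $\Delta_{-1}$) such that $$N\cdot x\ \cap\ \Big(\bigoplus_{\mu\in S}\mathfrak g^\mu\Big)\neq\emptyset .$$
   Context: $\mathbb F$ is a field of characteristic $0$. $\mathfrak g$ is a finite-dimensional absolutely simple Lie algebra over $\mathbb F$ with a grading $\mathfrak g=\mathfrak g_{-1}\oplus\mathfrak g_0\oplus\mathfrak g_1$, $\mathfrak g_{\pm1}\neq0$; $H_0\in\mathfrak g_0$ satisfies $\mathfrak g_i=\{x:[H_0,x]=ix\}$. One assumes that $\mathfrak g_1$ is an absolutely simple $\mathfrak g_0$-module and that $2H_0$ is 1-simple, i.e. there are $x\in\mathfrak g_1$, $y\in\mathfrak g_{-1}$ with $[x,y]=-2H_0$ (so that $(x,2H_0,y)$ is an $sl_2$-triple: $[h,x]=2x$, $[h,y]=-2y$, $[x,y]=-h$ with $h=2H_0$). $\mathfrak a\ni H_0$ is a maximal split abelian subalgebra, $\Delta$ the root system of $(\mathfrak g,\mathfrak a)$, $\mathfrak g^\alpha$ the root spaces, $\Delta_i=\{\lambda\in\Delta:\lambda(H_0)=i\}$; $\Delta^+$ is a choice of positive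 roots containing $\Delta_1$ and $\Delta_0^+=\Delta_0\cap\Delta^+$. Two roots $\lambda\neq\mu$ are strongly orthogonal if neither $\lambda+\mu$ nor $\lambda-\mu$ is a root or $0$. *)

theory Defs
  imports
    "HOL-Algebra.Algebraic_Closure_Type"
    "HOL-Library.Function_Algebras"
    "HOL-Library.Groups_Big_Fun"
begin

definition simple_lie ::
  "('k::field \<Rightarrow> 'v::ab_group_add \<Rightarrow> 'v) \<Rightarrow> ('v \<Rightarrow> 'v \<Rightarrow> 'v) \<Rightarrow> 'v set \<Rightarrow> bool" where
  "simple_lie scale bracket L \<longleftrightarrow>
     (\<exists>x\<in>L. \<exists>y\<in>L. bracket x y \<noteq> 0) \<and>
     (\<forall>I. module.subspace scale I \<longrightarrow> I \<subseteq> L \<longrightarrow> (\<forall>x\<in>L. \<forall>y\<in>I. bracket x y \<in> I) \<longrightarrow> I = {0} \<or> I = L)"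

(* V and L are subspaces of one ambient Lie algebra, and L acts on V by the bracket. *)
definition simple_submodule ::
  "('k::field \<Rightarrow> 'v::ab_group_add \<Rightarrow> 'v) \<Rightarrow> ('v \<Rightarrow> 'v \<Rightarrow> 'v) \<Rightarrow> 'v set \<Rightarrow> 'v set \<Rightarrow> bool" where
  "simple_submodule scale bracket L V \<longleftrightarrow>
     V \<noteq> {0} \<and> (\<forall>x\<in>L. \<forall>v\<in>V. bracket x v \<in> V) \<and>
     (\<forall>W. module.subspace scale W \<longrightarrow> W \<subseteq> V \<longrightarrow> (\<forall>x\<in>L. \<forall>w\<in>W. bracket x w \<in> W) \<longrightarrow> W = {0} \<or> W = V)"

definition fun_scale :: "'c::field \<Rightarrow> ('b \<Rightarrow> 'c) \<Rightarrow> 'b \<Rightarrow> 'c" where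
  "fun_scale c f = (\<lambda>b. c * f b)"

lemma vector_space_fun_scale: "vector_space fun_scale"
  by standard (auto simp: fun_scale_def fun_eq_iff algebra_simps)

locale lie_algebra = finite_dimensional_vector_space scale Basis
  for scale :: "'k::field_char_0 \<Rightarrow> 'g::ab_group_add \<Rightarrow> 'g" (infixr \<open>*s\<close> 75)
    and Basis :: "'g set" +
  fixes bracket :: "'g \<Rightarrow> 'g \<Rightarrow> 'g"
  assumes bracket_add_left: "bracket (x + y) z = bracket x z + bracket y z"
    and bracket_add_right: "bracket x (y + z) = bracket x y + bracket x z"
    and bracket_scale_left: "bracket (c *s x) y = c *s bracket x y"
    and bracket_scale_right: "bracket x (c *s y) = c *s bracket x y"
    and bracket_self: "bracket x x = 0"
    and jacobi: "bracket x (bracket y z) + bracket y (bracket z x) + bracket z (bracket x y) = 0"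
begin

(* Scalar extension to the algebraic closure K of the base field, in coordinates: an element of
   g \<otimes> K is its coordinate vector with respect to Basis, a function 'g \<Rightarrow> K vanishing
   off Basis. The map coord is x \<mapsto> x \<otimes> 1, and ext_bracket extends the structure
   constants K-bilinearly. For a subspace V of g, extension V is the image of V \<otimes> K. *)

definition coord :: "'g \<Rightarrow> 'g \<Rightarrow> 'k alg_closure" where
  "coord x = (\<lambda>b. to_ac (representation Basis x b))"

definition extension :: "'g set \<Rightarrow> ('g \<Rightarrow> 'k alg_closure) set" where
  "extension V = module.span fun_scale (coord ` V)"

definition ext_bracket ::
  "('g \<Rightarrow> 'k alg_closure) \<Rightarrow> ('g \<Rightarrow> 'k alg_closure) \<Rightarrow> 'g \<Rightarrow> 'k alg_closure" where
  "ext_bracket f g = (\<lambda>c. \<Sum>a\<in>Basis. \<Sum>b\<in>Basis. f a * g b * coord (bracket a b) c)"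

definition absolutely_simple :: bool where
  "absolutely_simple \<longleftrightarrow> simple_lie fun_scale ext_bracket (extension UNIV)"

definition absolutely_simple_submodule :: "'g set \<Rightarrow> 'g set \<Rightarrow> bool" where
  "absolutely_simple_submodule L V \<longleftrightarrow>
     simple_submodule fun_scale ext_bracket (extension L) (extension V)"

definition short_grading :: "(int \<Rightarrow> 'g set) \<Rightarrow> bool" where
  "short_grading gr \<longleftrightarrow>
     (\<forall>i. subspace (gr i)) \<and>
     (\<forall>i. i \<notin> {-1, 0, 1} \<longrightarrow> gr i = {0}) \<and>
     (\<forall>x. \<exists>!p. p \<in> gr (-1) \<times> gr 0 \<times> gr 1 \<and> x = fst p + fst (snd p) + snd (snd p)) \<and>
     (\<forall>i j. \<forall>x\<in>gr i. \<forall>y\<in>gr j. bracket x y \<in> gr (i + j)) \<and>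
     gr (-1) \<noteq> {0} \<and> gr 1 \<noteq> {0}"

definition grading_element :: "(int \<Rightarrow> 'g set) \<Rightarrow> 'g \<Rightarrow> bool" where
  "grading_element gr H\<^sub>0 \<longleftrightarrow>
     H\<^sub>0 \<in> gr 0 \<and> (\<forall>i\<in>{-1, 0, 1}. gr i = {x. bracket H\<^sub>0 x = of_int i *s x})"

definition one_simple :: "(int \<Rightarrow> 'g set) \<Rightarrow> 'g \<Rightarrow> bool" where
  "one_simple gr h \<longleftrightarrow> (\<exists>x\<in>gr 1. \<exists>y\<in>gr (-1). bracket x y = - h)"

definition ad_diagonalizable :: "'g \<Rightarrow> bool" where
  "ad_diagonalizable h \<longleftrightarrow> span {x. \<exists>c. bracket h x = c *s x} = UNIV"

definition split_abelian :: "'g set \<Rightarrow> bool" where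
  "split_abelian \<aa> \<longleftrightarrow>
     subspace \<aa> \<and> (\<forall>x\<in>\<aa>. \<forall>y\<in>\<aa>. bracket x y = 0) \<and> (\<forall>h\<in>\<aa>. ad_diagonalizable h)"

definition maximal_split_abelian :: "'g set \<Rightarrow> bool" where
  "maximal_split_abelian \<aa> \<longleftrightarrow>
     split_abelian \<aa> \<and> (\<forall>\<bb>. split_abelian \<bb> \<longrightarrow> \<aa> \<subseteq> \<bb> \<longrightarrow> \<bb> = \<aa>)"

(* Linear forms on \<aa> are represented by functions on all of 'g that vanish off \<aa>. The pointwise
   operations on functions then restrict to those of the dual space, and equality of functions
   is equality of forms. *)
definition dual :: "'g set \<Rightarrow> ('g \<Rightarrow> 'k) set" where
  "dual \<aa> = {\<phi>. (\<forall>x\<in>\<aa>. \<forall>y\<in>\<aa>. \<phi> (x + y) = \<phi> x + \<phi> y) \<and>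
                (\<forall>c. \<forall>x\<in>\<aa>. \<phi> (c *s x) = c * \<phi> x) \<and> (\<forall>x. x \<notin> \<aa> \<longrightarrow> \<phi> x = 0)}"

definition root_space :: "'g set \<Rightarrow> ('g \<Rightarrow> 'k) \<Rightarrow> 'g set" where
  "root_space \<aa> \<phi> = {x. \<forall>h\<in>\<aa>. bracket h x = \<phi> h *s x}"

definition roots :: "'g set \<Rightarrow> ('g \<Rightarrow> 'k) set" where
  "roots \<aa> = {\<phi> \<in> dual \<aa>. \<phi> \<noteq> 0 \<and> root_space \<aa> \<phi> \<noteq> {0}}"

definition roots_deg :: "'g set \<Rightarrow> 'g \<Rightarrow> int \<Rightarrow> ('g \<Rightarrow> 'k) set" where
  "roots_deg \<aa> H\<^sub>0 i = {\<phi> \<in> roots \<aa>. \<phi> H\<^sub>0 = of_int i}"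

definition positive_roots :: "'g set \<Rightarrow> ('g \<Rightarrow> 'k) set \<Rightarrow> bool" where
  "positive_roots \<aa> P \<longleftrightarrow>
     P \<subseteq> roots \<aa> \<and> (\<forall>\<phi>\<in>roots \<aa>. (\<phi> \<in> P) \<noteq> (- \<phi> \<in> P)) \<and>
     (\<forall>\<phi>\<in>P. \<forall>\<mu>\<in>P. \<phi> + \<mu> \<in> roots \<aa> \<longrightarrow> \<phi> + \<mu> \<in> P)"

definition strongly_orthogonal :: "'g set \<Rightarrow> ('g \<Rightarrow> 'k) \<Rightarrow> ('g \<Rightarrow> 'k) \<Rightarrow> bool" where
  "strongly_orthogonal \<aa> \<phi> \<mu> \<longleftrightarrow> \<phi> + \<mu> \<notin> roots \<aa> \<union> {0} \<and> \<phi> - \<mu> \<notin> roots \<aa> \<union> {0}"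

definition root_space_sum :: "'g set \<Rightarrow> ('g \<Rightarrow> 'k) set \<Rightarrow> 'g set" where
  "root_space_sum \<aa> S = span (\<Union>\<phi>\<in>S. root_space \<aa> \<phi>)"

(* The exponential series of ad u. It is a finite sum when ad u is nilpotent, which is
   the only case of interest. *)
definition exp_ad :: "'g \<Rightarrow> 'g \<Rightarrow> 'g" where
  "exp_ad u x = Sum_any (\<lambda>k. inverse (fact k) *s (bracket u ^^ k) x)"

definition N_group :: "'g set \<Rightarrow> 'g \<Rightarrow> ('g \<Rightarrow> 'k) set \<Rightarrow> ('g \<Rightarrow> 'g) set" where
  "N_group \<aa> H\<^sub>0 P = exp_ad ` root_space_sum \<aa> (roots_deg \<aa> H\<^sub>0 0 \<inter> P)"

end

end

theory Submission
  imports Defs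
begin

text \<open>For \<open>\<alpha> \<in> \<Delta>\<^sub>1\<close> and \<open>0 \<noteq> e \<in> g\<^sup>\<alpha>\<close> a graded Jacobson--Morozov argument gives an \<open>sl\<^sub>2\<close>-triple \<open>(e, h, f)\<close>
  with \<open>f \<in> g\<^sup>-\<^sup>\<alpha>\<close>; since \<open>ad h\<close> is diagonalizable and commutes with the maximal split \<open>\<aa>\<close>, \<open>h \<in> \<aa>\<close>. The
  values \<open>\<beta>(h)\<close>, \<open>\<beta> \<in> \<Delta>\<^sub>1\<close>, lie in \<open>{0, 1, 2}\<close>, and \<open>\<beta>(h) = 0\<close> means that \<open>\<alpha>\<close> and \<open>\<beta>\<close> are strongly
  orthogonal. Take \<open>\<alpha>\<close> minimal among the roots occurring in \<open>x\<close>, and \<open>e\<close> the component of \<open>x\<close>. A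
  component \<open>y \<in> g\<^sup>\<beta>\<close> with \<open>\<beta> \<noteq> \<alpha>\<close> and \<open>\<beta>(h) \<noteq> 0\<close> equals \<open>[e, [f, y]] / \<beta>(h)\<close>, so it is removed by an
  exponential of an element of \<open>[f, g\<^sub>1] \<inter> \<nn>\<close> at the cost of higher components. What remains besides
  \<open>e\<close> is strongly orthogonal to \<open>\<alpha>\<close>, and the later rounds do not disturb \<open>e\<close>. Finally \<open>exp (ad \<nn>)\<close> is
  closed under composition: the logarithm of a unipotent automorphism is a derivation, hence inner.
  Degree \<open>-1\<close> follows by replacing \<open>H\<close> by \<open>-H\<close>.\<close>

section \<open>Traces and power series of endomorphisms\<close>

text \<open>Two things shape the proof. \<open>N_group\<close> is by definition only the image of
  \<open>exp_ad\<close>, so closure under composition has to be proved. And \<open>P\<close> is only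
  a closed half of the roots, without a defining functional, simple roots or heights. The height is
  replaced by a \<open>rank\<close> on the roots of degree one that grows along positive steps. It
  makes \<open>\<nn>\<close> act nilpotently in degree 1; faithfulness of the action on degree 1
  carries this to degrees 0 and -1. Everything from semisimple theory comes from the Killing form.
  Since \<open>(ad H)^2\<close> has eigenvalues 0 and 1, \<open>kappa H H\<close> is a positive
  integer; so the radical is an ideal that misses \<open>H\<close>, and nondegeneracy follows
  without Cartan's criterion. Nondegeneracy then gives inner derivations, the duality of degrees 1
  and -1, and the regularity of elements of degree 1 behind the \<open>sl2\<close>-triples. The
  weights 0, 1, 2 of a coroot reflect the shortness of the grading: \<open>(ad f)^3\<close> sends
  degree 1 to degree -2, which is zero, and this forces \<open>h(h - 1)(h - 2) = 0\<close> on degree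
  1.\<close>

context finite_dimensional_vector_space
begin

abbreviation lin :: "('b \<Rightarrow> 'b) \<Rightarrow> bool" where
  "lin A \<equiv> Vector_Spaces.linear scale scale A"

lemma linI:
  assumes "\<And>x y. A (x + y) = A x + A y" "\<And>c x. A (scale c x) = scale c (A x)"
  shows "lin A"
  by (simp add: Vector_Spaces.linear_iff assms vector_space_axioms)

lemma lin_add: "lin A \<Longrightarrow> A (x + y) = A x + A y"
  and lin_scale: "lin A \<Longrightarrow> A (scale c x) = scale c (A x)"
  by (simp_all add: Vector_Spaces.linear_iff)

lemma lin_zero: "lin A \<Longrightarrow> A 0 = 0"
  using lin_scale[of A 0 0] by simp

lemma lin_minus: "lin A \<Longrightarrow> A (- x) = - A x"
  using lin_scale[of A "-1" x] by simp

lemma lin_diff: "lin A \<Longrightarrow> A (x - y) = A x - A y"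
  using lin_add[of A x "- y"] by (simp add: lin_minus)

lemma lin_sum: "lin A \<Longrightarrow> A (sum f I) = (\<Sum>i\<in>I. A (f i))"
  by (induction I rule: infinite_finite_induct) (simp_all add: lin_zero lin_add)

lemma lin_comp: "lin A \<Longrightarrow> lin B \<Longrightarrow> lin (\<lambda>x. A (B x))"
  by (rule linI) (simp_all add: lin_add lin_scale)

lemma lin_funpow: "lin A \<Longrightarrow> lin (A ^^ n)"
  by (induction n) (auto intro!: linI simp: lin_add lin_scale)

lemma subspace_kernel: "lin A \<Longrightarrow> subspace {x. A x = 0}"
  by (auto intro!: subspaceI simp: lin_zero lin_add lin_scale)

lemma subspace_vimage: "lin A \<Longrightarrow> subspace W \<Longrightarrow> subspace {x. A x \<in> W}"
  by (auto intro!: subspaceI simp: lin_zero lin_add lin_scale subspace_0 subspace_add subspace_scale)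

lemma lin_span_subset:
  assumes "lin A" "subspace W" "\<And>x. x \<in> Y \<Longrightarrow> A x \<in> W" "x \<in> span Y"
  shows "A x \<in> W"
  using span_minimal[of Y "{x. A x \<in> W}"] subspace_vimage[OF assms(1,2)] assms(3,4) by auto

lemma rep_add: "independent B \<Longrightarrow> span B = UNIV \<Longrightarrow>
    representation B (x + y) b = representation B x b + representation B y b"
  by (simp add: representation_add)

lemma rep_scale: "independent B \<Longrightarrow> span B = UNIV \<Longrightarrow>
    representation B (scale c x) b = c * representation B x b"
  by (simp add: representation_scale)

lemma rep_sum: "independent B \<Longrightarrow> span B = UNIV \<Longrightarrow>
    representation B (sum f I) b = (\<Sum>i\<in>I. representation B (f i) b)"
  by (simp add: representation_sum)

lemma rep_expand:
  assumes "independent B" "span B = UNIV"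
  shows "(\<Sum>b\<in>B. scale (representation B x b) b) = x"
  using sum_representation_eq[OF assms(1), of x B] assms(2) finiteI_independent[OF assms(1)] by blast

lemma basis_extension:
  assumes "independent A"
  obtains B where "A \<subseteq> B" "independent B" "span B = UNIV" "finite B"
proof (rule that)
  show "A \<subseteq> extend_basis A" by (rule extend_basis_superset[OF assms])
  show "independent (extend_basis A)" by (rule independent_extend_basis[OF assms])
  then show "finite (extend_basis A)" by (rule finiteI_independent)
  show "span (extend_basis A) = UNIV" by (rule span_extend_basis[OF assms])
qed

definition trace :: "('b \<Rightarrow> 'b) \<Rightarrow> 'a" where
  "trace A = (\<Sum>b\<in>Basis. representation Basis (A b) b)"

text \<open>Frees the trace from the fixed \<open>Basis\<close>: nilpotent maps are computed in a
  basis adapted to a flag, \<open>(ad H)^2\<close> in a homogeneous basis.\<close>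

lemma trace_basis:
  assumes A: "lin A" and B: "independent B" "span B = UNIV"
  shows "trace A = (\<Sum>c\<in>B. representation B (A c) c)"
proof -
  note Bas = independent_Basis span_Basis
  have "trace A = (\<Sum>b\<in>Basis. representation Basis (\<Sum>c\<in>B. scale (representation B (A b) c) c) b)"
    unfolding trace_def rep_expand[OF B] ..
  also have "\<dots> = (\<Sum>c\<in>B. \<Sum>b\<in>Basis. representation Basis c b * representation B (A b) c)"
    by (subst sum.swap) (simp add: rep_sum[OF Bas] rep_scale[OF Bas] mult.commute)
  also have "\<dots> = (\<Sum>c\<in>B. representation B (A (\<Sum>b\<in>Basis. scale (representation Basis c b) b)) c)"
    by (simp add: lin_sum[OF A] lin_scale[OF A] rep_sum[OF B] rep_scale[OF B])
  finally show ?thesis unfolding rep_expand[OF Bas] .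
qed

lemma trace_comm:
  assumes A: "lin A" and C: "lin C"
  shows "trace (\<lambda>x. A (C x)) = trace (\<lambda>x. C (A x))"
proof -
  note Bas = independent_Basis span_Basis
  let ?r = "representation Basis"
  have *: "trace (\<lambda>x. A (C x)) = (\<Sum>b\<in>Basis. \<Sum>c\<in>Basis. ?r (C b) c * ?r (A c) b)"
    if A: "lin A" for A C
  proof -
    have "trace (\<lambda>x. A (C x)) = (\<Sum>b\<in>Basis. ?r (A (\<Sum>c\<in>Basis. scale (?r (C b) c) c)) b)"
      unfolding trace_def rep_expand[OF Bas] ..
    then show ?thesis
      by (simp add: lin_sum[OF A] lin_scale[OF A] rep_sum[OF Bas] rep_scale[OF Bas])
  qed
  show ?thesis
    unfolding *[OF A] *[OF C] by (subst sum.swap) (simp add: mult.commute)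
qed

lemma trace_add: "trace (\<lambda>x. A x + C x) = trace A + trace C"
  by (simp add: trace_def rep_add[OF independent_Basis span_Basis] sum.distrib)

lemma trace_scale: "trace (\<lambda>x. scale c (A x)) = c * trace A"
  by (simp add: trace_def rep_scale[OF independent_Basis span_Basis] sum_distrib_left)

lemma trace_diff: "trace (\<lambda>x. A x - C x) = trace A - trace C"
  using trace_add[of A "\<lambda>x. scale (-1) (C x)"] trace_scale[of "-1" C] by simp

lemma representation_eq_0:
  assumes "independent B" "b \<notin> C" "C \<subseteq> B" "x \<in> span C"
  shows "representation B x b = 0"
  using representation_extend[OF assms(1,4,3)] representation_ne_zero[of C x b] assms(2) by auto

text \<open>A basis adapted to the flag of kernels of the powers of \<open>A\<close> makes all diagonal entries vanish.\<close>

lemma trace_nilpotent: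
  assumes A: "lin A" and nil: "\<And>x. (A ^^ K) x = 0"
  shows "trace A = 0"
proof -
  have "\<exists>B. independent B \<and> span B = {x. (A ^^ n) x = 0} \<and> (\<forall>b\<in>B. A b \<in> span (B - {b}))" for n
  proof (induction n)
    case 0
    show ?case by (rule exI[of _ "{}"]) (auto simp: independent_empty)
  next
    case (Suc n)
    then obtain B where B: "independent B" "span B = {x. (A ^^ n) x = 0}"
      "\<forall>b\<in>B. A b \<in> span (B - {b})" by blast
    let ?V = "{x. (A ^^ Suc n) x = 0}"
    have V: "subspace ?V" by (rule subspace_kernel[OF lin_funpow[OF A]])
    have "B \<subseteq> ?V" using B(2) span_base[of _ B] by (auto simp: lin_zero[OF A])
    then obtain B' where B': "B \<subseteq> B'" "B' \<subseteq> ?V" "independent B'" "?V \<subseteq> span B'"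
      using maximal_independent_subset_extend[OF _ B(1)] by blast
    have "span B' = ?V" using span_minimal[OF B'(2) V] B'(4) by blast
    moreover have "A b \<in> span (B' - {b})" if b: "b \<in> B'" for b
    proof (cases "b \<in> B")
      case True
      then show ?thesis using B(3) B'(1) span_mono[of "B - {b}" "B' - {b}"] by blast
    next
      case False
      have "A b \<in> span B" using B(2) B'(2) b by (auto simp: funpow_swap1)
      then show ?thesis using False B'(1) span_mono[of B "B' - {b}"] by blast
    qed
    ultimately show ?case using B'(3) by blast
  qed
  from this[of K] obtain B where B: "independent B" "span B = UNIV"
    "\<forall>b\<in>B. A b \<in> span (B - {b})" using nil by auto
  have "representation B (A b) b = 0" if "b \<in> B" for b
    using representation_eq_0[OF B(1), of b "B - {b}"] B(3) that by blast
  then show ?thesis unfolding trace_basis[OF A B(1,2)] by simp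
qed

lemma separating_functional:
  assumes W: "subspace W" and v: "v \<notin> W"
  obtains \<phi> where "\<forall>x y. \<phi> (x + y) = \<phi> x + \<phi> y" "\<forall>c x. \<phi> (scale c x) = c * \<phi> x"
    "\<forall>x\<in>W. \<phi> x = 0" "\<phi> v = 1"
proof -
  obtain C where C: "C \<subseteq> W" "independent C" "W \<subseteq> span C"
    by (rule maximal_independent_subset[of W])
  then have sC: "span C = W" using span_minimal[OF C(1) W] by blast
  have "independent (insert v C)" using C(2) v sC by (simp add: independent_insertI)
  then obtain B where B: "insert v C \<subseteq> B" "independent B" "span B = UNIV"
    by (rule basis_extension)
  have "v \<notin> C" using C(1) v by blast
  then have "representation B x v = 0" if "x \<in> W" for x
    using representation_eq_0[OF B(2), of v C x] B(1) sC that by auto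
  moreover have "representation B v v = 1"
    using representation_basis[OF B(2), of v] B(1) by auto
  ultimately show ?thesis
    using that[of "\<lambda>x. representation B x v"] by (simp add: rep_add[OF B(2,3)] rep_scale[OF B(2,3)])
qed

text \<open>Each coordinate is a polynomial with infinitely many roots. The hypothesis
  \<open>inf\<close> stands for characteristic 0, since the scalar field of this context is an
  arbitrary field.\<close>

lemma polynomial_coeffs_zero:
  assumes inf: "infinite (range (of_nat :: nat \<Rightarrow> 'a))"
    and zero: "\<And>n::nat. (\<Sum>k<K. scale (of_nat n ^ k) (v k)) = 0" and k: "k < K"
  shows "v k = 0"
proof -
  note Bas = independent_Basis span_Basis
  have "representation Basis (v k) b = 0" for b
  proof -
    define p where "p = (\<Sum>k<K. monom (representation Basis (v k) b) k)"
    have "poly p (of_nat n) = 0" for n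
    proof -
      have "poly p (of_nat n) = representation Basis (\<Sum>k<K. scale (of_nat n ^ k) (v k)) b"
        by (simp add: p_def poly_sum poly_monom rep_sum[OF Bas] rep_scale[OF Bas] mult.commute)
      then show ?thesis by (simp add: zero representation_zero)
    qed
    then have "range of_nat \<subseteq> {x. poly p x = 0}" by auto
    then have "p = 0" using inf poly_roots_finite[of p] finite_subset by blast
    then have "coeff p k = 0" by simp
    then show ?thesis using k by (simp add: p_def coeff_sum)
  qed
  then show ?thesis using rep_expand[OF Bas, of "v k"] by simp
qed

text \<open>The functional calculus \<open>F(M)\<close>: when \<open>M^K = 0\<close> the truncation
  at \<open>K\<close> loses nothing, and identities between formal power series become identities
  between endomorphisms.\<close>

definition fps_eval :: "nat \<Rightarrow> ('b \<Rightarrow> 'b) \<Rightarrow> 'a fps \<Rightarrow> 'b \<Rightarrow> 'b" where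
  "fps_eval K M F x = (\<Sum>k<K. scale (fps_nth F k) ((M ^^ k) x))"

lemma funpow_zero_mono:
  assumes M: "lin M" and nil: "\<And>x. (M ^^ K) x = 0" and "K \<le> n"
  shows "(M ^^ n) x = 0"
proof -
  have "(M ^^ n) x = (M ^^ (n - K)) ((M ^^ K) x)"
    using \<open>K \<le> n\<close> by (simp flip: funpow_add comp_apply[of "M ^^ (n - K)"])
  then show ?thesis by (simp add: nil lin_zero lin_funpow M)
qed

lemma lin_fps_eval: "lin M \<Longrightarrow> lin (fps_eval K M F)"
  unfolding fps_eval_def
  by (rule linI) (simp_all add: lin_add[OF lin_funpow] lin_scale[OF lin_funpow] scale_right_distrib
      sum.distrib scale_sum_right mult.commute)

lemma sum_square_eq_triangle:
  fixes g :: "nat \<Rightarrow> nat \<Rightarrow> 'c::comm_monoid_add"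
  assumes "\<And>i j. i + j \<ge> K \<Longrightarrow> g i j = 0"
  shows "(\<Sum>i<K. \<Sum>j<K. g i j) = (\<Sum>k<K. \<Sum>i\<le>k. g i (k - i))"
proof -
  have "(\<Sum>i<K. \<Sum>j<K. g i j) = (\<Sum>(i,j)\<in>{..<K} \<times> {..<K}. g i j)"
    by (simp add: sum.cartesian_product)
  also have "\<dots> = (\<Sum>(i,j)\<in>{(i,j). i + j < K}. g i j)"
    by (rule sum.mono_neutral_right) (auto, meson assms not_le)
  finally show ?thesis by (simp add: sum.triangle_reindex)
qed

lemma fps_eval_mult:
  assumes M: "lin M" and nil: "\<And>x. (M ^^ K) x = 0"
  shows "fps_eval K M (F * G) x = fps_eval K M F (fps_eval K M G x)"
proof -
  let ?g = "\<lambda>i j. scale (fps_nth F i * fps_nth G j) ((M ^^ (i + j)) x)"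
  have "fps_eval K M F (fps_eval K M G x) = (\<Sum>i<K. \<Sum>j<K. ?g i j)"
    by (simp add: fps_eval_def lin_sum[OF lin_funpow[OF M]] lin_scale[OF lin_funpow[OF M]]
        scale_sum_right funpow_add)
  also have "\<dots> = (\<Sum>k<K. \<Sum>i\<le>k. ?g i (k - i))"
    by (rule sum_square_eq_triangle) (simp add: funpow_zero_mono[OF M nil])
  also have "\<dots> = fps_eval K M (F * G) x"
    by (simp add: fps_eval_def fps_mult_nth scale_sum_left atMost_atLeast0)
  finally show ?thesis ..
qed

lemma fps_eval_1: "K > 0 \<Longrightarrow> fps_eval K M 1 x = x"
proof -
  assume "K > 0"
  have "fps_eval K M 1 x = (\<Sum>k<K. if k = 0 then x else 0)"
    unfolding fps_eval_def by (rule sum.cong) auto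
  then show ?thesis using \<open>K > 0\<close> by simp
qed

lemma fps_eval_diff: "fps_eval K M (F - G) x = fps_eval K M F x - fps_eval K M G x"
  by (simp add: fps_eval_def scale_left_diff_distrib sum_subtractf)

lemma fps_eval_power:
  assumes M: "lin M" and nil: "\<And>x. (M ^^ K) x = 0" and "K > 0"
  shows "fps_eval K M (F ^ n) x = (fps_eval K M F ^^ n) x"
  by (induction n arbitrary: x) (simp_all add: fps_eval_1 fps_eval_mult[OF M nil] \<open>K > 0\<close> funpow_swap1)

lemma fps_eval_compose:
  assumes M: "lin M" and nil: "\<And>x. (M ^^ K) x = 0" and "K > 0" and L: "fps_nth L 0 = 0"
  shows "fps_eval K M (F oo L) x = fps_eval K (fps_eval K M L) F x"
proof -
  have "fps_eval K M (F oo L) x = (\<Sum>n<K. \<Sum>i<K. scale (fps_nth F i * fps_nth (L ^ i) n) ((M ^^ n) x))"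
    unfolding fps_eval_def fps_compose_nth scale_sum_left
  proof (rule sum.cong[OF refl])
    \<comment> \<open>As \<open>L\<close> has no constant term, \<open>L ^ i\<close> starts in
      degree \<open>i\<close>; the terms with \<open>i > n\<close> vanish and the inner range may be
      made independent of \<open>n\<close>.\<close>
    fix n assume "n \<in> {..<K}"
    then show "(\<Sum>i = 0..n. scale (fps_nth F i * fps_nth (L ^ i) n) ((M ^^ n) x)) =
        (\<Sum>i<K. scale (fps_nth F i * fps_nth (L ^ i) n) ((M ^^ n) x))"
      by (intro sum.mono_neutral_left) (auto simp: startsby_zero_power_prefix[OF L])
  qed
  also have "\<dots> = (\<Sum>i<K. scale (fps_nth F i) (fps_eval K M (L ^ i) x))"
    by (subst sum.swap) (simp add: fps_eval_def scale_sum_right)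
  finally show ?thesis
    unfolding fps_eval_power[OF M nil \<open>K > 0\<close>] by (simp add: fps_eval_def[of K "fps_eval K M L"])
qed

lemma fps_eval_mono:
  assumes "K \<le> n" "lin M" "\<And>x. (M ^^ K) x = 0"
  shows "fps_eval n M F x = fps_eval K M F x"
  unfolding fps_eval_def
proof (rule sum.mono_neutral_right)
  show "\<forall>i\<in>{..<n} - {..<K}. scale (fps_nth F i) ((M ^^ i) x) = 0"
    using funpow_zero_mono[OF assms(2,3)] by simp
qed (use assms(1) in auto)

lemma fps_eval_vanishing:
  assumes "\<And>k. k < K \<Longrightarrow> fps_nth F k = 0"
  shows "fps_eval K M F x = 0"
  unfolding fps_eval_def by (rule sum.neutral) (simp add: assms)

text \<open>Only powers \<open>M^k\<close> with \<open>k > 0\<close> occur, and the first factor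
  already lands in \<open>W'\<close>. Both \<open>exp - 1\<close> and the logarithm are handled by
  this.\<close>

lemma fps_eval_in_subspace:
  assumes "subspace W'" "W' \<subseteq> W" "\<And>x. x \<in> W \<Longrightarrow> M x \<in> W'" "fps_nth F 0 = 0" "x \<in> W"
  shows "fps_eval K M F x \<in> W'"
proof -
  have S: "(M ^^ Suc k) x \<in> W'" for k
  proof (induction k)
    case 0
    then show ?case using assms(3)[OF assms(5)] by simp
  next
    case (Suc k)
    then have "(M ^^ Suc k) x \<in> W" using assms(2) by blast
    from assms(3)[OF this] show ?case by simp
  qed
  have "scale (fps_nth F k) ((M ^^ k) x) \<in> W'" for k
  proof (cases k)
    case 0
    then show ?thesis using subspace_0[OF assms(1)] assms(4) by simp
  next
    case (Suc m)
    show ?thesis unfolding Suc by (rule subspace_scale[OF assms(1) S])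
  qed
  then show ?thesis
    unfolding fps_eval_def by (intro subspace_sum[OF assms(1)])
qed

end

section \<open>Derivations and automorphisms\<close>

context lie_algebra
begin

lemma bracket_zero_left [simp]: "bracket 0 x = 0"
  using bracket_scale_left[of 0 0 x] by simp

lemma bracket_zero_right [simp]: "bracket x 0 = 0"
  using bracket_scale_right[of x 0 0] by simp

lemma bracket_anti: "bracket x y = - bracket y x"
proof -
  have "0 = bracket (x + y) (x + y)" by (rule bracket_self[symmetric])
  also have "\<dots> = bracket x y + bracket y x"
    unfolding bracket_add_left bracket_add_right by (simp add: bracket_self)
  finally show ?thesis by (metis eq_neg_iff_add_eq_0)
qed

lemma lin_bracket: "lin (bracket x)"
  by (rule linI) (simp_all add: bracket_add_right bracket_scale_right)

lemma lin_bracket_left: "lin (\<lambda>x. bracket x y)"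
  by (rule linI) (simp_all add: bracket_add_left bracket_scale_left)

lemma bracket_minus_left [simp]: "bracket (- x) y = - bracket x y"
  by (rule lin_minus[OF lin_bracket_left])

lemma bracket_minus_right [simp]: "bracket x (- y) = - bracket x y"
  by (rule lin_minus[OF lin_bracket])

lemma bracket_diff_left: "bracket (x - y) z = bracket x z - bracket y z"
  by (rule lin_diff[OF lin_bracket_left])

lemma bracket_diff_right: "bracket x (y - z) = bracket x y - bracket x z"
  by (rule lin_diff[OF lin_bracket])

lemma bracket_sum_left: "bracket (sum f I) y = (\<Sum>i\<in>I. bracket (f i) y)"
  by (rule lin_sum[OF lin_bracket_left])

lemma bracket_sum_right: "bracket x (sum f I) = (\<Sum>i\<in>I. bracket x (f i))"
  by (rule lin_sum[OF lin_bracket])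

lemma leibniz: "bracket x (bracket y z) = bracket (bracket x y) z + bracket y (bracket x z)"
proof -
  have "bracket x (bracket y z) = - bracket y (bracket z x) - bracket z (bracket x y)"
    using jacobi[of x y z] by (metis add.assoc add_uminus_conv_diff eq_neg_iff_add_eq_0 minus_add_distrib)
  also have "bracket z (bracket x y) = - bracket (bracket x y) z" by (rule bracket_anti)
  also have "bracket z x = - bracket x z" by (rule bracket_anti)
  finally show ?thesis by simp
qed

lemma bracket_bracket_left: "bracket (bracket x y) z = bracket x (bracket y z) - bracket y (bracket x z)"
  by (simp add: leibniz[of x y z])

lemma bracket_eq_0_commute: "bracket x y = 0 \<longleftrightarrow> bracket y x = 0"
  using bracket_anti[of x y] by auto

definition derivation :: "('g \<Rightarrow> 'g) \<Rightarrow> bool" where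
  "derivation D \<longleftrightarrow> lin D \<and> (\<forall>a b. D (bracket a b) = bracket (D a) b + bracket a (D b))"

definition automorphism :: "('g \<Rightarrow> 'g) \<Rightarrow> bool" where
  "automorphism T \<longleftrightarrow> lin T \<and> (\<forall>a b. T (bracket a b) = bracket (T a) (T b))"

lemma derivation_bracket: "derivation (bracket x)"
  unfolding derivation_def using lin_bracket leibniz by blast

text \<open>With divided powers \<open>D^n / n!\<close> the higher Leibniz rule loses its binomial
  coefficients and becomes a Cauchy product.\<close>

definition divpow :: "('g \<Rightarrow> 'g) \<Rightarrow> nat \<Rightarrow> 'g \<Rightarrow> 'g" where
  "divpow D n x = inverse (fact n) *s (D ^^ n) x"

lemma fps_eval_exp: "fps_eval N D (fps_exp c) x = (\<Sum>k<N. c ^ k *s divpow D k x)"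
  by (simp add: fps_eval_def divpow_def divide_inverse)

text \<open>Truncating at \<open>2 * K\<close> makes the square of index pairs agree with the
  triangle: if \<open>i + j\<close> is at least \<open>2 * K\<close>, one of the two divided powers
  is zero. The parameter \<open>c\<close> stays free because the logarithm argument needs all
  natural \<open>c\<close>.\<close>

lemma bracket_fps_eval_exp:
  assumes D: "lin D" and nil: "\<And>x. (D ^^ K) x = 0"
  shows "bracket (fps_eval (2 * K) D (fps_exp c) a) (fps_eval (2 * K) D (fps_exp c) b)
    = (\<Sum>k<2 * K. c ^ k *s (\<Sum>i\<le>k. bracket (divpow D i a) (divpow D (k - i) b)))"
proof -
  let ?g = "\<lambda>i j. c ^ (i + j) *s bracket (divpow D i a) (divpow D j b)"
  have z: "divpow D i x = 0" if "i \<ge> K" for i x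
    using funpow_zero_mono[OF D nil that] by (simp add: divpow_def)
  have "bracket (fps_eval (2 * K) D (fps_exp c) a) (fps_eval (2 * K) D (fps_exp c) b) =
      (\<Sum>i<2 * K. \<Sum>j<2 * K. ?g i j)"
    by (subst sum.swap) (simp add: fps_eval_exp bracket_sum_left bracket_sum_right bracket_scale_left
        bracket_scale_right power_add scale_sum_right mult.commute)
  also have "\<dots> = (\<Sum>k<2 * K. \<Sum>i\<le>k. ?g i (k - i))"
  proof (rule sum_square_eq_triangle)
    fix i j :: nat assume "2 * K \<le> i + j"
    then have "K \<le> i \<or> K \<le> j" by linarith
    then show "?g i j = 0" using z by auto
  qed
  also have "\<dots> = (\<Sum>k<2 * K. c ^ k *s (\<Sum>i\<le>k. bracket (divpow D i a) (divpow D (k - i) b)))"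
    by (simp add: scale_sum_right)
  finally show ?thesis .
qed

lemma divpow_Suc: "lin D \<Longrightarrow> of_nat (Suc n) *s divpow D (Suc n) x = D (divpow D n x)"
  by (simp add: divpow_def lin_scale del: of_nat_Suc)

text \<open>After multiplication by \<open>n + 1\<close>, differentiating either factor contributes
  the weights \<open>i\<close> and \<open>n + 1 - i\<close>, which add up to \<open>n + 1\<close>.
  The summand missing at either end of the range has weight 0.\<close>

lemma divpow_bracket:
  assumes "derivation D"
  shows "divpow D n (bracket a b) = (\<Sum>i\<le>n. bracket (divpow D i a) (divpow D (n - i) b))"
proof (induction n)
  case 0
  show ?case by (simp add: divpow_def)
next
  case (Suc n)
  have D: "lin D" and der: "\<And>a b. D (bracket a b) = bracket (D a) b + bracket a (D b)"
    using assms by (auto simp: derivation_def)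
  let ?g = "\<lambda>i. bracket (divpow D i a) (divpow D (Suc n - i) b)"
  have "of_nat (Suc n) *s divpow D (Suc n) (bracket a b) =
      (\<Sum>i\<le>n. D (bracket (divpow D i a) (divpow D (n - i) b)))"
    by (simp only: divpow_Suc[OF D] Suc lin_sum[OF D])
  also have "\<dots> = (\<Sum>i\<le>n. of_nat (Suc i) *s ?g (Suc i)) + (\<Sum>i\<le>n. of_nat (Suc n - i) *s ?g i)"
    unfolding sum.distrib[symmetric]
    by (rule sum.cong[OF refl])
      (simp add: der Suc_diff_le bracket_scale_left bracket_scale_right
        divpow_Suc[OF D, symmetric] del: of_nat_Suc)
  also have "(\<Sum>i\<le>n. of_nat (Suc i) *s ?g (Suc i)) = (\<Sum>i\<le>Suc n. of_nat i *s ?g i)"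
    by (simp add: sum.atMost_Suc_shift del: sum.atMost_Suc of_nat_Suc)
  also have "(\<Sum>i\<le>n. of_nat (Suc n - i) *s ?g i) = (\<Sum>i\<le>Suc n. of_nat (Suc n - i) *s ?g i)"
    by simp
  also have "(\<Sum>i\<le>Suc n. of_nat i *s ?g i) + (\<Sum>i\<le>Suc n. of_nat (Suc n - i) *s ?g i) =
      (\<Sum>i\<le>Suc n. of_nat (Suc n) *s ?g i)"
    unfolding sum.distrib[symmetric]
    by (rule sum.cong[OF refl])
      (simp flip: scale_left_distrib of_nat_add del: of_nat_Suc)
  finally have "of_nat (Suc n) *s divpow D (Suc n) (bracket a b) = of_nat (Suc n) *s (\<Sum>i\<le>Suc n. ?g i)"
    by (simp only: scale_sum_right)
  then show ?case by (simp del: of_nat_Suc sum.atMost_Suc)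
qed

lemma exp_derivation_automorphism:
  assumes D: "derivation D" and nil: "\<And>x. (D ^^ K) x = 0"
  shows "automorphism (fps_eval K D (fps_exp 1))"
proof -
  have l: "lin D" using D by (simp add: derivation_def)
  have e: "fps_eval K D F = fps_eval (2 * K) D F" for F
    using fps_eval_mono[OF _ l nil, of "2 * K"] by (simp add: fun_eq_iff)
  show ?thesis
    unfolding automorphism_def e
    using lin_fps_eval[OF l] bracket_fps_eval_exp[OF l nil, of 1]
    by (simp add: fps_eval_exp divpow_bracket[OF D])
qed

lemma automorphism_comp: "automorphism S \<Longrightarrow> automorphism T \<Longrightarrow> automorphism (\<lambda>x. S (T x))"
  by (simp add: automorphism_def lin_comp)

text \<open>The powers \<open>T\<^sup>n\<close> are polynomial in \<open>n\<close>; the coefficients of degree one in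
  \<open>T\<^sup>n [a, b] = [T\<^sup>n a, T\<^sup>n b]\<close> give the derivation rule.\<close>

lemma unipotent_automorphism_log:
  assumes T: "automorphism T" and nil: "\<And>x. ((\<lambda>x. T x - x) ^^ K) x = 0"
  obtains D F N where "derivation D" "\<forall>x. (D ^^ N) x = 0" "fps_nth F 0 = 0"
    "D = fps_eval N (\<lambda>x. T x - x) F" "T = fps_eval N D (fps_exp 1)"
proof -
  define M where "M = (\<lambda>x. T x - x)"
  \<comment> \<open>The truncation must reach beyond degree 1, so that evaluating
    \<open>1 + X\<close> at \<open>M\<close> really gives \<open>T\<close>, even for small
    \<open>K\<close>.\<close>
  define N where "N = K + 2"
  \<comment> \<open>The compositional inverse of \<open>exp - 1\<close> is the series
    \<open>log (1 + X)\<close>, hence \<open>D = log T\<close>.\<close>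
  define L where "L = fps_inv (fps_exp (1::'k) - 1)"
  define D where "D = fps_eval N M L"
  have T_lin: "lin T" and T_br: "\<And>a b. T (bracket a b) = bracket (T a) (T b)"
    using T by (auto simp: automorphism_def)
  have M: "lin M" unfolding M_def
    by (rule linI) (simp_all add: lin_add[OF T_lin] lin_scale[OF T_lin] scale_right_diff_distrib)
  have Mnil: "(M ^^ N) x = 0" for x
    by (rule funpow_zero_mono[OF M, of K]) (simp_all add: M_def nil N_def)
  have N: "N > 0" "2 \<le> N" by (simp_all add: N_def)
  have L0: "fps_nth L 0 = 0" by (simp add: L_def fps_inv_def)
  have D: "lin D" unfolding D_def by (rule lin_fps_eval[OF M])
  \<comment> \<open>\<open>D^N\<close> is the value of \<open>L ^ N\<close>, whose coefficients
    below degree \<open>N\<close> are zero.\<close>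
  have DN: "(D ^^ N) x = 0" for x
    unfolding D_def fps_eval_power[OF M Mnil N(1), symmetric]
    by (rule fps_eval_vanishing) (use startsby_zero_power_prefix[OF L0] in blast)
  have "(fps_exp 1 - 1) oo L = fps_X" unfolding L_def by (rule fps_inv_right) auto
  then have E: "fps_exp 1 oo L = 1 + fps_X"
    by (simp add: fps_compose_sub_distrib diff_eq_eq add.commute)
  have "fps_eval N M fps_X x = (\<Sum>k<N. if k = 1 then M x else 0)" for x
    unfolding fps_eval_def by (rule sum.cong) auto
  then have "fps_eval N M fps_X x = M x" for x using N(2) by simp
  moreover have "fps_eval N M (1 + fps_X) x = fps_eval N M 1 x + fps_eval N M fps_X x" for x
    by (simp add: fps_eval_def scale_left_distrib sum.distrib)
  ultimately have ev: "fps_eval N M (1 + fps_X) = T"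
    by (simp add: fun_eq_iff fps_eval_1[OF N(1)] M_def)
  have Tn: "(T ^^ n) x = fps_eval N D (fps_exp (of_nat n)) x" for n x
  proof -
    have "(T ^^ n) x = fps_eval N M ((fps_exp 1 oo L) ^ n) x"
      unfolding E fps_eval_power[OF M Mnil N(1)] ev ..
    also have "\<dots> = fps_eval N M (fps_exp (of_nat n) oo L) x"
      by (simp add: fps_compose_power[OF L0] fps_exp_power_mult)
    finally show ?thesis unfolding fps_eval_compose[OF M Mnil N(1) L0] D_def .
  qed
  have der: "D (bracket a b) = bracket (D a) b + bracket a (D b)" for a b
  proof -
    let ?v = "\<lambda>k. divpow D k (bracket a b) - (\<Sum>i\<le>k. bracket (divpow D i a) (divpow D (k - i) b))"
    have e: "fps_eval N D F = fps_eval (2 * N) D F" for F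
      using fps_eval_mono[OF _ D DN, of "2 * N"] by (simp add: fun_eq_iff)
    have "(\<Sum>k<2 * N. of_nat n ^ k *s ?v k) = 0" for n :: nat
    proof -
      have "(T ^^ n) (bracket a b) = bracket ((T ^^ n) a) ((T ^^ n) b)"
        by (induction n) (simp_all add: T_br)
      then have "fps_eval (2 * N) D (fps_exp (of_nat n)) (bracket a b) =
          (\<Sum>k<2 * N. of_nat n ^ k *s (\<Sum>i\<le>k. bracket (divpow D i a) (divpow D (k - i) b)))"
        unfolding Tn e bracket_fps_eval_exp[OF D DN] .
      then show ?thesis
        unfolding fps_eval_exp
        by (simp add: scale_right_diff_distrib sum_subtractf)
    qed
    from polynomial_coeffs_zero[OF _ this, of 1] have "?v 1 = 0"
      using N(2) infinite_UNIV_char_0 by (auto simp: finite_image_iff inj_of_nat)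
    then show ?thesis by (simp add: divpow_def add.commute)
  qed
  show ?thesis
  proof (rule that)
    show "derivation D" using D der by (simp add: derivation_def)
    show "\<forall>x. (D ^^ N) x = 0" using DN by blast
    show "fps_nth L 0 = 0" by (rule L0)
    show "D = fps_eval N (\<lambda>x. T x - x) L" by (simp add: D_def M_def)
    show "T = fps_eval N D (fps_exp 1)" using Tn[of 1] by (simp add: fun_eq_iff)
  qed
qed

text \<open>\<open>Sum_any\<close> returns 0 on an infinite support; nilpotency confines the support
  to indices below \<open>K\<close>, so \<open>exp_ad\<close> is the true exponential here.\<close>

lemma exp_ad_eq_fps_eval:
  assumes nil: "\<And>x. (bracket u ^^ K) x = 0"
  shows "exp_ad u = fps_eval K (bracket u) (fps_exp 1)"
proof
  fix x
  have "exp_ad u x = (\<Sum>k<K. inverse (fact k) *s (bracket u ^^ k) x)"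
    unfolding exp_ad_def
    by (rule Sum_any.expand_superset)
      (use funpow_zero_mono[OF lin_bracket nil] in \<open>auto simp: not_less[symmetric]\<close>)
  then show "exp_ad u x = fps_eval K (bracket u) (fps_exp 1) x"
    by (simp add: fps_eval_def divide_inverse)
qed

section \<open>Simplicity and the Killing form\<close>

lemma coord_eq_0: "coord x = 0 \<longleftrightarrow> x = 0"
proof
  assume "coord x = 0"
  then have "representation Basis x b = 0" for b
    by (simp add: coord_def fun_eq_iff)
  then show "x = 0"
    using rep_expand[OF independent_Basis span_Basis, of x] by simp
qed (simp add: coord_def fun_eq_iff representation_zero)

lemma ext_bracket_coord: "ext_bracket (coord x) (coord y) = coord (bracket x y)"
proof
  fix c
  note Bas = independent_Basis span_Basis
  let ?r = "representation Basis"
  have "coord (bracket x y) c =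
      coord (bracket (\<Sum>a\<in>Basis. ?r x a *s a) (\<Sum>b\<in>Basis. ?r y b *s b)) c"
    unfolding rep_expand[OF Bas] ..
  also have "\<dots> = (\<Sum>a\<in>Basis. \<Sum>b\<in>Basis. coord x a * coord y b * coord (bracket a b) c)"
    unfolding bracket_sum_left unfolding bracket_sum_right
    by (simp add: coord_def bracket_scale_left bracket_scale_right
        rep_sum[OF Bas] rep_scale[OF Bas] to_ac_sum mult_ac del: scale_scale)
  finally show "ext_bracket (coord x) (coord y) c = coord (bracket x y) c"
    by (simp add: ext_bracket_def)
qed

lemma ext_bracket_add_left: "ext_bracket (f + g) h = ext_bracket f h + ext_bracket g h"
  and ext_bracket_add_right: "ext_bracket f (g + h) = ext_bracket f g + ext_bracket f h"
  and ext_bracket_scale_left: "ext_bracket (fun_scale c f) g = fun_scale c (ext_bracket f g)"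
  and ext_bracket_scale_right: "ext_bracket f (fun_scale c g) = fun_scale c (ext_bracket f g)"
  and ext_bracket_zero_left: "ext_bracket 0 f = 0"
  and ext_bracket_zero_right: "ext_bracket f 0 = 0"
  by (simp_all add: ext_bracket_def fun_scale_def fun_eq_iff distrib_left distrib_right
      sum.distrib sum_distrib_left mult_ac)

text \<open>An ideal of \<open>g\<close> extends to an ideal of the scalar extension, and a proper subspace
  extends to a proper subspace.\<close>

lemma absolutely_simple_ideal:
  assumes simple: absolutely_simple and I: "subspace I" "\<And>x y. y \<in> I \<Longrightarrow> bracket x y \<in> I"
  shows "I = {0} \<or> I = UNIV"
proof -
  interpret F: vector_space "fun_scale :: 'k alg_closure \<Rightarrow> ('g \<Rightarrow> 'k alg_closure) \<Rightarrow> _"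
    by (rule vector_space_fun_scale)
  have base: "coord x \<in> extension V" if "x \<in> V" for x V
    unfolding extension_def using that by (intro F.span_base) auto
  have sub: "F.subspace (extension V)" for V
    unfolding extension_def by (rule F.subspace_span)
  have "ext_bracket f g \<in> extension I" if f: "f \<in> extension UNIV" and g: "g \<in> extension I" for f g
  proof -
    have 1: "ext_bracket f (coord y) \<in> extension I" if y: "y \<in> I" for y
    proof -
      have "F.subspace {f. ext_bracket f (coord y) \<in> extension I}"
        by (rule F.subspaceI) (auto simp: ext_bracket_add_left ext_bracket_scale_left
            ext_bracket_zero_left F.subspace_0[OF sub] F.subspace_add[OF sub] F.subspace_scale[OF sub])
      moreover have "coord ` UNIV \<subseteq> {f. ext_bracket f (coord y) \<in> extension I}"
        using base[OF I(2)[OF y]] by (auto simp: ext_bracket_coord)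
      ultimately have "extension UNIV \<subseteq> {f. ext_bracket f (coord y) \<in> extension I}"
        unfolding extension_def by (intro F.span_minimal)
      then show ?thesis using f by blast
    qed
    have "F.subspace {g. ext_bracket f g \<in> extension I}"
      by (rule F.subspaceI) (auto simp: ext_bracket_add_right ext_bracket_scale_right
          ext_bracket_zero_right F.subspace_0[OF sub] F.subspace_add[OF sub] F.subspace_scale[OF sub])
    moreover have "coord ` I \<subseteq> {g. ext_bracket f g \<in> extension I}"
      using 1 by auto
    ultimately have "extension I \<subseteq> {g. ext_bracket f g \<in> extension I}"
      unfolding extension_def[of I] by (intro F.span_minimal) (simp_all add: extension_def[of I])
    then show ?thesis using g by blast
  qed
  moreover have "extension I \<subseteq> extension UNIV"
    unfolding extension_def by (intro F.span_mono) auto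
  ultimately have "extension I = {0} \<or> extension I = extension UNIV"
    using simple sub unfolding absolutely_simple_def simple_lie_def by blast
  then show ?thesis
  proof
    assume "extension I = {0}"
    then have "x = 0" if "x \<in> I" for x using base[OF that] by (simp add: coord_eq_0)
    then show ?thesis using subspace_0[OF I(1)] by blast
  next
    assume E: "extension I = extension UNIV"
    have "v \<in> I" for v
    proof (rule ccontr)
      assume "v \<notin> I"
      then obtain \<phi> where "\<forall>x y. \<phi> (x + y) = \<phi> x + \<phi> y" "\<forall>c x. \<phi> (c *s x) = c * \<phi> x"
        "\<forall>x\<in>I. \<phi> x = 0" "\<phi> v = 1"
        by (rule separating_functional[OF I(1)])
      then have \<phi>: "\<And>x y. \<phi> (x + y) = \<phi> x + \<phi> y" "\<And>c x. \<phi> (c *s x) = c * \<phi> x"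
        "\<And>x. x \<in> I \<Longrightarrow> \<phi> x = 0" "\<phi> v = 1"
        by simp_all
      have \<phi>0: "\<phi> 0 = 0" using \<phi>(2)[of 0 0] by simp
      have \<phi>_sum: "\<phi> (sum f J) = (\<Sum>j\<in>J. \<phi> (f j))" for f :: "'g \<Rightarrow> 'g" and J
        by (induction J rule: infinite_finite_induct) (simp_all add: \<phi>(1) \<phi>0)
      \<comment> \<open>The linear extension of \<phi> to the algebraic closure: it vanishes on
        \<open>extension I\<close> but takes the value 1 at \<open>coord v\<close>.\<close>
      define \<Phi> where "\<Phi> f = (\<Sum>b\<in>Basis. f b * to_ac (\<phi> b))" for f
      have \<Phi>_coord: "\<Phi> (coord x) = to_ac (\<phi> x)" for x
      proof -
        have "\<Phi> (coord x) = to_ac (\<phi> (\<Sum>b\<in>Basis. representation Basis x b *s b))"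
          by (simp add: \<Phi>_def coord_def \<phi>_sum \<phi>(2) to_ac_sum)
        then show ?thesis unfolding rep_expand[OF independent_Basis span_Basis] .
      qed
      have "F.subspace {f. \<Phi> f = 0}"
        by (rule F.subspaceI) (auto simp: \<Phi>_def fun_scale_def distrib_right sum.distrib mult.assoc
            simp flip: sum_distrib_left)
      moreover have "coord ` I \<subseteq> {f. \<Phi> f = 0}" using \<phi>(3) by (auto simp: \<Phi>_coord)
      ultimately have "extension I \<subseteq> {f. \<Phi> f = 0}"
        unfolding extension_def by (intro F.span_minimal)
      then have "\<Phi> (coord v) = 0" using base[of v UNIV] E by auto
      then show False by (simp add: \<Phi>_coord \<phi>(4))
    qed
    then show ?thesis by blast
  qed
qed

text \<open>Applying \<open>ad h - \<phi>_k(h)\<close> removes the \<open>k\<close>-th summand and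
  rescales the others. Weights form an indexed family over an arbitrary set \<open>\<hh>\<close>, so
  that the same lemma covers the eigenvalues of a single element and weights shifted by a
  root.\<close>

lemma root_space_independent:
  assumes "finite I" "\<And>i. i \<in> I \<Longrightarrow> v i \<in> root_space \<hh> (\<phi> i)"
    and "\<And>i j. i \<in> I \<Longrightarrow> j \<in> I \<Longrightarrow> i \<noteq> j \<Longrightarrow> \<exists>h\<in>\<hh>. \<phi> i h \<noteq> \<phi> j h"
    and "(\<Sum>i\<in>I. v i) = 0" and "i \<in> I"
  shows "v i = 0"
  using assms
proof (induction I arbitrary: v i rule: finite_induct)
  case empty
  then show ?case by simp
next
  case (insert k I)
  have v: "bracket h (v i) = \<phi> i h *s v i" if "i \<in> insert k I" "h \<in> \<hh>" for i h
    using insert.prems(1)[OF that(1)] that(2) by (auto simp: root_space_def)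
  have vk: "v k + (\<Sum>i\<in>I. v i) = 0" using insert.prems(3) insert.hyps by simp
  have z: "(\<phi> i h - \<phi> k h) *s v i = 0" if i: "i \<in> I" and h: "h \<in> \<hh>" for i h
  proof (rule insert.IH[of "\<lambda>i. (\<phi> i h - \<phi> k h) *s v i"])
    show "(\<phi> j h - \<phi> k h) *s v j \<in> root_space \<hh> (\<phi> j)" if "j \<in> I" for j
      using insert.prems(1)[of j] that
      by (simp add: root_space_def bracket_scale_right mult.commute)
    have "bracket h (v k + (\<Sum>i\<in>I. v i)) = 0" by (simp add: vk)
    then have "\<phi> k h *s v k + (\<Sum>i\<in>I. \<phi> i h *s v i) = 0"
      using h by (simp add: bracket_add_right bracket_sum_right v)
    moreover have "\<phi> k h *s v k + (\<Sum>i\<in>I. \<phi> k h *s v i) = 0"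
      using arg_cong[OF vk, of "\<lambda>x. \<phi> k h *s x"] by (simp add: scale_right_distrib scale_sum_right)
    ultimately have "(\<Sum>i\<in>I. \<phi> i h *s v i) = (\<Sum>i\<in>I. \<phi> k h *s v i)"
      by (metis add_left_cancel)
    then show "(\<Sum>i\<in>I. (\<phi> i h - \<phi> k h) *s v i) = 0"
      by (simp add: scale_left_diff_distrib sum_subtractf)
    show "\<exists>h\<in>\<hh>. \<phi> i h \<noteq> \<phi> j h" if "i \<in> I" "j \<in> I" "i \<noteq> j" for i j
      using insert.prems(2) that by blast
  qed (rule i)
  have "v i = 0" if i: "i \<in> I" for i
  proof -
    have "i \<noteq> k" using i insert.hyps(2) by blast
    then obtain h where "h \<in> \<hh>" "\<phi> i h \<noteq> \<phi> k h"
      using insert.prems(2)[of i k] i by auto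
    then show ?thesis using z[OF i, of h] by simp
  qed
  then show ?case using insert.prems(4) vk by auto
qed

lemma subspace_root_space: "subspace (root_space \<hh> \<phi>)"
  by (rule subspaceI) (auto simp: root_space_def bracket_add_right bracket_scale_right
      scale_right_distrib mult.commute)

lemma root_space_bracket:
  assumes "x \<in> root_space \<hh> \<phi>" "y \<in> root_space \<hh> \<psi>"
  shows "bracket x y \<in> root_space \<hh> (\<phi> + \<psi>)"
  using assms by (auto simp: root_space_def leibniz[of _ x y] bracket_scale_left bracket_scale_right
      scale_left_distrib)

section \<open>The Killing form\<close>

definition kappa :: "'g \<Rightarrow> 'g \<Rightarrow> 'k" where
  "kappa x y = trace (\<lambda>z. bracket x (bracket y z))"

lemma kappa_commute: "kappa x y = kappa y x"
  unfolding kappa_def by (rule trace_comm[OF lin_bracket lin_bracket])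

lemma kappa_add_left: "kappa (x + y) z = kappa x z + kappa y z"
  by (simp add: kappa_def bracket_add_left trace_add)

lemma kappa_scale_left: "kappa (c *s x) z = c * kappa x z"
  by (simp add: kappa_def bracket_scale_left trace_scale)

lemma kappa_add_right: "kappa x (y + z) = kappa x y + kappa x z"
  by (simp add: kappa_commute[of x] kappa_add_left)

lemma kappa_scale_right: "kappa x (c *s z) = c * kappa x z"
  by (simp add: kappa_commute[of x] kappa_scale_left)

lemma kappa_zero_left [simp]: "kappa 0 x = 0"
  using kappa_scale_left[of 0 0 x] by simp

lemma kappa_zero_right [simp]: "kappa x 0 = 0"
  by (simp add: kappa_commute[of x])

lemma kappa_minus_left: "kappa (- x) y = - kappa x y"
  using kappa_scale_left[of "-1" x y] by simp

lemma kappa_bracket: "kappa (bracket x y) z = kappa x (bracket y z)"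
proof -
  have 1: "lin (\<lambda>w. bracket x (bracket z w))" by (rule lin_comp[OF lin_bracket lin_bracket])
  show ?thesis
    unfolding kappa_def bracket_bracket_left bracket_diff_right trace_diff
    using trace_comm[OF lin_bracket 1, of y] by simp
qed

end

text \<open>The grading is carried by \<open>H\<close> alone. Replacing \<open>H\<close> by
  \<open>-H\<close> preserves the assumptions and exchanges degrees 1 and -1, so every result about
  degree 1 has a mirror image.\<close>

locale short_graded = lie_algebra scale Basis bracket
  for scale :: "'k::field_char_0 \<Rightarrow> 'g::ab_group_add \<Rightarrow> 'g" (infixr \<open>*s\<close> 75)
    and Basis :: "'g set"
    and bracket :: "'g \<Rightarrow> 'g \<Rightarrow> 'g" +
  fixes H :: 'g
  assumes decomp: "\<exists>a b c. x = a + b + c \<and> bracket H a = - a \<and> bracket H b = 0 \<and> bracket H c = c"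
    and not_central: "\<exists>x. bracket H x \<noteq> 0"
    and ideals: "subspace I \<Longrightarrow> (\<And>x y. y \<in> I \<Longrightarrow> bracket x y \<in> I) \<Longrightarrow> I = {0} \<or> I = UNIV"
begin

definition deg :: "'k \<Rightarrow> 'g set" where
  "deg c = {x. bracket H x = c *s x}"

lemma subspace_deg: "subspace (deg c)"
  by (rule subspaceI) (auto simp: deg_def bracket_add_right bracket_scale_right scale_right_distrib
      mult.commute)

lemmas deg_add = subspace_add[OF subspace_deg]
  and deg_scale = subspace_scale[OF subspace_deg]
  and deg_zero = subspace_0[OF subspace_deg]

lemma deg_bracket: "x \<in> deg c \<Longrightarrow> y \<in> deg d \<Longrightarrow> c + d = e \<Longrightarrow> bracket x y \<in> deg e"
  by (auto simp: deg_def leibniz[of H] bracket_scale_left bracket_scale_right scale_left_distrib)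

lemma deg_cases:
  obtains a b c where "x = a + b + c" "a \<in> deg (-1)" "b \<in> deg 0" "c \<in> deg 1"
  using decomp[of x] unfolding deg_def by auto

lemma deg_trivial:
  assumes x: "x \<in> deg c" and c: "c \<noteq> -1" "c \<noteq> 0" "c \<noteq> 1"
  shows "x = 0"
proof -
  obtain u v w where d: "x = u + v + w" "u \<in> deg (-1)" "v \<in> deg 0" "w \<in> deg 1" by (rule deg_cases)
  \<comment> \<open>These are the homogeneous components of \<open>c x - [H, x]\<close>, which is
    zero.\<close>
  let ?f = "\<lambda>i :: 'k. if i = -1 then (c + 1) *s u else if i = 0 then c *s v else (c - 1) *s w"
  have e: "- u + w = c *s x"
    using x d by (simp add: deg_def bracket_add_right)
  have "(\<Sum>i\<in>{-1, 0, 1}. ?f i) = (c + 1) *s u + (c *s v + (c - 1) *s w)"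
    by simp
  also have "\<dots> = c *s x - (- u + w)"
    unfolding d(1) by (simp add: scale_left_distrib scale_left_diff_distrib scale_right_distrib)
  finally have s: "(\<Sum>i\<in>{-1, 0, 1}. ?f i) = 0" by (simp only: e diff_self)
  have "?f i = 0" if "i \<in> {-1, 0, 1}" for i
    by (rule root_space_independent[of "{-1, 0, 1}" ?f "{H}" "\<lambda>i _. i"])
      (use s that d in \<open>auto simp: root_space_def deg_def bracket_scale_right mult.commute
        scale_left_distrib scale_left_diff_distrib bracket_add_right bracket_diff_right\<close>)
  from this[of "-1"] this[of 0] this[of 1]
  have z: "(c + 1) *s u = 0" "c *s v = 0" "(c - 1) *s w = 0" by simp_all
  have "c + 1 \<noteq> 0" using c(1) eq_neg_iff_add_eq_0[of c 1] by blast
  then have "u = 0" using z(1) scale_eq_0_iff by blast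
  moreover have "v = 0" using z(2) c(2) by simp
  moreover have "w = 0" using z(3) c(3) by simp
  ultimately show ?thesis using d(1) by simp
qed

text \<open>In a homogeneous basis \<open>(ad H)^2\<close> is diagonal with entries 0 and 1. Its
  trace counts the basis vectors of degree 1 or -1, and a positive integer is nonzero in
  characteristic 0.\<close>

lemma kappa_H: "kappa H H \<noteq> 0"
proof -
  let ?V = "deg (-1) \<union> deg 0 \<union> deg 1"
  obtain B where B: "B \<subseteq> ?V" "independent B" "?V \<subseteq> span B"
    by (rule maximal_independent_subset[of ?V])
  have sB: "span B = UNIV"
  proof -
    have "x \<in> span B" for x
      using deg_cases[of x] B(3) span_add by (metis UnCI subsetD)
    then show ?thesis by blast
  qed
  have "representation B (bracket H (bracket H b)) b = (if b \<in> deg 0 then 0 else 1)" if b: "b \<in> B" for b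
  proof (cases "b \<in> deg 0")
    case True
    then show ?thesis by (simp add: deg_def representation_zero)
  next
    case False
    then have "bracket H (bracket H b) = b" using B(1) b by (auto simp: deg_def)
    then show ?thesis using representation_basis[OF B(2) b] False by simp
  qed
  then have "kappa H H = (\<Sum>b\<in>B. if b \<in> deg 0 then 0 else 1)"
    unfolding kappa_def trace_basis[OF lin_comp[OF lin_bracket lin_bracket] B(2) sB] by simp
  also have "\<dots> = of_nat (card {b \<in> B. b \<notin> deg 0})"
    using finiteI_independent[OF B(2)] by (simp add: sum.If_cases Int_def Collect_neg_eq[symmetric])
  finally have *: "kappa H H = of_nat (card {b \<in> B. b \<notin> deg 0})" .
  have "{b \<in> B. b \<notin> deg 0} \<noteq> {}"
  proof
    assume "{b \<in> B. b \<notin> deg 0} = {}"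
    then have "span B \<subseteq> deg 0" by (intro span_minimal subspace_deg) blast
    then show False using not_central sB by (auto simp: deg_def)
  qed
  then show ?thesis using * finiteI_independent[OF B(2)] by (simp add: card_eq_0_iff)
qed

text \<open>By invariance the radical of the form is an ideal, and it does not contain
  \<open>H\<close>.\<close>

lemma kappa_nondegenerate:
  assumes "\<And>y. kappa x y = 0"
  shows "x = 0"
proof -
  let ?R = "{x. \<forall>y. kappa x y = 0}"
  have "?R = {0} \<or> ?R = UNIV"
  proof (rule ideals)
    show "subspace ?R" by (rule subspaceI) (auto simp: kappa_add_left kappa_scale_left)
    show "bracket z x \<in> ?R" if "x \<in> ?R" for z x
      using that by (simp add: bracket_anti[of z x] kappa_minus_left kappa_bracket)
  qed
  moreover have "H \<notin> ?R" using kappa_H by blast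
  ultimately show ?thesis using assms by blast
qed

lemma kappa_deg:
  assumes "x \<in> deg c" "y \<in> deg d" "c + d \<noteq> 0"
  shows "kappa x y = 0"
proof -
  have "c * kappa x y = - (d * kappa x y)"
    using kappa_bracket[of x H y] assms(1,2)
    by (simp add: deg_def bracket_anti[of x H] kappa_minus_left kappa_scale_left kappa_scale_right
)
      (metis minus_minus)
  then show ?thesis using assms(3) by (simp add: eq_neg_iff_add_eq_0 flip: distrib_right)
qed

text \<open>Nondegeneracy makes the map from \<open>w\<close> to the values of
  \<open>kappa w\<close> on the basis injective; in finite dimension it is then surjective.\<close>

lemma kappa_representation:
  assumes add: "\<And>x y. \<phi> (x + y) = \<phi> x + \<phi> y" and scale: "\<And>c x. \<phi> (c *s x) = c * \<phi> x"
  obtains w where "\<And>x. \<phi> x = kappa w x"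
proof -
  note Bas = independent_Basis span_Basis
  have \<phi>0: "\<phi> 0 = 0" using scale[of 0 0] by simp
  have \<phi>_sum: "\<phi> (sum f J) = (\<Sum>j\<in>J. \<phi> (f j))" for f :: "'g \<Rightarrow> 'g" and J
    by (induction J rule: infinite_finite_induct) (simp_all add: add \<phi>0)
  have kappa_sum: "kappa w (sum f J) = (\<Sum>j\<in>J. kappa w (f j))" for f :: "'g \<Rightarrow> 'g" and J w
    by (induction J rule: infinite_finite_induct) (simp_all add: kappa_add_right)
  let ?A = "\<lambda>w. \<Sum>b\<in>Basis. kappa w b *s b"
  have A: "lin ?A"
    by (rule linI) (simp_all add: kappa_add_left kappa_scale_left scale_left_distrib sum.distrib
        scale_sum_right)
  have rep: "representation Basis (\<Sum>b\<in>Basis. f b *s b) b = f b" if "b \<in> Basis" for f b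
  proof -
    have "representation Basis (\<Sum>b\<in>Basis. f b *s b) b = (\<Sum>c\<in>Basis. if c = b then f c else 0)"
      unfolding rep_sum[OF Bas] rep_scale[OF Bas]
      by (rule sum.cong) (auto simp: representation_basis[OF independent_Basis])
    then show ?thesis using that finite_Basis by simp
  qed
  have "inj ?A"
  proof (rule injI)
    fix u v assume "?A u = ?A v"
    then have e: "kappa u b = kappa v b" if "b \<in> Basis" for b
      using rep[OF that, of "kappa u"] rep[OF that, of "kappa v"] by simp
    have "kappa (u - v) x = 0" for x
    proof -
      have "kappa (u - v) (\<Sum>b\<in>Basis. representation Basis x b *s b) = 0"
        unfolding kappa_sum kappa_scale_right
        using e kappa_add_left[of u "- v"] by (simp add: kappa_minus_left)
      then show ?thesis unfolding rep_expand[OF Bas] .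
    qed
    then show "u = v" using kappa_nondegenerate[of "u - v"] by simp
  qed
  then have "surj ?A" by (rule linear_inj_imp_surj[OF A])
  then obtain w where w: "(\<Sum>b\<in>Basis. \<phi> b *s b) = ?A w" by (rule surjE)
  have wb: "\<phi> b = kappa w b" if "b \<in> Basis" for b
    using rep[OF that, of \<phi>] rep[OF that, of "kappa w"] w by simp
  have "\<phi> x = kappa w x" for x
  proof -
    have "\<phi> (\<Sum>b\<in>Basis. representation Basis x b *s b) = kappa w (\<Sum>b\<in>Basis. representation Basis x b *s b)"
      unfolding kappa_sum kappa_scale_right \<phi>_sum scale using wb by simp
    then show ?thesis unfolding rep_expand[OF Bas] .
  qed
  then show ?thesis by (rule that)
qed

text \<open>With \<open>E = D - ad w\<close> orthogonal to all \<open>ad z\<close> for the trace form,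
  \<open>\<kappa> (E a) b = tr ([E, ad a] ad b) = tr (E (ad [a, b])) = 0\<close>.\<close>

lemma derivation_inner:
  assumes "derivation D"
  obtains w where "D = bracket w"
proof -
  have D: "lin D" and der: "\<And>a b. D (bracket a b) = bracket (D a) b + bracket a (D b)"
    using assms by (auto simp: derivation_def)
  let ?\<phi> = "\<lambda>z. trace (\<lambda>x. D (bracket z x))"
  obtain w where w: "\<And>z. ?\<phi> z = kappa w z"
    by (rule kappa_representation[of ?\<phi>])
      (simp_all add: bracket_add_left bracket_scale_left lin_add[OF D] lin_scale[OF D]
        trace_add trace_scale)
  define E where "E = (\<lambda>x. D x - bracket w x)"
  have E: "lin E" unfolding E_def
    by (rule linI) (simp_all add: lin_add[OF D] lin_scale[OF D] bracket_add_right bracket_scale_right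
        scale_right_diff_distrib)
  have Eder: "E (bracket a b) = bracket (E a) b + bracket a (E b)" for a b
    by (simp add: E_def der leibniz[of w] bracket_diff_left bracket_diff_right)
  have Etr: "trace (\<lambda>x. E (bracket z x)) = 0" for z
    unfolding E_def trace_diff using w[of z] by (simp add: kappa_def)
  have "E a = 0" for a
  proof (rule kappa_nondegenerate)
    fix b
    have 1: "lin (\<lambda>x. E (bracket b x))" by (rule lin_comp[OF E lin_bracket])
    have "kappa (E a) b = trace (\<lambda>x. E (bracket a (bracket b x)) - bracket a (E (bracket b x)))"
      by (simp add: kappa_def Eder)
    also have "\<dots> = trace (\<lambda>x. E (bracket a (bracket b x)) - E (bracket b (bracket a x)))"
      unfolding trace_diff using trace_comm[OF lin_bracket 1, of a] by simp
    also have "\<dots> = trace (\<lambda>x. E (bracket (bracket a b) x))"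
      by (simp add: bracket_bracket_left lin_diff[OF E])
    finally show "kappa (E a) b = 0" by (simp add: Etr)
  qed
  then have "D = bracket w" by (auto simp: E_def)
  then show ?thesis by (rule that)
qed

text \<open>Degree -1 pairs only with degree 1, and there
  \<open>kappa y c = - kappa H [y, c]\<close>.\<close>

lemma deg_minus_faithful:
  assumes y: "y \<in> deg (-1)" and "\<And>w. w \<in> deg 1 \<Longrightarrow> bracket y w = 0"
  shows "y = 0"
proof (rule kappa_nondegenerate)
  fix x
  obtain a b c where x: "x = a + b + c" "a \<in> deg (-1)" "b \<in> deg 0" "c \<in> deg 1" by (rule deg_cases)
  have "- kappa y c = kappa (bracket H y) c" using y by (simp add: deg_def kappa_minus_left)
  also have "\<dots> = 0" using assms(2)[OF x(4)] by (simp add: kappa_bracket)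
  finally show "kappa y x = 0"
    using kappa_deg[OF y x(2)] kappa_deg[OF y x(3)] by (simp add: x(1) kappa_add_right)
qed

text \<open>By duality of degrees 1 and -1, an element of degree 0 that kills degree 1 also kills
  degree -1. The elements of degree 0 killing both form an ideal, and \<open>H\<close> is not among
  them.\<close>

lemma deg_zero_faithful:
  assumes "v \<in> deg 0" and "\<And>w. w \<in> deg 1 \<Longrightarrow> bracket v w = 0"
  shows "v = 0"
proof -
  let ?J = "{v \<in> deg 0. \<forall>w\<in>deg 1 \<union> deg (-1). bracket v w = 0}"
  have "?J = {0} \<or> ?J = UNIV"
  proof (rule ideals)
    show "subspace ?J"
      by (rule subspaceI) (auto simp: deg_zero deg_add deg_scale bracket_add_left bracket_scale_left)
  next
    fix x v assume v: "v \<in> ?J"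
    obtain a b c where x: "x = a + b + c" "a \<in> deg (-1)" "b \<in> deg 0" "c \<in> deg 1" by (rule deg_cases)
    have "bracket a v = 0" "bracket c v = 0"
      using v x by (auto simp: bracket_eq_0_commute[of _ v])
    then have e: "bracket x v = bracket b v" by (simp add: x(1) bracket_add_left)
    moreover have "bracket (bracket b v) w = 0" if "w \<in> deg 1 \<union> deg (-1)" for w
    proof -
      have "bracket b w \<in> deg 1 \<union> deg (-1)" using deg_bracket[OF x(3)] that by auto
      then show ?thesis using v that by (simp add: bracket_bracket_left)
    qed
    moreover have "bracket b v \<in> deg 0" using deg_bracket[OF x(3)] v by simp
    ultimately show "bracket x v \<in> ?J" by simp
  qed
  moreover have "H \<notin> ?J"
  proof
    assume "H \<in> ?J"
    then have z: "bracket H w = 0" if "w \<in> deg 1 \<union> deg (-1)" for w using that by simp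
    have "bracket H x = 0" for x
    proof -
      obtain a b c where x: "x = a + b + c" "a \<in> deg (-1)" "b \<in> deg 0" "c \<in> deg 1" by (rule deg_cases)
      have "bracket H b = 0" using x(3) by (simp add: deg_def)
      then show ?thesis using z[of a] z[of c] x by (simp add: bracket_add_right)
    qed
    then show False using not_central by blast
  qed
  moreover have "bracket v y = 0" if y: "y \<in> deg (-1)" for y
  proof (rule kappa_nondegenerate)
    fix x
    obtain a b c where x: "x = a + b + c" "a \<in> deg (-1)" "b \<in> deg 0" "c \<in> deg 1" by (rule deg_cases)
    have vy: "bracket v y \<in> deg (-1)" using deg_bracket[OF assms(1) y] by simp
    have "kappa (bracket v y) c = - kappa (bracket y v) c"
      by (simp add: bracket_anti[of v y] kappa_minus_left)
    also have "\<dots> = 0" using assms(2)[OF x(4)] by (simp add: kappa_bracket)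
    finally show "kappa (bracket v y) x = 0"
      using kappa_deg[OF vy x(2)] kappa_deg[OF vy x(3)] by (simp add: x(1) kappa_add_right)
  qed
  ultimately show ?thesis using assms by blast
qed

end

section \<open>Root spaces\<close>

context lie_algebra
begin

lemma span_UN_sum:
  assumes V: "\<And>i. subspace (V i)" and x: "x \<in> span (\<Union>i\<in>I. V i)"
  shows "\<exists>J f. finite J \<and> J \<subseteq> I \<and> (\<forall>j\<in>J. f j \<in> V j) \<and> x = sum f J"
  using x
proof (induction rule: span_induct_alt)
  case base
  show ?case by (intro exI[of _ "{}"]) simp
next
  case (step c y z)
  then obtain J f where J: "finite J" "J \<subseteq> I" "\<forall>j\<in>J. f j \<in> V j" "z = sum f J" by blast
  from step obtain i where i: "i \<in> I" "y \<in> V i" by blast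
  let ?f = "\<lambda>j. (if j \<in> J then f j else 0) + (if j = i then c *s y else 0)"
  have "?f j \<in> V j" if "j \<in> insert i J" for j
    using that i J(3) V by (auto simp: subspace_add subspace_scale subspace_0)
  moreover have "c *s y + z = sum ?f (insert i J)"
  proof -
    have "sum ?f (insert i J) = (\<Sum>j\<in>insert i J. if j \<in> J then f j else 0) + (\<Sum>j\<in>insert i J. if j = i then c *s y else 0)"
      by (rule sum.distrib)
    also have "(\<Sum>j\<in>insert i J. if j \<in> J then f j else 0) = sum f J"
      by (rule sum.mono_neutral_cong_right) (use J(1) in auto)
    also have "(\<Sum>j\<in>insert i J. if j = i then c *s y else 0) = c *s y"
      using J(1) by (simp add: sum.delta')
    finally show ?thesis using J(4) by (simp add: add.commute)
  qed
  ultimately show ?case using J(1,2) i(1) by (intro exI[of _ "insert i J"] exI[of _ ?f]) auto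
qed

text \<open>Split a joint eigenvector of \<open>\<hh>\<close> into eigenvectors \<open>f c\<close>
  of \<open>ad h\<close>. Since \<open>g\<close> commutes with \<open>h\<close>, the vectors
  \<open>[g, f c] - \<phi>(g) f c\<close> are again eigenvectors of \<open>ad h\<close> with
  distinct eigenvalues; they sum to zero, so each one vanishes.\<close>

lemma joint_eigenvectors_span:
  assumes "finite \<hh>" "\<And>h. h \<in> \<hh> \<Longrightarrow> ad_diagonalizable h"
    and "\<And>g h. g \<in> \<hh> \<Longrightarrow> h \<in> \<hh> \<Longrightarrow> bracket g h = 0"
  shows "span (\<Union>\<phi>. root_space \<hh> \<phi>) = UNIV"
  using assms
proof (induction \<hh> rule: finite_induct)
  case empty
  show ?case by (simp add: root_space_def)
next
  case (insert h \<hh>)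
  let ?E = "\<lambda>c. root_space {h} (\<lambda>_. c)"
  let ?U = "\<Union>\<phi>. root_space (insert h \<hh>) \<phi>"
  have "{x. \<exists>c. bracket h x = c *s x} = (\<Union>c. ?E c)" by (auto simp: root_space_def)
  then have sp: "span (\<Union>c. ?E c) = UNIV"
    using insert.prems(1)[of h] by (simp add: ad_diagonalizable_def)
  have "x \<in> span ?U" if x: "x \<in> root_space \<hh> \<phi>" for x \<phi>
  proof -
    obtain C f where C: "finite C" "\<forall>c\<in>C. f c \<in> ?E c" "x = sum f C"
      using span_UN_sum[of ?E x UNIV, OF subspace_root_space] sp by auto
    have "f c \<in> root_space (insert h \<hh>) (\<phi>(h := c))" if c: "c \<in> C" for c
    proof -
      have "bracket g (f c) = \<phi> g *s f c" if g: "g \<in> \<hh>" for g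
      proof -
        let ?v = "\<lambda>c. bracket g (f c) - \<phi> g *s f c"
        have hg: "bracket h g = 0" using insert.prems(2) g by blast
        have "?v c = 0"
        proof (rule root_space_independent[of C ?v "{h}" "\<lambda>c _. c"])
          fix d assume "d \<in> C"
          then have "bracket h (f d) = d *s f d" using C(2) by (auto simp: root_space_def)
          then show "?v d \<in> ?E d"
            by (simp add: root_space_def bracket_diff_right leibniz[of h g] hg bracket_scale_right
                scale_right_diff_distrib mult.commute)
        next
          have "(\<Sum>c\<in>C. ?v c) = bracket g x - \<phi> g *s x"
            by (simp add: C(3) sum_subtractf bracket_sum_right scale_sum_right)
          also have "\<dots> = 0" using x g by (simp add: root_space_def)
          finally show "(\<Sum>c\<in>C. ?v c) = 0" .
        qed (use C(1) c in auto)
        then show ?thesis by simp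
      qed
      moreover have "bracket h (f c) = c *s f c" using C(2) c by (auto simp: root_space_def)
      ultimately show ?thesis using insert.hyps(2) by (auto simp: root_space_def)
    qed
    then have "f c \<in> span ?U" if "c \<in> C" for c
      using that by (intro span_base) blast
    then show ?thesis unfolding C(3) by (intro span_sum)
  qed
  then have "(\<Union>\<phi>. root_space \<hh> \<phi>) \<subseteq> span ?U" by blast
  then have "span (\<Union>\<phi>. root_space \<hh> \<phi>) \<subseteq> span ?U" by (intro span_minimal subspace_span)
  moreover have "span (\<Union>\<phi>. root_space \<hh> \<phi>) = UNIV"
    using insert.IH insert.prems by blast
  ultimately show ?case by blast
qed

lemma ad_eigenvalue_in_dual:
  assumes a: "subspace \<aa>" and x: "x \<noteq> 0" and eig: "\<forall>h\<in>\<aa>. \<exists>c. bracket h x = c *s x"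
  shows "\<exists>\<phi>\<in>dual \<aa>. x \<in> root_space \<aa> \<phi>"
proof -
  obtain \<psi> where \<psi>: "\<And>h. h \<in> \<aa> \<Longrightarrow> bracket h x = \<psi> h *s x" using eig by metis
  let ?\<phi> = "\<lambda>h. if h \<in> \<aa> then \<psi> h else 0"
  have "\<psi> (g + h) = \<psi> g + \<psi> h" if "g \<in> \<aa>" "h \<in> \<aa>" for g h
  proof -
    have "\<psi> (g + h) *s x = (\<psi> g + \<psi> h) *s x"
      using \<psi>[OF that(1)] \<psi>[OF that(2)] \<psi>[OF subspace_add[OF a that]]
      by (simp add: bracket_add_left scale_left_distrib)
    then show ?thesis using x by simp
  qed
  moreover have "\<psi> (c *s h) = c * \<psi> h" if "h \<in> \<aa>" for c h
  proof -
    have "\<psi> (c *s h) *s x = (c * \<psi> h) *s x"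
      unfolding \<psi>[OF subspace_scale[OF a that], symmetric] bracket_scale_left \<psi>[OF that] by simp
    then show ?thesis using x by simp
  qed
  ultimately have "?\<phi> \<in> dual \<aa>"
    unfolding dual_def using subspace_add[OF a] subspace_scale[OF a] by auto
  moreover have "x \<in> root_space \<aa> ?\<phi>" using \<psi> by (simp add: root_space_def)
  ultimately show ?thesis by blast
qed

text \<open>Simultaneous diagonalization is available for finite sets, so it is applied to a basis
  of \<open>\<aa>\<close>; a common eigenvector of the basis is one for all of \<open>\<aa>\<close>,
  and its eigenvalue is a linear form.\<close>

lemma span_dual_root_spaces:
  assumes a: "split_abelian \<aa>"
  shows "span (\<Union>\<phi>\<in>dual \<aa>. root_space \<aa> \<phi>) = UNIV"
proof -
  have sa: "subspace \<aa>" and comm: "\<And>x y. x \<in> \<aa> \<Longrightarrow> y \<in> \<aa> \<Longrightarrow> bracket x y = 0"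
    and diag: "\<And>h. h \<in> \<aa> \<Longrightarrow> ad_diagonalizable h"
    using a by (auto simp: split_abelian_def)
  obtain B where B: "B \<subseteq> \<aa>" "independent B" "\<aa> \<subseteq> span B"
    by (rule maximal_independent_subset[of \<aa>])
  have "x \<in> span (\<Union>\<phi>\<in>dual \<aa>. root_space \<aa> \<phi>)" if x: "x \<in> root_space B \<phi>" for x \<phi>
  proof (cases "x = 0")
    case True
    then show ?thesis by (simp add: span_zero)
  next
    case False
    have "subspace {h. \<exists>c. bracket h x = c *s x}"
    proof (rule subspaceI)
      show "0 \<in> {h. \<exists>c. bracket h x = c *s x}" by (auto intro: exI[of _ 0])
    next
      fix g h assume "g \<in> {h. \<exists>c. bracket h x = c *s x}" "h \<in> {h. \<exists>c. bracket h x = c *s x}"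
      then obtain c d where "bracket g x = c *s x" "bracket h x = d *s x" by blast
      then have "bracket (g + h) x = (c + d) *s x" by (simp add: bracket_add_left scale_left_distrib)
      then show "g + h \<in> {h. \<exists>c. bracket h x = c *s x}" by blast
    next
      fix d h assume "h \<in> {h. \<exists>c. bracket h x = c *s x}"
      then obtain c where "bracket h x = c *s x" by blast
      then have "bracket (d *s h) x = (d * c) *s x" by (simp add: bracket_scale_left)
      then show "d *s h \<in> {h. \<exists>c. bracket h x = c *s x}" by blast
    qed
    moreover have "B \<subseteq> {h. \<exists>c. bracket h x = c *s x}" using x by (auto simp: root_space_def)
    ultimately have "\<aa> \<subseteq> {h. \<exists>c. bracket h x = c *s x}" using B(3) span_minimal by blast
    then have "\<exists>\<phi>\<in>dual \<aa>. x \<in> root_space \<aa> \<phi>"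
      by (intro ad_eigenvalue_in_dual[OF sa False]) blast
    then show ?thesis by (intro span_base) blast
  qed
  then have "(\<Union>\<phi>. root_space B \<phi>) \<subseteq> span (\<Union>\<phi>\<in>dual \<aa>. root_space \<aa> \<phi>)" by blast
  then have "span (\<Union>\<phi>. root_space B \<phi>) \<subseteq> span (\<Union>\<phi>\<in>dual \<aa>. root_space \<aa> \<phi>)"
    by (intro span_minimal subspace_span)
  moreover have "span (\<Union>\<phi>. root_space B \<phi>) = UNIV"
    by (rule joint_eigenvectors_span[OF finiteI_independent[OF B(2)]]) (use B(1) comm diag in blast)+
  ultimately show ?thesis by blast
qed

lemma root_decomposition:
  assumes "split_abelian \<aa>"
  obtains \<Lambda> v where "finite \<Lambda>" "\<Lambda> \<subseteq> dual \<aa>" "\<forall>\<phi>\<in>\<Lambda>. v \<phi> \<in> root_space \<aa> \<phi>" "x = sum v \<Lambda>"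
  using span_UN_sum[of "root_space \<aa>" x "dual \<aa>", OF subspace_root_space]
    span_dual_root_spaces[OF assms] by auto

lemma dual_neqD: "\<phi> \<in> dual \<aa> \<Longrightarrow> \<psi> \<in> dual \<aa> \<Longrightarrow> \<phi> \<noteq> \<psi> \<Longrightarrow> \<exists>h\<in>\<aa>. \<phi> h \<noteq> \<psi> h"
  by (rule ccontr) (auto simp: dual_def fun_eq_iff)

lemma dual_add: "\<phi> \<in> dual \<aa> \<Longrightarrow> \<psi> \<in> dual \<aa> \<Longrightarrow> \<phi> + \<psi> \<in> dual \<aa>"
  and dual_diff: "\<phi> \<in> dual \<aa> \<Longrightarrow> \<psi> \<in> dual \<aa> \<Longrightarrow> \<phi> - \<psi> \<in> dual \<aa>"
  and dual_uminus: "\<phi> \<in> dual \<aa> \<Longrightarrow> - \<phi> \<in> dual \<aa>"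
  and dual_zero: "0 \<in> dual \<aa>"
  by (auto simp: dual_def algebra_simps)

lemma root_dual: "\<phi> \<in> roots \<aa> \<Longrightarrow> \<phi> \<in> dual \<aa>"
  by (simp add: roots_def)

lemma root_spaces_independent:
  assumes "finite \<Lambda>" "\<Lambda> \<subseteq> dual \<aa>" "\<forall>\<phi>\<in>\<Lambda>. v \<phi> \<in> root_space \<aa> \<phi>" "sum v \<Lambda> = 0" "\<phi> \<in> \<Lambda>"
  shows "v \<phi> = 0"
  by (rule root_space_independent[of \<Lambda> v \<aa> "\<lambda>\<phi>. \<phi>"]) (use assms dual_neqD in blast)+

text \<open>Nonzero vectors from distinct root spaces are independent, so every finite set of roots
  has at most as many elements as a basis; this uniform bound gives finiteness.\<close>

lemma finite_roots: "finite (roots \<aa>)"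
proof -
  obtain v where v: "\<And>\<phi>. \<phi> \<in> roots \<aa> \<Longrightarrow> v \<phi> \<in> root_space \<aa> \<phi> \<and> v \<phi> \<noteq> 0"
  proof -
    have "\<exists>x. x \<in> root_space \<aa> \<phi> \<and> x \<noteq> 0" if "\<phi> \<in> roots \<aa>" for \<phi>
      using that subspace_0[OF subspace_root_space[of \<aa> \<phi>]] by (auto simp: roots_def)
    then show ?thesis using that by metis
  qed
  have "card \<Phi> \<le> card Basis" if \<Phi>: "\<Phi> \<subseteq> roots \<aa>" "finite \<Phi>" for \<Phi>
  proof -
    have sub: "\<Phi> \<subseteq> dual \<aa>" using \<Phi>(1) root_dual by blast
    have ind: "f \<phi> = 0" if s: "(\<Sum>\<phi>\<in>\<Phi>. f \<phi> *s v \<phi>) = 0" and p: "\<phi> \<in> \<Phi>" for f \<phi>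
    proof -
      have "f \<phi> *s v \<phi> = 0"
        by (rule root_spaces_independent[OF \<Phi>(2) sub _ s p])
          (use v \<Phi>(1) subspace_scale[OF subspace_root_space] in blast)
      then show ?thesis using v[of \<phi>] p \<Phi>(1) by auto
    qed
    have inj: "inj_on v \<Phi>"
    proof (rule inj_onI, rule ccontr)
      fix \<phi> \<psi> assume p: "\<phi> \<in> \<Phi>" "\<psi> \<in> \<Phi>" "v \<phi> = v \<psi>" "\<phi> \<noteq> \<psi>"
      let ?f = "\<lambda>\<chi>. (if \<chi> = \<phi> then 1 else 0) - (if \<chi> = \<psi> then 1 else 0 :: 'k)"
      have "(\<Sum>\<chi>\<in>\<Phi>. ?f \<chi> *s v \<chi>) = (\<Sum>\<chi>\<in>\<Phi>. (if \<chi> = \<phi> then v \<chi> else 0) - (if \<chi> = \<psi> then v \<chi> else 0))"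
        by (rule sum.cong) auto
      also have "\<dots> = 0" using p \<Phi>(2) by (simp add: sum_subtractf)
      finally show False using ind[of ?f \<phi>] p by simp
    qed
    have "independent (v ` \<Phi>)"
    proof (rule independent_if_scalars_zero)
      fix f x assume s: "(\<Sum>x\<in>v ` \<Phi>. f x *s x) = 0" and "x \<in> v ` \<Phi>"
      then obtain \<phi> where "\<phi> \<in> \<Phi>" "x = v \<phi>" by blast
      then show "f x = 0" using ind[of "\<lambda>\<phi>. f (v \<phi>)" \<phi>] s by (simp add: sum.reindex[OF inj])
    qed (use \<Phi>(2) in simp)
    then have "card (v ` \<Phi>) \<le> dim (UNIV :: 'g set)" by (intro independent_card_le_dim) auto
    then show ?thesis by (simp add: card_image[OF inj])
  qed
  then show ?thesis by (meson finite_if_finite_subsets_card_bdd)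
qed

definition eigen_span :: "('g \<Rightarrow> 'g) \<Rightarrow> 'g set \<Rightarrow> 'k set \<Rightarrow> 'g set" where
  "eigen_span D V C = span (\<Union>c\<in>C. {v \<in> V. D v = c *s v})"

lemma kappa_bracket_left: "kappa (bracket x y) z = - kappa y (bracket x z)"
  by (simp add: bracket_anti[of x y] kappa_minus_left kappa_bracket)

text \<open>If \<open>(D - c) v\<close> is a sum of eigenvectors with eigenvalues \<open>j\<close>
  different from \<open>c\<close>, dividing the summands by \<open>j - c\<close> gives a vector with
  the same image under \<open>D - c\<close>. It differs from \<open>v\<close> by an eigenvector for
  \<open>c\<close>. Peeling off one linear factor at a time turns a polynomial relation with simple
  roots into an eigenvector decomposition.\<close>

lemma eigen_span_step:
  assumes D: "lin D" and V: "subspace V" and v: "v \<in> V" and c: "c \<notin> C"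
    and Dv: "D v - c *s v \<in> eigen_span D V C"
  shows "v \<in> eigen_span D V (insert c C)"
proof -
  let ?E = "\<lambda>c. {v \<in> V. D v = c *s v}"
  have sub: "subspace (?E c)" for c
    by (rule subspaceI) (auto simp: subspace_0[OF V] subspace_add[OF V] subspace_scale[OF V]
        lin_zero[OF D] lin_add[OF D] lin_scale[OF D] scale_right_distrib mult.commute)
  obtain J f where J: "finite J" "J \<subseteq> C" "\<forall>j\<in>J. f j \<in> ?E j" "D v - c *s v = sum f J"
    using span_UN_sum[of ?E, OF sub Dv[unfolded eigen_span_def]] by blast
  let ?v = "\<Sum>j\<in>J. inverse (j - c) *s f j"
  have tm: "D (inverse (j - c) *s f j) - c *s (inverse (j - c) *s f j) = f j" if "j \<in> J" for j
  proof -
    have "j - c \<noteq> 0" using that J(2) c by auto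
    have "D (inverse (j - c) *s f j) - c *s (inverse (j - c) *s f j) = (inverse (j - c) * (j - c)) *s f j"
      using that J(3) by (simp add: lin_scale[OF D] left_diff_distrib right_diff_distrib scale_left_diff_distrib mult.commute)
    then show ?thesis using \<open>j - c \<noteq> 0\<close> by simp
  qed
  have "D ?v - c *s ?v = sum f J"
    by (simp add: lin_sum[OF D] scale_sum_right tm flip: sum_subtractf del: scale_scale)
  then have "D (v - ?v) = c *s (v - ?v)"
    using J(4) by (simp add: lin_diff[OF D] scale_right_diff_distrib algebra_simps)
  moreover have vV: "?v \<in> V" by (rule subspace_sum[OF V]) (use J(3) subspace_scale[OF V] in auto)
  ultimately have "v - ?v \<in> ?E c" using subspace_diff[OF V v] by simp
  then have "v - ?v \<in> eigen_span D V (insert c C)"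
    unfolding eigen_span_def by (intro span_base) blast
  moreover have "?v \<in> eigen_span D V (insert c C)"
    unfolding eigen_span_def by (intro span_sum span_scale span_base) (use J(2,3) in blast)
  ultimately show ?thesis unfolding eigen_span_def using span_add by fastforce
qed

end

section \<open>Regular elements of degree one\<close>

context short_graded
begin

lemma scale_two: "2 *s x = x + x"
  by (metis one_add_one scale_left_distrib scale_one)

lemma scale_three: "3 *s x = x + x + x"
proof -
  have "(3 :: 'k) = 1 + 1 + 1" by simp
  then show ?thesis by (metis scale_left_distrib scale_one)
qed

lemma short_graded_minus: "short_graded scale Basis bracket (- H)"
proof
  fix x
  obtain a b c where "x = a + b + c" "a \<in> deg (-1)" "b \<in> deg 0" "c \<in> deg 1" by (rule deg_cases)
  then show "\<exists>a b c. x = a + b + c \<and> bracket (- H) a = - a \<and> bracket (- H) b = 0 \<and> bracket (- H) c = c"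
    by (intro exI[of _ c] exI[of _ b] exI[of _ a]) (simp add: deg_def add_ac)
next
  show "\<exists>x. bracket (- H) x \<noteq> 0" using not_central by simp
qed (rule ideals)

lemma deg_1_commute: "x \<in> deg 1 \<Longrightarrow> y \<in> deg 1 \<Longrightarrow> bracket x y = 0"
  using deg_trivial[of "bracket x y" 2] deg_bracket[of x 1 y 1 2] by simp

lemma deg_minus_1_commute: "x \<in> deg (-1) \<Longrightarrow> y \<in> deg (-1) \<Longrightarrow> bracket x y = 0"
  using deg_trivial[of "bracket x y" "-2"] deg_bracket[of x "-1" y "-1" "-2"] by simp

section \<open>Vectors of degree -1 killed by \<open>(ad e)^2\<close> are orthogonal to
  \<open>e\<close>\<close>

context
  fixes e z c
  assumes e: "e \<in> deg 1" and z: "z \<in> deg (-1)" and ez: "bracket e (bracket e z) = 0"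
    and c: "c = bracket e z"
begin

lemma sandwich_deg: "c \<in> deg 0"
  unfolding c by (rule deg_bracket[OF e z]) simp

lemma sandwich_commute: "bracket c (bracket e x) = bracket e (bracket c x)"
proof -
  have "bracket c e = 0" using ez bracket_eq_0_commute[of c e] by (simp add: c)
  then show ?thesis by (simp add: leibniz[of c e])
qed

lemma sandwich_apply: "bracket c x = bracket e (bracket z x) - bracket z (bracket e x)"
  by (simp add: c bracket_bracket_left)

lemma sandwich_deg_1: "w \<in> deg 1 \<Longrightarrow> bracket e (bracket z w) = bracket c w"
  by (simp add: sandwich_apply deg_1_commute[OF e])

text \<open>Write \<open>E\<close>, \<open>Z\<close>, \<open>C\<close> for the adjoint maps of
  \<open>e\<close>, \<open>z\<close>, \<open>c\<close>, so that \<open>C = [E, Z]\<close> commutes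
  with \<open>E\<close>. On degree 1 this gives \<open>E^2 Z^2 = 2 C^2\<close>. Since
  \<open>Z^3\<close> kills degree 1, moving \<open>C\<close> through \<open>E^2 Z^2\<close> gives
  \<open>2 C^3 = -4 C^3\<close>, hence \<open>6 C^3 = 0\<close>.\<close>

lemma sandwich_cube_deg_1:
  assumes w: "w \<in> deg 1"
  shows "bracket c (bracket c (bracket c w)) = 0"
proof -
  let ?E = "bracket e" and ?Z = "bracket z" and ?C = "bracket c"
  have Zw: "?Z w \<in> deg 0" by (rule deg_bracket[OF z w]) simp
  have Z2w: "?Z (?Z w) \<in> deg (-1)" by (rule deg_bracket[OF z Zw]) simp
  have Z3w: "?Z (?Z (?Z w)) = 0" by (rule deg_minus_1_commute[OF z Z2w])
  have C: "?C x \<in> deg d" if "x \<in> deg d" for x d by (rule deg_bracket[OF sandwich_deg that]) simp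
  have EZ2w: "?E (?Z (?Z w)) \<in> deg 0" by (rule deg_bracket[OF e Z2w]) simp
  then have E2Z2w: "?E (?E (?Z (?Z w))) \<in> deg 1" by (rule deg_bracket[OF e]) simp
  have "?C (?C w) = ?E (?C (?Z w))"
    by (simp add: sandwich_commute flip: sandwich_deg_1[OF w])
  also have "\<dots> = ?E (?E (?Z (?Z w))) - ?C (?C w)"
    by (simp add: sandwich_apply[of "?Z w"] bracket_diff_right sandwich_deg_1[OF w] sandwich_deg_1[OF C[OF w]])
  finally have C2: "?E (?E (?Z (?Z w))) = ?C (?C w) + ?C (?C w)" by (simp add: algebra_simps)
  have "?C (?C (?C w)) + ?C (?C (?C w)) = ?C (?E (?E (?Z (?Z w))))"
    unfolding C2 by (simp only: bracket_add_right)
  also have "\<dots> = ?E (?E (?C (?Z (?Z w))))"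
    by (simp only: sandwich_commute)
  also have "\<dots> = - ?E (?E (?Z (?E (?Z (?Z w)))))"
    by (simp add: sandwich_apply[of "?Z (?Z w)"] Z3w)
  \<comment> \<open>This is \<open>E C y = C E y\<close> written out with
    \<open>C = E Z - Z E\<close>, using \<open>E^2 y = 0\<close> for \<open>y\<close> of degree
    0.\<close>
  also have "?E (?E (?Z y)) = ?E (?Z (?E y)) + ?E (?Z (?E y))" if "y \<in> deg 0" for y
  proof -
    have "?E y \<in> deg 1" by (rule deg_bracket[OF e that]) simp
    then have "?E (?E y) = 0" by (rule deg_1_commute[OF e])
    then show ?thesis
      using sandwich_commute[of y] by (simp add: sandwich_apply bracket_diff_right algebra_simps)
  qed
  note this[OF EZ2w]
  also have "?E (?Z (?E (?E (?Z (?Z w))))) = ?C (?C (?C w)) + ?C (?C (?C w))"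
    unfolding sandwich_deg_1[OF E2Z2w] unfolding C2 by (simp add: bracket_add_right)
  finally have "3 *s (2 *s ?C (?C (?C w))) = 0"
    by (simp only: scale_two scale_three) (simp add: algebra_simps eq_neg_iff_add_eq_0)
  then show ?thesis by simp
qed

text \<open>Up to sign the transpose of the statement in degree 1, since \<open>ad c\<close> is skew
  for the Killing form, which pairs degree -1 with degree 1.\<close>

lemma sandwich_cube_deg_minus_1:
  assumes y: "y \<in> deg (-1)"
  shows "bracket c (bracket c (bracket c y)) = 0"
proof (rule kappa_nondegenerate)
  fix x
  have C: "bracket c x \<in> deg (-1)" if "x \<in> deg (-1)" for x by (rule deg_bracket[OF sandwich_deg that]) simp
  then have y3: "bracket c (bracket c (bracket c y)) \<in> deg (-1)" using y by blast
  obtain u v w where x: "x = u + v + w" "u \<in> deg (-1)" "v \<in> deg 0" "w \<in> deg 1" by (rule deg_cases)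
  have "kappa (bracket c (bracket c (bracket c y))) w = 0"
    using sandwich_cube_deg_1[OF x(4)] by (simp add: kappa_bracket_left)
  then show "kappa (bracket c (bracket c (bracket c y))) x = 0"
    using kappa_deg[OF y3 x(2)] kappa_deg[OF y3 x(3)] by (simp add: x(1) kappa_add_right)
qed

text \<open>\<open>ad e ad z\<close> is zero on degree -1 and equals \<open>ad c\<close> on degree
  1, where the third power vanishes. On degree 0 its first application gives \<open>[e, y]\<close>
  with \<open>y\<close> of degree -1, and each later one replaces \<open>y\<close> by
  \<open>- [c, y]\<close>; hence the exponent 4.\<close>

lemma sandwich_kappa: "kappa e z = 0"
  unfolding kappa_def
proof (rule trace_nilpotent[of _ 4])
  let ?A = "\<lambda>x. bracket e (bracket z x)"
  show A: "lin ?A" by (rule lin_comp[OF lin_bracket lin_bracket])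
  fix x
  obtain u v w where x: "x = u + v + w" "u \<in> deg (-1)" "v \<in> deg 0" "w \<in> deg 1" by (rule deg_cases)
  have A0: "?A 0 = 0" by simp
  have "?A u = 0" by (simp add: deg_minus_1_commute[OF z x(2)])
  then have u: "?A (?A (?A (?A u))) = 0" by simp
  have C: "bracket c y \<in> deg d" if "y \<in> deg d" for y d by (rule deg_bracket[OF sandwich_deg that]) simp
  have w: "?A (?A (?A (?A w))) = 0"
    using sandwich_cube_deg_1[OF x(4)] by (simp add: sandwich_deg_1 C x(4))
  have zv: "bracket z v \<in> deg (-1)" by (rule deg_bracket[OF z x(3)]) simp
  have neg: "?A (bracket e y) = - bracket e (bracket c y)" if "y \<in> deg (-1)" for y
    using deg_minus_1_commute[OF z that] by (simp add: sandwich_apply)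
  have v: "?A (?A (?A (?A v))) = 0"
    using sandwich_cube_deg_minus_1[OF zv] by (simp add: neg zv C)
  show "(?A ^^ 4) x = 0"
    using u v w by (simp add: eval_nat_numeral x(1) lin_add[OF A])
qed

end

text \<open>By the preceding lemma \<open>e\<close> is orthogonal to the kernel of \<open>(ad e)\<^sup>2\<close>, whose orthogonal complement
  is the range of \<open>(ad e)\<^sup>2\<close>.\<close>

lemma deg_1_regular:
  assumes e: "e \<in> deg 1"
  shows "\<exists>y. bracket e (bracket e y) = e"
proof (rule ccontr)
  assume "\<not> ?thesis"
  then have ne: "e \<notin> range (\<lambda>y. bracket e (bracket e y))" by (metis rangeE)
  have sub: "subspace (range (\<lambda>y. bracket e (bracket e y)))"
  proof (rule subspaceI)
    show "0 \<in> range (\<lambda>y. bracket e (bracket e y))" by (rule range_eqI[of _ _ 0]) simp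
  next
    fix x y assume "x \<in> range (\<lambda>y. bracket e (bracket e y))" "y \<in> range (\<lambda>y. bracket e (bracket e y))"
    then obtain a b where "x = bracket e (bracket e a)" "y = bracket e (bracket e b)" by auto
    then show "x + y \<in> range (\<lambda>y. bracket e (bracket e y))"
      by (intro range_eqI[of _ _ "a + b"]) (simp add: bracket_add_right)
  next
    fix c x assume "x \<in> range (\<lambda>y. bracket e (bracket e y))"
    then obtain a where "x = bracket e (bracket e a)" by auto
    then show "c *s x \<in> range (\<lambda>y. bracket e (bracket e y))"
      by (intro range_eqI[of _ _ "c *s a"]) (simp add: bracket_scale_right)
  qed
  obtain \<phi> where \<phi>: "\<forall>x y. \<phi> (x + y) = \<phi> x + \<phi> y" "\<forall>c x. \<phi> (c *s x) = c * \<phi> x"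
    "\<forall>x\<in>range (\<lambda>y. bracket e (bracket e y)). \<phi> x = 0" "\<phi> e = 1"
    by (rule separating_functional[OF sub ne])
  obtain w where w: "\<And>x. \<phi> x = kappa w x"
    by (rule kappa_representation[of \<phi>]) (use \<phi>(1,2) in auto)
  have "bracket e (bracket e w) = 0"
  proof (rule kappa_nondegenerate)
    fix y
    have "kappa (bracket e (bracket e w)) y = kappa w (bracket e (bracket e y))"
      by (simp add: kappa_bracket_left)
    then show "kappa (bracket e (bracket e w)) y = 0" using \<phi>(3) w by auto
  qed
  \<comment> \<open>\<open>(ad e)^2\<close> kills degrees 0 and 1, and only degree -1 pairs with
    \<open>e\<close>, so \<open>w\<close> may be replaced by its component \<open>a\<close>.\<close>
  moreover obtain a b c where x: "w = a + b + c" "a \<in> deg (-1)" "b \<in> deg 0" "c \<in> deg 1" by (rule deg_cases)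
  moreover have "bracket e b \<in> deg 1" by (rule deg_bracket[OF e x(3)]) simp
  ultimately have "bracket e (bracket e a) = 0"
    by (simp add: bracket_add_right deg_1_commute[OF e])
  then have "kappa e a = 0" by (rule sandwich_kappa[OF e x(2) _ refl])
  then have "kappa w e = 0"
    using kappa_deg[OF e x(3)] kappa_deg[OF e x(4)]
    by (simp add: x(1) kappa_add_left kappa_commute[of a] kappa_commute[of b] kappa_commute[of c])
  then show False using w \<phi>(4) by simp
qed

section \<open>Graded \<open>sl2\<close>-triples and the eigenvalues of \<open>ad h\<close>\<close>

definition sl2_triple :: "'g \<Rightarrow> 'g \<Rightarrow> 'g \<Rightarrow> bool" where
  "sl2_triple e h f \<longleftrightarrow> e \<in> deg 1 \<and> f \<in> deg (-1) \<and> bracket e f = h \<and>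
     bracket h e = 2 *s e \<and> bracket h f = - (2 *s f)"

text \<open>The defect \<open>z = [h, g] + 2 g\<close> commutes with \<open>e\<close> by the Jacobi
  identity and with \<open>g\<close> for degree reasons, hence with \<open>h = [e, g]\<close>.
  Subtracting \<open>z / 2\<close> from \<open>g\<close> therefore corrects \<open>[h, g]\<close>
  without changing \<open>[e, g]\<close>; the result is \<open>- [h, g] / 2\<close>.\<close>

lemma complete_triple:
  assumes e: "e \<in> deg 1" and g: "g \<in> deg (-1)" and h: "h = bracket e g" and he: "bracket h e = 2 *s e"
  shows "sl2_triple e h ((- 1 / 2) *s bracket h g)"
proof -
  let ?f = "(- 1 / 2) *s bracket h g"
  let ?z = "bracket h g + 2 *s g"
  have h0: "h \<in> deg 0" unfolding h by (rule deg_bracket[OF e g]) simp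
  have hg: "bracket h g \<in> deg (-1)" by (rule deg_bracket[OF h0 g]) simp
  have eh: "bracket e h = - (2 *s e)" using he bracket_anti[of e h] by simp
  have ez: "bracket e ?z = 0"
    by (simp add: bracket_add_right bracket_scale_right leibniz[of e h g] eh bracket_scale_left
        bracket_self flip: h)
  have "?z \<in> deg (-1)" using hg g by (intro deg_add deg_scale)
  then have "bracket g ?z = 0" by (rule deg_minus_1_commute[OF g])
  then have hz: "bracket h ?z = 0" using ez by (simp add: h bracket_bracket_left)
  have f: "?f = g - (1 / 2) *s ?z" by (simp add: scale_right_distrib)
  have "bracket e ?f = h" unfolding f bracket_diff_right bracket_scale_right ez by (simp add: h)
  moreover have "bracket h ?f = - (2 *s ?f)"
    unfolding f bracket_diff_right bracket_scale_right hz
    by (simp add: scale_right_distrib scale_right_diff_distrib)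
  moreover have "?f \<in> deg (-1)" by (rule deg_scale[OF hg])
  ultimately show ?thesis using e he by (simp add: sl2_triple_def)
qed

context
  fixes e h f
  assumes triple: "sl2_triple e h f"
begin

lemma triple_deg: "e \<in> deg 1" "f \<in> deg (-1)" "h \<in> deg 0"
  using triple deg_bracket[of e 1 f "-1" 0] by (auto simp: sl2_triple_def)

lemma triple_e_f: "bracket e (bracket f x) = bracket f (bracket e x) + bracket h x"
  using triple by (auto simp: sl2_triple_def leibniz[of e f] add.commute)

lemma triple_h_f: "bracket h (bracket f x) = bracket f (bracket h x) - 2 *s bracket f x"
  using triple by (auto simp: sl2_triple_def leibniz[of h f] bracket_scale_left)

lemma triple_h_e: "bracket h (bracket e x) = bracket e (bracket h x) + 2 *s bracket e x"
  using triple by (auto simp: sl2_triple_def leibniz[of h e] bracket_scale_left)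

abbreviation (input) Q :: "'k \<Rightarrow> 'g \<Rightarrow> 'g" where
  "Q k x \<equiv> bracket h x - k *s x"

lemma triple_Q_deg: "x \<in> deg d \<Longrightarrow> Q k x \<in> deg d"
  using deg_bracket[OF triple_deg(3), of x d d] by (simp add: subspace_diff[OF subspace_deg] deg_scale)

text \<open>\<open>(ad f)^3\<close> is zero on degree 1. Applying \<open>ad e\<close> once to
  \<open>f^3 w = 0\<close> gives \<open>3 f^2 (h - 2) w = 0\<close>; applying it twice more uses
  \<open>e^2 f^2 = 2 h (h - 1)\<close> on degree 1.\<close>

lemma triple_deg_1_eigen:
  assumes w: "w \<in> deg 1"
  shows "Q 0 (Q 1 (Q 2 w)) = 0"
proof -
  have ef: "bracket e (bracket f x) = bracket h x" if "x \<in> deg 1" for x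
    by (simp add: triple_e_f deg_1_commute[OF triple_deg(1) that])
  have eff: "bracket e (bracket f (bracket f x)) = 2 *s bracket f (Q 1 x)" if "x \<in> deg 1" for x
  proof -
    have "bracket e (bracket f (bracket f x)) = bracket f (bracket h x) + (bracket f (bracket h x) - 2 *s bracket f x)"
      by (subst triple_e_f) (simp only: ef[OF that] triple_h_f)
    also have "\<dots> = 2 *s bracket f (Q 1 x)"
      by (simp add: bracket_diff_right scale_two)
    finally show ?thesis .
  qed
  have eeff: "bracket e (bracket e (bracket f (bracket f x))) = 2 *s Q 0 (Q 1 x)" if "x \<in> deg 1" for x
    using triple_Q_deg[OF that, of 1] by (simp add: eff[OF that] bracket_scale_right ef)
  have fw: "bracket f w \<in> deg 0" by (rule deg_bracket[OF triple_deg(2) w]) simp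
  then have "bracket f (bracket f w) \<in> deg (-1)" by (rule deg_bracket[OF triple_deg(2)]) simp
  then have fff: "bracket f (bracket f (bracket f w)) = 0" by (rule deg_minus_1_commute[OF triple_deg(2)])
  have "0 = bracket e (bracket f (bracket f (bracket f w)))" by (simp add: fff)
  also have "\<dots> = bracket f (2 *s bracket f (Q 1 w)) + bracket h (bracket f (bracket f w))"
    by (subst triple_e_f) (simp only: eff[OF w])
  also have "\<dots> = 3 *s bracket f (bracket f (Q 2 w))"
    by (simp add: triple_h_f bracket_diff_right bracket_add_right scale_two scale_three algebra_simps)
  finally have "bracket f (bracket f (Q 2 w)) = 0" by simp
  then show ?thesis using eeff[OF triple_Q_deg[OF w, of 2]] by simp
qed

lemma triple_eigen_chain:
  assumes V: "V = deg d" and v: "v \<in> V" and z: "Q 0 (Q 1 (Q 2 v)) = 0"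
  shows "v \<in> eigen_span (bracket h) V {0, 1, 2}"
proof -
  have sub: "subspace V" and Qd: "\<And>k x. x \<in> V \<Longrightarrow> Q k x \<in> V"
    unfolding V by (rule subspace_deg) (rule triple_Q_deg)
  note step = eigen_span_step[OF lin_bracket sub]
  have 0: "0 \<in> eigen_span (bracket h) V {}" by (simp add: eigen_span_def)
  have 1: "Q 1 (Q 2 v) \<in> eigen_span (bracket h) V (insert 0 {})"
    by (rule step, intro Qd v, simp, simp only: z 0)
  have 2: "Q 2 v \<in> eigen_span (bracket h) V (insert 1 {0})"
    by (rule step, intro Qd v, simp, rule 1)
  have "v \<in> eigen_span (bracket h) V (insert 2 {1, 0})"
    by (rule step, rule v, simp, rule 2)
  then show ?thesis by (simp add: insert_commute)
qed

lemma triple_deg_1_eigen_span: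
  assumes "w \<in> deg 1"
  shows "w \<in> eigen_span (bracket h) (deg 1) {0, 1, 2}"
  by (rule triple_eigen_chain[OF refl assms triple_deg_1_eigen[OF assms]])

text \<open>Degree 0 acts faithfully on degree 1, so its weights are differences of the weights 0,
  1, 2. Against an eigenvector of weight \<open>c\<close> the factor \<open>Q k\<close> becomes
  \<open>Q (c + k)\<close>, and for each such \<open>c\<close> the five values \<open>c + k\<close>
  include 0, 1 and 2.\<close>

lemma triple_deg_0_eigen:
  assumes v: "v \<in> deg 0"
  shows "Q (-2) (Q (-1) (Q 0 (Q 1 (Q 2 v)))) = 0"
proof (rule deg_zero_faithful)
  let ?p = "\<lambda>v. Q (-2) (Q (-1) (Q 0 (Q 1 (Q 2 v))))"
  show "?p v \<in> deg 0" by (intro triple_Q_deg v)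
  fix w assume "w \<in> deg 1"
  then have "w \<in> span (\<Union>c\<in>{0, 1, 2}. {w \<in> deg 1. bracket h w = c *s w})"
    using triple_deg_1_eigen_span[of w] by (simp add: eigen_span_def)
  moreover have "bracket (?p v) w \<in> {0}" if w: "w \<in> (\<Union>c\<in>{0, 1, 2}. {w \<in> deg 1. bracket h w = c *s w})" for w
  proof -
    obtain c where c': "c \<in> {0, 1, 2 :: 'k}" "w \<in> {w \<in> deg 1. bracket h w = c *s w}"
      using w by (rule UN_E)
    then have c: "w \<in> deg 1" "bracket h w = c *s w" by simp_all
    let ?u = "bracket v w"
    have u: "?u \<in> deg 1" using deg_bracket[OF v c(1)] by simp
    have Qb: "bracket (Q k x) w = Q (c + k) (bracket x w)" for k x
      using leibniz[of h x w] c(2)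
      by (simp add: bracket_diff_left bracket_scale_left bracket_scale_right scale_left_distrib algebra_simps)
    have eq: "bracket (?p v) w = Q (c + -2) (Q (c + -1) (Q (c + 0) (Q (c + 1) (Q (c + 2) ?u))))"
      unfolding Qb ..
    have z: "Q 0 (Q 1 (Q 2 x)) = 0" if "x \<in> deg 1" for x by (rule triple_deg_1_eigen[OF that])
    have d3: "Q 3 ?u \<in> deg 1" and d34: "Q 3 (Q 4 ?u) \<in> deg 1" by (intro triple_Q_deg u)+
    have n: "(1::'k) + -2 = -1" "(1::'k) + -1 = 0" "(1::'k) + 0 = 1" "(1::'k) + 1 = 2" "(1::'k) + 2 = 3"
      "(2::'k) + -2 = 0" "(2::'k) + -1 = 1" "(2::'k) + 0 = 2" "(2::'k) + 1 = 3" "(2::'k) + 2 = 4"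
      by simp_all
    have Q0: "Q k 0 = 0" for k by simp
    consider "c = 0" | "c = 1" | "c = 2" using c'(1) by auto
    then have "bracket (?p v) w = 0"
    proof cases
      case 1
      show ?thesis unfolding eq unfolding 1 add_0_left by (simp only: z[OF u] Q0)
    next
      case 2
      show ?thesis unfolding eq unfolding 2 n by (simp only: z[OF d3] Q0)
    next
      case 3
      show ?thesis unfolding eq unfolding 3 n by (rule z[OF d34])
    qed
    then show ?thesis by simp
  qed
  ultimately have "bracket (?p v) w \<in> {0}"
    by (rule lin_span_subset[OF lin_bracket subspace_single_0, rotated])
  then show "bracket (?p v) w = 0" by simp
qed

lemma triple_deg_0_eigen_span:
  assumes v: "v \<in> deg 0"
  shows "v \<in> eigen_span (bracket h) (deg 0) {-2, -1, 0, 1, 2}"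
proof -
  note step = eigen_span_step[OF lin_bracket subspace_deg]
  have z: "Q (-2) (Q (-1) (Q 0 (Q 1 (Q 2 v)))) = 0" by (rule triple_deg_0_eigen[OF v])
  note Qd = triple_Q_deg[of _ 0]
  have 0: "0 \<in> eigen_span (bracket h) (deg 0) {}" by (simp add: eigen_span_def)
  have 1: "Q (-1) (Q 0 (Q 1 (Q 2 v))) \<in> eigen_span (bracket h) (deg 0) (insert (-2) {})"
    by (rule step, intro Qd v, simp, simp only: z 0)
  have 2: "Q 0 (Q 1 (Q 2 v)) \<in> eigen_span (bracket h) (deg 0) (insert (-1) {-2})"
    by (rule step, intro Qd v, simp, rule 1)
  have 3: "Q 1 (Q 2 v) \<in> eigen_span (bracket h) (deg 0) (insert 0 {-1, -2})"
    by (rule step, intro Qd v, simp, rule 2)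
  have 4: "Q 2 v \<in> eigen_span (bracket h) (deg 0) (insert 1 {0, -1, -2})"
    by (rule step, intro Qd v, simp, rule 3)
  have "v \<in> eigen_span (bracket h) (deg 0) (insert 2 {1, 0, -1, -2})"
    by (rule step, rule v, simp, rule 4)
  then show ?thesis by (simp add: insert_commute)
qed

end

text \<open>Degree -1 is the degree 1 of the opposite grading, for which \<open>(f, -h, e)\<close>
  is the triple.\<close>

lemma sl2_triple_ad_diagonalizable:
  assumes triple: "sl2_triple e h f"
  shows "ad_diagonalizable h"
proof -
  interpret m: short_graded scale Basis bracket "- H" by (rule short_graded_minus)
  have md: "m.deg c = deg (- c)" for c
    by (auto simp: m.deg_def deg_def minus_equation_iff) (metis minus_minus)
  let ?S = "span {x. \<exists>c. bracket h x = c *s x}"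
  have sub: "eigen_span (bracket h) V C \<subseteq> ?S" for V C
    unfolding eigen_span_def by (rule span_mono) auto
  have "m.sl2_triple f (- h) e"
    using triple bracket_anti[of f e]
    by (auto simp: m.sl2_triple_def sl2_triple_def md)
  then have "x \<in> eigen_span (bracket (- h)) (m.deg 1) {0, 1, 2}" if "x \<in> deg (-1)" for x
    using m.triple_deg_1_eigen_span that by (simp add: md)
  moreover have "eigen_span (bracket (- h)) V C \<subseteq> ?S" for V C
    unfolding eigen_span_def
    by (rule span_mono) (auto, metis scale_minus_left minus_minus)
  ultimately have 1: "x \<in> ?S" if "x \<in> deg (-1)" for x using that by blast
  have "x \<in> ?S" for x
  proof -
    obtain u v w where x: "x = u + v + w" "u \<in> deg (-1)" "v \<in> deg 0" "w \<in> deg 1" by (rule deg_cases)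
    show ?thesis unfolding x(1)
      using 1[OF x(2)] triple_deg_0_eigen_span[OF triple x(3)] triple_deg_1_eigen_span[OF triple x(4)] sub
      by (intro span_add) blast+
  qed
  then show ?thesis by (auto simp: ad_diagonalizable_def)
qed

end

section \<open>Coroots of the roots of degree one\<close>

locale short_graded_roots = short_graded scale Basis bracket H
  for scale :: "'k::field_char_0 \<Rightarrow> 'g::ab_group_add \<Rightarrow> 'g" (infixr \<open>*s\<close> 75)
    and Basis :: "'g set"
    and bracket :: "'g \<Rightarrow> 'g \<Rightarrow> 'g"
    and H :: 'g +
  fixes \<aa> :: "'g set" and P :: "('g \<Rightarrow> 'k) set"
  assumes maximal: "maximal_split_abelian \<aa>"
    and H_in: "H \<in> \<aa>"
    and positive: "positive_roots \<aa> P"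
begin

abbreviation \<Delta> :: "('g \<Rightarrow> 'k) set" where "\<Delta> \<equiv> roots \<aa>"
abbreviation \<Delta>1 :: "('g \<Rightarrow> 'k) set" where "\<Delta>1 \<equiv> roots_deg \<aa> H 1"
abbreviation rs :: "('g \<Rightarrow> 'k) \<Rightarrow> 'g set" where "rs \<equiv> root_space \<aa>"

lemma split_abelian_a: "split_abelian \<aa>"
  using maximal by (simp add: maximal_split_abelian_def)

lemma subspace_a: "subspace \<aa>" and abelian: "x \<in> \<aa> \<Longrightarrow> y \<in> \<aa> \<Longrightarrow> bracket x y = 0"
  using split_abelian_a by (auto simp: split_abelian_def)

lemma root_spaceD: "x \<in> rs \<phi> \<Longrightarrow> h \<in> \<aa> \<Longrightarrow> bracket h x = \<phi> h *s x"
  by (simp add: root_space_def)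

lemma root_space_deg: "x \<in> rs \<phi> \<Longrightarrow> x \<in> deg (\<phi> H)"
  using root_spaceD[OF _ H_in] by (simp add: deg_def)

lemma roots_degD: "\<alpha> \<in> roots_deg \<aa> H d \<Longrightarrow> \<alpha> \<in> \<Delta> \<and> \<alpha> \<in> dual \<aa> \<and> \<alpha> H = of_int d"
  by (simp add: roots_deg_def roots_def)

lemma root_space_nonzero: "\<alpha> \<in> \<Delta> \<Longrightarrow> \<exists>x\<in>rs \<alpha>. x \<noteq> 0"
  using subspace_0[OF subspace_root_space[of \<aa> \<alpha>]] by (auto simp: roots_def)

lemma rootI: "x \<in> rs \<phi> \<Longrightarrow> x \<noteq> 0 \<Longrightarrow> \<phi> \<in> dual \<aa> \<Longrightarrow> \<phi> \<noteq> 0 \<Longrightarrow> \<phi> \<in> \<Delta>"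
  by (auto simp: roots_def)

lemma roots_degI: "x \<in> rs \<phi> \<Longrightarrow> x \<noteq> 0 \<Longrightarrow> \<phi> \<in> dual \<aa> \<Longrightarrow> \<phi> H = 1 \<Longrightarrow> \<phi> \<in> \<Delta>1"
  using rootI[of x \<phi>] by (force simp: roots_deg_def)

lemma root_neq_zero: "\<alpha> \<in> \<Delta> \<Longrightarrow> \<alpha> \<noteq> 0"
  by (simp add: roots_def)

lemma deg_decomposition:
  assumes "x \<in> deg d"
  obtains \<Lambda> v where "finite \<Lambda>" "\<Lambda> \<subseteq> {\<phi> \<in> dual \<aa>. \<phi> H = d}"
    "\<forall>\<phi>\<in>\<Lambda>. v \<phi> \<in> rs \<phi> \<and> v \<phi> \<noteq> 0" "x = sum v \<Lambda>"
proof -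
  obtain \<Lambda> v where L: "finite \<Lambda>" "\<Lambda> \<subseteq> dual \<aa>" "\<forall>\<phi>\<in>\<Lambda>. v \<phi> \<in> rs \<phi>" "x = sum v \<Lambda>"
    by (rule root_decomposition[OF split_abelian_a])
  let ?L = "{\<phi> \<in> \<Lambda>. v \<phi> \<noteq> 0}"
  \<comment> \<open>These are the weight components of \<open>[H, x] - d x\<close>, which is
    zero.\<close>
  have "(\<phi> H - d) *s v \<phi> = 0" if "\<phi> \<in> \<Lambda>" for \<phi>
  proof (rule root_spaces_independent[OF L(1,2), of "\<lambda>\<phi>. (\<phi> H - d) *s v \<phi>"])
    show "\<forall>\<phi>\<in>\<Lambda>. (\<phi> H - d) *s v \<phi> \<in> rs \<phi>"
      using L(3) subspace_scale[OF subspace_root_space] by blast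
    have "(\<Sum>\<phi>\<in>\<Lambda>. (\<phi> H - d) *s v \<phi>) = bracket H x - d *s x"
    proof -
      have "bracket H (v \<phi>) = \<phi> H *s v \<phi>" if "\<phi> \<in> \<Lambda>" for \<phi>
        using L(3) that root_spaceD[OF _ H_in] by blast
      then show ?thesis
        by (simp add: L(4) bracket_sum_right scale_sum_right scale_left_diff_distrib sum_subtractf)
    qed
    then show "(\<Sum>\<phi>\<in>\<Lambda>. (\<phi> H - d) *s v \<phi>) = 0" using assms by (simp add: deg_def)
  qed (rule that)
  then have "?L \<subseteq> {\<phi> \<in> dual \<aa>. \<phi> H = d}" using L(2) by auto
  moreover have "x = sum v ?L"
    unfolding L(4) by (rule sum.mono_neutral_right) (use L(1) in auto)
  ultimately show ?thesis using L(1,3) by (intro that[of ?L v]) auto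
qed

lemma kappa_root_spaces:
  assumes "x \<in> rs \<phi>" "y \<in> rs \<psi>" "\<phi> \<in> dual \<aa>" "\<psi> \<in> dual \<aa>" "\<phi> + \<psi> \<noteq> 0"
  shows "kappa x y = 0"
proof -
  have "- \<phi> \<noteq> \<psi>" using assms(5) by (metis add.right_inverse)
  then obtain h where h: "h \<in> \<aa>" "- \<phi> h \<noteq> \<psi> h"
    using dual_neqD[OF dual_uminus[OF assms(3)] assms(4)] by auto
  have "\<phi> h * kappa x y = kappa (bracket h x) y"
    by (simp add: root_spaceD[OF assms(1) h(1)] kappa_scale_left)
  also have "\<dots> = - (\<psi> h * kappa x y)"
    by (simp add: kappa_bracket_left root_spaceD[OF assms(2) h(1)] kappa_scale_right)
  finally have "(\<phi> h + \<psi> h) * kappa x y = 0" by (simp add: distrib_right)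
  moreover have "\<phi> h + \<psi> h \<noteq> 0" using h(2) by (metis neg_eq_iff_add_eq_0)
  ultimately show ?thesis by simp
qed

text \<open>A nonzero root vector is not orthogonal to everything, and it can only pair with the
  opposite weight.\<close>

lemma roots_uminus:
  assumes "\<alpha> \<in> \<Delta>"
  shows "- \<alpha> \<in> \<Delta>"
proof (rule ccontr)
  assume n: "- \<alpha> \<notin> \<Delta>"
  have d: "\<alpha> \<in> dual \<aa>" "- \<alpha> \<in> dual \<aa>" "- \<alpha> \<noteq> 0"
    using assms dual_uminus root_neq_zero[OF assms] by (auto simp: roots_def)
  obtain x where x: "x \<in> rs \<alpha>" "x \<noteq> 0" using root_space_nonzero[OF assms] by blast
  have "kappa x y = 0" for y
  proof -
    obtain \<Lambda> v where L: "finite \<Lambda>" "\<Lambda> \<subseteq> dual \<aa>" "\<forall>\<phi>\<in>\<Lambda>. v \<phi> \<in> rs \<phi>" "y = sum v \<Lambda>"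
      by (rule root_decomposition[OF split_abelian_a])
    have "kappa x (v \<phi>) = 0" if p: "\<phi> \<in> \<Lambda>" for \<phi>
    proof (cases "\<phi> = - \<alpha>")
      case True
      have "v \<phi> = 0" using L(3) p n d(2,3) rootI[of "v \<phi>" "- \<alpha>"] True by blast
      then show ?thesis by simp
    next
      case False
      then have "\<alpha> + \<phi> \<noteq> 0" by (metis add_eq_0_iff)
      then show ?thesis using kappa_root_spaces[OF x(1) _ d(1)] L(2,3) p by blast
    qed
    moreover have "kappa x (sum v \<Lambda>) = (\<Sum>\<phi>\<in>\<Lambda>. kappa x (v \<phi>))"
      by (induction \<Lambda> rule: infinite_finite_induct) (simp_all add: kappa_add_right)
    ultimately show ?thesis by (simp add: L(4))
  qed
  then show False using kappa_nondegenerate x(2) by blast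
qed

lemma roots_minus_commute: "\<alpha> - \<beta> \<in> \<Delta> \<longleftrightarrow> \<beta> - \<alpha> \<in> \<Delta>"
  using roots_uminus[of "\<alpha> - \<beta>"] roots_uminus[of "\<beta> - \<alpha>"] by auto

text \<open>\<open>(ad e)^2\<close> shifts every weight by \<open>2 \<alpha>\<close>, so in a
  solution of \<open>[e, [e, y]] = e\<close> only the component of weight \<open>- \<alpha>\<close>
  contributes to \<open>e\<close>.\<close>

lemma root_space_regular:
  assumes \<alpha>: "\<alpha> \<in> dual \<aa>" "\<alpha> H = 1" and e: "e \<in> rs \<alpha>"
  shows "\<exists>y\<in>rs (- \<alpha>). bracket e (bracket e y) = e"
proof -
  have "e \<in> deg 1" using root_space_deg[OF e] \<alpha>(2) by simp
  then obtain y where y: "bracket e (bracket e y) = e" using deg_1_regular by blast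
  obtain \<Lambda> v where L: "finite \<Lambda>" "\<Lambda> \<subseteq> dual \<aa>" "\<forall>\<phi>\<in>\<Lambda>. v \<phi> \<in> rs \<phi>" "y = sum v \<Lambda>"
    by (rule root_decomposition[OF split_abelian_a])
  let ?L = "insert (- \<alpha>) \<Lambda>" and ?v = "\<lambda>\<phi>. if \<phi> \<in> \<Lambda> then v \<phi> else 0"
  have v: "?v \<phi> \<in> rs \<phi>" for \<phi> using L(3) subspace_0[OF subspace_root_space] by auto
  have "y = sum ?v ?L"
    unfolding L(4) by (rule sum.mono_neutral_cong_left) (use L(1) in auto)
  then have s: "(\<Sum>\<phi>\<in>?L. bracket e (bracket e (?v \<phi>))) = e"
    using y by (simp only: bracket_sum_right)
  let ?w = "\<lambda>\<phi>. bracket e (bracket e (?v \<phi>)) - (if \<phi> = - \<alpha> then e else 0)"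
  have "?w (- \<alpha>) = 0"
  proof (rule root_space_independent[of ?L ?w \<aa> "\<lambda>\<phi>. \<alpha> + (\<alpha> + \<phi>)"])
    fix \<phi> assume "\<phi> \<in> ?L"
    have "bracket e (bracket e (?v \<phi>)) \<in> rs (\<alpha> + (\<alpha> + \<phi>))"
      by (intro root_space_bracket e v)
    moreover have "(if \<phi> = - \<alpha> then e else 0) \<in> rs (\<alpha> + (\<alpha> + \<phi>))"
      using e subspace_0[OF subspace_root_space] by auto
    ultimately show "?w \<phi> \<in> rs (\<alpha> + (\<alpha> + \<phi>))"
      by (rule subspace_diff[OF subspace_root_space])
  next
    fix \<phi> \<psi> assume "\<phi> \<in> ?L" "\<psi> \<in> ?L" "\<phi> \<noteq> \<psi>"
    then have "\<exists>h\<in>\<aa>. \<phi> h \<noteq> \<psi> h" using dual_neqD L(2) dual_uminus[OF \<alpha>(1)] by blast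
    then show "\<exists>h\<in>\<aa>. (\<alpha> + (\<alpha> + \<phi>)) h \<noteq> (\<alpha> + (\<alpha> + \<psi>)) h" by auto
  next
    have "(\<Sum>\<phi>\<in>?L. if \<phi> = - \<alpha> then e else 0) = e" using L(1) by (simp add: sum.delta)
    then show "(\<Sum>\<phi>\<in>?L. ?w \<phi>) = 0" unfolding sum_subtractf s by simp
  qed (use L(1) in auto)
  then have "bracket e (bracket e (?v (- \<alpha>))) = e" by simp
  then show ?thesis using v by blast
qed

text \<open>Sums of commuting diagonalizable elements are diagonalizable, so \<open>\<aa>\<close>
  together with \<open>h\<close> spans a split abelian subalgebra, and maximality applies.\<close>

lemma in_a_if_diagonalizable:
  assumes h: "h \<in> rs 0" "ad_diagonalizable h"
  shows "h \<in> \<aa>"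
proof -
  have comm: "bracket x h = 0" "bracket h x = 0" if "x \<in> \<aa>" for x
    using h(1) that bracket_eq_0_commute[of h x] by (simp_all add: root_space_def)
  let ?b = "span (insert h \<aa>)"
  have b: "\<exists>k. \<exists>a\<in>\<aa>. x = k *s h + a" if "x \<in> ?b" for x
  proof -
    have "span \<aa> = \<aa>" using subspace_a by simp
    moreover obtain k where "x - k *s h \<in> span \<aa>"
      using \<open>x \<in> ?b\<close> by (auto simp: span_breakdown_eq)
    ultimately have "x - k *s h \<in> \<aa>" by (simp only:)
    then show ?thesis by (intro exI[of _ k] bexI[of _ "x - k *s h"]) simp_all
  qed
  have "split_abelian ?b"
    unfolding split_abelian_def
  proof (intro conjI ballI)
    fix x y assume "x \<in> ?b" "y \<in> ?b"
    then obtain k a l c where "x = k *s h + a" "a \<in> \<aa>" "y = l *s h + c" "c \<in> \<aa>"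
      using b[of x] b[of y] by blast
    then show "bracket x y = 0"
      by (simp add: bracket_add_left bracket_add_right bracket_scale_left bracket_scale_right
          bracket_self comm abelian)
  next
    fix x assume "x \<in> ?b"
    then obtain k a where x: "x = k *s h + a" "a \<in> \<aa>" using b[of x] by blast
    have sp: "span (\<Union>\<phi>. root_space {h, a} \<phi>) = UNIV"
    proof (rule joint_eigenvectors_span)
      show "ad_diagonalizable g" if "g \<in> {h, a}" for g
        using that h(2) x(2) split_abelian_a by (auto simp: split_abelian_def)
      show "bracket g g' = 0" if "g \<in> {h, a}" "g' \<in> {h, a}" for g g'
        using that comm[OF x(2)] by (auto simp: bracket_self)
    qed simp
    have "y \<in> {y. \<exists>c. bracket x y = c *s y}" if "y \<in> root_space {h, a} \<phi>" for y \<phi>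
    proof -
      have "bracket x y = (k * \<phi> h + \<phi> a) *s y"
        using that by (simp add: x(1) root_space_def bracket_add_left bracket_scale_left scale_left_distrib)
      then show ?thesis by blast
    qed
    then have "span (\<Union>\<phi>. root_space {h, a} \<phi>) \<subseteq> span {y. \<exists>c. bracket x y = c *s y}"
      by (intro span_mono) blast
    then show "ad_diagonalizable x" unfolding ad_diagonalizable_def using sp by blast
  qed (rule subspace_span)
  moreover have "\<aa> \<subseteq> ?b" using span_superset[of "insert h \<aa>"] by blast
  ultimately have "?b = \<aa>" using maximal by (simp add: maximal_split_abelian_def)
  then show ?thesis using span_base[of h "insert h \<aa>"] by simp
qed

lemma root_triple:
  assumes \<alpha>: "\<alpha> \<in> \<Delta>1" and e: "e \<in> rs \<alpha>" "e \<noteq> 0"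
  obtains h f where "sl2_triple e h f" "h \<in> \<aa>" "f \<in> rs (- \<alpha>)" "\<alpha> h = 2"
proof -
  have d: "\<alpha> \<in> dual \<aa>" "\<alpha> H = 1" using roots_degD[OF \<alpha>] by auto
  obtain y where y: "y \<in> rs (- \<alpha>)" "bracket e (bracket e y) = e"
    using root_space_regular[OF d e(1)] by blast
  \<comment> \<open>The factor -2 turns \<open>[e, [e, y]] = e\<close> into
    \<open>[h, e] = - [e, [e, g]] = 2 e\<close>.\<close>
  let ?g = "(- 2) *s y"
  define h where "h = bracket e ?g"
  define f where "f = (- 1 / 2) *s bracket h ?g"
  have g: "?g \<in> rs (- \<alpha>)" by (rule subspace_scale[OF subspace_root_space y(1)])
  have h0: "h \<in> rs 0" using root_space_bracket[OF e(1) g] by (simp add: h_def)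
  have "bracket h ?g \<in> rs (- \<alpha>)" using root_space_bracket[OF h0 g] by simp
  then have f: "f \<in> rs (- \<alpha>)" unfolding f_def by (rule subspace_scale[OF subspace_root_space])
  have e1: "e \<in> deg 1" using root_space_deg[OF e(1)] d by simp
  have g1: "?g \<in> deg (-1)" using root_space_deg[OF g] d by simp
  have he: "bracket h e = 2 *s e"
    unfolding bracket_anti[of h e] unfolding h_def using y(2) by (simp add: bracket_scale_right)
  have t: "sl2_triple e h f"
    unfolding f_def by (rule complete_triple[OF e1 g1 h_def he])
  have ha: "h \<in> \<aa>"
    by (rule in_a_if_diagonalizable[OF h0 sl2_triple_ad_diagonalizable[OF t]])
  have "\<alpha> h = 2" using root_spaceD[OF e(1) ha] he e(2) by simp
  then show ?thesis using t ha f that by blast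
qed

context
  fixes \<alpha> e h f
  assumes \<alpha>: "\<alpha> \<in> \<Delta>1" and e: "e \<in> rs \<alpha>" and t: "sl2_triple e h f" and h: "h \<in> \<aa>"
    and f: "f \<in> rs (- \<alpha>)" and \<alpha>h: "\<alpha> h = 2"
begin

lemma coroot_values:
  assumes \<beta>: "\<beta> \<in> \<Delta>1"
  shows "\<beta> h \<in> {0, 1, 2}"
proof -
  obtain w where w: "w \<in> rs \<beta>" "w \<noteq> 0" using root_space_nonzero roots_degD[OF \<beta>] by blast
  have "w \<in> deg 1" using root_space_deg[OF w(1)] roots_degD[OF \<beta>] by simp
  moreover have "bracket h w - 2 *s w = (\<beta> h - 2) *s w"
    by (simp add: root_spaceD[OF w(1) h] scale_left_diff_distrib)
  moreover have "bracket h (k *s w) - l *s (k *s w) = ((\<beta> h - l) * k) *s w" for k l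
    by (simp add: bracket_scale_right root_spaceD[OF w(1) h] left_diff_distrib
        right_diff_distrib scale_left_diff_distrib mult.commute)
  ultimately have "((\<beta> h - 0) * ((\<beta> h - 1) * (\<beta> h - 2))) *s w = 0"
    using triple_deg_1_eigen[OF t, of w] by metis
  then show ?thesis using w(2) by auto
qed

text \<open>For \<open>w\<close> of weight \<beta> the vector \<open>[f, w]\<close> has weight
  \<open>\<beta> - \<alpha>\<close>, and it is nonzero because
  \<open>[e, [f, w]] = \<beta>(h) w\<close>.\<close>

lemma coroot_nonzero:
  assumes \<beta>: "\<beta> \<in> \<Delta>1" and n: "\<beta> h \<noteq> 0"
  shows "\<beta> - \<alpha> \<in> \<Delta> \<union> {0}"
proof (cases "\<beta> - \<alpha> = 0")
  case False
  obtain w where w: "w \<in> rs \<beta>" "w \<noteq> 0" using root_space_nonzero roots_degD[OF \<beta>] by blast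
  have "w \<in> deg 1" using root_space_deg[OF w(1)] roots_degD[OF \<beta>] by simp
  then have "bracket e (bracket f w) = \<beta> h *s w"
    using deg_1_commute[OF triple_deg(1)[OF t]] by (simp add: triple_e_f[OF t] root_spaceD[OF w(1) h])
  then have "bracket f w \<noteq> 0" using n w(2) by auto
  moreover have "bracket f w \<in> rs (\<beta> - \<alpha>)" using root_space_bracket[OF f w(1)] by simp
  moreover have "\<beta> - \<alpha> \<in> dual \<aa>" using dual_diff roots_degD[OF \<alpha>] roots_degD[OF \<beta>] by blast
  ultimately show ?thesis using rootI False by blast
qed simp

text \<open>A root vector \<open>v\<close> of weight \<open>\<alpha> - \<beta>\<close> would have
  \<open>h\<close>-weight 2. It is killed by \<open>e\<close>, since 4 is not a weight in degree 1;
  a highest weight vector of weight 2 has \<open>f^2 v\<close> nonzero, but \<open>f^2 v\<close>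
  lies in degree -2.\<close>

lemma coroot_zero:
  assumes \<beta>: "\<beta> \<in> \<Delta>1" and z: "\<beta> h = 0"
  shows "\<alpha> - \<beta> \<notin> \<Delta> \<union> {0}"
proof
  have wt: "(\<alpha> - \<beta>) h = 2" using z \<alpha>h by simp
  assume "\<alpha> - \<beta> \<in> \<Delta> \<union> {0}"
  moreover have "\<alpha> - \<beta> \<noteq> 0" using wt by auto
  ultimately have r: "\<alpha> - \<beta> \<in> \<Delta>" by blast
  obtain v where v: "v \<in> rs (\<alpha> - \<beta>)" "v \<noteq> 0" using root_space_nonzero[OF r] by blast
  have v0: "v \<in> deg 0" using root_space_deg[OF v(1)] roots_degD[OF \<alpha>] roots_degD[OF \<beta>] by simp
  have hv: "bracket h v = 2 *s v" using root_spaceD[OF v(1) h] wt by simp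
  have "bracket e v \<in> deg 1" by (rule deg_bracket[OF triple_deg(1)[OF t] v0]) simp
  from triple_deg_1_eigen[OF t this]
  have "(4 * (3 * 2)) *s bracket e v = 0"
    by (simp add: triple_h_e[OF t] hv bracket_scale_right bracket_diff_right flip: scale_left_distrib scale_left_diff_distrib)
  then have ev: "bracket e v = 0" by simp
  have "bracket f v \<in> deg (-1)" by (rule deg_bracket[OF triple_deg(2)[OF t] v0]) simp
  then have ff: "bracket f (bracket f v) = 0" by (rule deg_minus_1_commute[OF triple_deg(2)[OF t]])
  have efv: "bracket e (bracket f v) = 2 *s v" by (simp add: triple_e_f[OF t] ev hv)
  have "bracket h (bracket f v) = 0" by (simp add: triple_h_f[OF t] hv bracket_scale_right)
  then have "0 = bracket f (2 *s v)"
    using triple_e_f[OF t, of "bracket f v"] by (simp add: ff efv)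
  then have "bracket f v = 0" by (simp add: bracket_scale_right)
  then show False using efv v(2) by simp
qed

lemma coroot_zero_strongly_orthogonal:
  assumes \<beta>: "\<beta> \<in> \<Delta>1" and z: "\<beta> h = 0"
  shows "strongly_orthogonal \<aa> \<alpha> \<beta>" "strongly_orthogonal \<aa> \<beta> \<alpha>"
proof -
  have H2: "(\<alpha> + \<beta>) H = 2" using roots_degD[OF \<alpha>] roots_degD[OF \<beta>] by simp
  have "\<alpha> + \<beta> \<noteq> 0"
  proof
    assume "\<alpha> + \<beta> = 0"
    with H2 show False by (simp del: plus_fun_apply)
  qed
  moreover have "\<alpha> + \<beta> \<notin> \<Delta>"
  proof
    assume "\<alpha> + \<beta> \<in> \<Delta>"
    then obtain x where "x \<in> rs (\<alpha> + \<beta>)" "x \<noteq> 0" using root_space_nonzero by blast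
    then show False using deg_trivial[of x 2] root_space_deg[of x "\<alpha> + \<beta>"] H2 by simp
  qed
  moreover have "\<alpha> - \<beta> \<notin> \<Delta> \<union> {0}" by (rule coroot_zero[OF \<beta> z])
  ultimately show "strongly_orthogonal \<aa> \<alpha> \<beta>" "strongly_orthogonal \<aa> \<beta> \<alpha>"
    using roots_minus_commute[of \<alpha> \<beta>] by (auto simp: strongly_orthogonal_def add.commute[of \<beta>])
qed

text \<open>A vector of degree 0 killed by \<open>e\<close> would be a highest weight vector with
  \<open>f^2 v = 0\<close>, and this allows only the weights 0 and 1.\<close>

lemma weight_raise_nonzero:
  assumes v: "v \<in> deg 0" "v \<noteq> 0" "bracket h v = c *s v" and c: "c \<noteq> 0" "c \<noteq> 1"
  shows "bracket e v \<noteq> 0"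
proof
  assume ev: "bracket e v = 0"
  have "bracket f v \<in> deg (-1)" by (rule deg_bracket[OF triple_deg(2)[OF t] v(1)]) simp
  then have ff: "bracket f (bracket f v) = 0" by (rule deg_minus_1_commute[OF triple_deg(2)[OF t]])
  have efv: "bracket e (bracket f v) = c *s v" by (simp add: triple_e_f[OF t] ev v(3))
  have "0 = bracket f (c *s v) + (bracket f (c *s v) - 2 *s bracket f v)"
    using triple_e_f[OF t, of "bracket f v"] by (simp add: ff efv triple_h_f[OF t] v(3))
  then have "(c + (c - 2)) *s bracket f v = 0"
    unfolding bracket_scale_right scale_left_distrib scale_left_diff_distrib by (rule sym)
  moreover have "c + (c - 2) = 2 * (c - 1)" by simp
  ultimately have "bracket f v = 0" using c(2) by simp
  then show False using efv v(2) c(1) by simp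
qed

end

lemma coroot_exists:
  assumes \<alpha>: "\<alpha> \<in> \<Delta>1"
  obtains e h f where "e \<in> rs \<alpha>" "sl2_triple e h f" "h \<in> \<aa>" "f \<in> rs (- \<alpha>)" "\<alpha> h = 2"
proof -
  obtain e where "e \<in> rs \<alpha>" "e \<noteq> 0" using root_space_nonzero roots_degD[OF \<alpha>] by blast
  then show ?thesis using root_triple[OF \<alpha>] that by metis
qed

section \<open>A substitute for the height on the roots of degree one\<close>

lemma P_roots: "\<phi> \<in> P \<Longrightarrow> \<phi> \<in> \<Delta>"
  using positive by (auto simp: positive_roots_def)

lemma P_uminus: "\<phi> \<in> \<Delta> \<Longrightarrow> - \<phi> \<in> P \<longleftrightarrow> \<phi> \<notin> P"
  using positive by (auto simp: positive_roots_def)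

lemma P_minus: "\<beta> - \<alpha> \<in> P \<Longrightarrow> \<alpha> - \<beta> \<notin> P"
  using P_uminus[of "\<beta> - \<alpha>"] P_roots by auto

lemma P_add: "\<phi> \<in> P \<Longrightarrow> \<psi> \<in> P \<Longrightarrow> \<phi> + \<psi> \<in> \<Delta> \<Longrightarrow> \<phi> + \<psi> \<in> P"
  using positive by (auto simp: positive_roots_def)

lemma P_trans: "\<beta> - \<alpha> \<in> P \<Longrightarrow> \<gamma> - \<beta> \<in> P \<Longrightarrow> \<gamma> - \<alpha> \<in> \<Delta> \<union> {0} \<Longrightarrow> \<gamma> - \<alpha> \<in> P"
  using P_add[of "\<beta> - \<alpha>" "\<gamma> - \<beta>"] P_minus[of \<beta> \<alpha>] by auto

text \<open>Three positive steps in \<open>\<Delta>1\<close> can be replaced by two; this makes the order generated by the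
  positive roots of degree 0 acyclic on \<open>\<Delta>1\<close> without choosing a functional defining \<open>P\<close>.\<close>

lemma shorten_path:
  assumes D: "\<alpha>0 \<in> \<Delta>1" "\<alpha>1 \<in> \<Delta>1" "\<alpha>2 \<in> \<Delta>1" "\<alpha>3 \<in> \<Delta>1"
    and p: "\<alpha>1 - \<alpha>0 \<in> P" "\<alpha>2 - \<alpha>1 \<in> P" "\<alpha>3 - \<alpha>2 \<in> P"
  shows "\<exists>\<gamma>\<in>\<Delta>1. \<gamma> - \<alpha>0 \<in> P \<and> \<alpha>3 - \<gamma> \<in> P"
proof (cases "\<alpha>2 - \<alpha>0 \<in> \<Delta> \<union> {0} \<or> \<alpha>3 - \<alpha>1 \<in> \<Delta> \<union> {0}")
  case True
  then show ?thesis using P_trans[OF p(1,2)] P_trans[OF p(2,3)] D p by blast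
next
  case False
  obtain e2 h2 f2 where t2: "e2 \<in> rs \<alpha>2" "sl2_triple e2 h2 f2" "h2 \<in> \<aa>" "f2 \<in> rs (- \<alpha>2)" "\<alpha>2 h2 = 2"
    by (rule coroot_exists[OF D(3)])
  obtain e3 h3 f3 where t3: "e3 \<in> rs \<alpha>3" "sl2_triple e3 h3 f3" "h3 \<in> \<aa>" "f3 \<in> rs (- \<alpha>3)" "\<alpha>3 h3 = 2"
    by (rule coroot_exists[OF D(4)])
  note c2 = coroot_values[OF D(3) t2] coroot_nonzero[OF D(3) t2] coroot_zero[OF D(3) t2]
  note c3 = coroot_values[OF D(4) t3] coroot_nonzero[OF D(4) t3] coroot_zero[OF D(4) t3]
  \<comment> \<open>The path is rearranged: the middle step is taken first, and the two outer steps
    are merged into \<open>\<alpha>3 - \<gamma>\<close>.\<close>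
  let ?\<gamma> = "\<alpha>0 + (\<alpha>2 - \<alpha>1)"
  have d: "\<alpha>0 \<in> dual \<aa>" "\<alpha>1 \<in> dual \<aa>" "\<alpha>2 \<in> dual \<aa>" and H1: "\<alpha>0 H = 1" "\<alpha>1 H = 1" "\<alpha>2 H = 1"
    using D roots_degD by (simp_all, (metis of_int_1 roots_degD)+)
  have a0h2: "\<alpha>0 h2 = 0"
    using c2(2)[OF D(1)] False roots_minus_commute[of \<alpha>0 \<alpha>2] by auto
  have "\<alpha>2 - \<alpha>1 \<in> \<Delta>" using P_roots[OF p(2)] .
  then have "\<alpha>1 h2 \<noteq> 0" using c2(3)[OF D(2)] by blast
  then have a1h2: "\<alpha>1 h2 = 1 \<or> \<alpha>1 h2 = 2" using c2(1)[OF D(2)] by blast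
  have "\<alpha>0 - \<alpha>1 \<in> \<Delta>" using P_roots[OF p(1)] roots_minus_commute by blast
  then obtain v where v: "v \<in> rs (\<alpha>0 - \<alpha>1)" "v \<noteq> 0" using root_space_nonzero by blast
  have hv: "bracket h2 v = (- \<alpha>1 h2) *s v" using root_spaceD[OF v(1) t2(3)] a0h2 by simp
  have v0: "v \<in> deg 0" using root_space_deg[OF v(1)] H1 by simp
  \<comment> \<open>For the coroot \<open>h2\<close> the vector \<open>v\<close> has weight -1 or
    -2, so raising it by \<open>e2\<close> cannot give zero; this shows that \<gamma> is a
    root.\<close>
  have "bracket e2 v \<noteq> 0"
    by (rule weight_raise_nonzero[OF D(3) t2 v0 v(2) hv]) (use a1h2 in auto)
  moreover have "bracket e2 v \<in> rs ?\<gamma>"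
    using root_space_bracket[OF t2(1) v(1)] by (simp add: algebra_simps)
  moreover have "?\<gamma> \<in> dual \<aa>" by (intro dual_add dual_diff d)
  ultimately have \<gamma>: "?\<gamma> \<in> \<Delta>1" using H1 by (intro roots_degI) auto
  \<comment> \<open>At \<open>h3\<close> the middle root contributes 0, \<open>\<alpha>2\<close>
    contributes 1 or 2 and \<open>\<alpha>0\<close> is not negative, so \<open>\<gamma>(h3)\<close>
    cannot vanish.\<close>
  have "\<alpha>1 h3 = 0" using c3(2)[OF D(2)] False roots_minus_commute[of \<alpha>1 \<alpha>3] by auto
  moreover have "\<alpha>2 h3 \<noteq> 0" using c3(3)[OF D(3)] P_roots[OF p(3)] by blast
  ultimately have "?\<gamma> h3 \<noteq> 0" using c3(1)[OF D(1)] c3(1)[OF D(3)] by auto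
  then have "?\<gamma> - \<alpha>3 \<in> \<Delta> \<union> {0}" by (rule c3(2)[OF \<gamma>])
  moreover have g: "?\<gamma> - \<alpha>3 = - ((\<alpha>3 - \<alpha>2) + (\<alpha>1 - \<alpha>0))" by (simp add: algebra_simps)
  moreover have "(\<alpha>3 - \<alpha>2) + (\<alpha>1 - \<alpha>0) \<noteq> 0"
    using P_uminus[of "\<alpha>1 - \<alpha>0"] p(1,3) P_roots by (auto simp: add_eq_0_iff2 simp del: minus_diff_eq)
  ultimately have "?\<gamma> - \<alpha>3 \<in> \<Delta>" by (metis Un_iff neg_equal_0_iff_equal singletonD)
  then have "(\<alpha>3 - \<alpha>2) + (\<alpha>1 - \<alpha>0) \<in> \<Delta>" using roots_uminus g by (metis minus_minus)
  then have "(\<alpha>3 - \<alpha>2) + (\<alpha>1 - \<alpha>0) \<in> P" by (rule P_add[OF p(3,1)])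
  then have "\<alpha>3 - ?\<gamma> \<in> P" by (simp add: algebra_simps)
  moreover have "?\<gamma> - \<alpha>0 \<in> P" using p(2) by simp
  ultimately show ?thesis using \<gamma> by blast
qed

text \<open>By \<open>shorten_path\<close> these one or two steps already form a relation closed
  under appending positive steps within \<open>\<Delta>1\<close>. The short form makes irreflexivity
  evident: a loop would put 0, or a root together with its negative, into \<open>P\<close>.\<close>

definition below :: "('g \<Rightarrow> 'k) \<Rightarrow> ('g \<Rightarrow> 'k) \<Rightarrow> bool" where
  "below \<alpha> \<beta> \<longleftrightarrow> \<beta> - \<alpha> \<in> P \<or> (\<exists>\<gamma>\<in>\<Delta>1. \<gamma> - \<alpha> \<in> P \<and> \<beta> - \<gamma> \<in> P)"

lemma below_irrefl: "\<not> below \<alpha> \<alpha>"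
  using P_roots[of 0] root_neq_zero P_minus by (auto simp: below_def)

lemma below_step: "\<alpha> \<in> \<Delta>1 \<Longrightarrow> \<beta> \<in> \<Delta>1 \<Longrightarrow> \<gamma> \<in> \<Delta>1 \<Longrightarrow> below \<alpha> \<beta> \<Longrightarrow> \<gamma> - \<beta> \<in> P \<Longrightarrow> below \<alpha> \<gamma>"
  unfolding below_def using shorten_path by blast

lemma finite_\<Delta>1: "finite \<Delta>1"
  using finite_roots[of \<aa>] by (simp add: roots_deg_def)

text \<open>Takes the place of the height: it increases strictly along positive steps and stays
  below \<open>card \<Delta>1\<close>.\<close>

definition rank :: "('g \<Rightarrow> 'k) \<Rightarrow> nat" where
  "rank \<beta> = card {\<alpha> \<in> \<Delta>1. below \<alpha> \<beta>}"

lemma rank_less: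
  assumes "\<alpha> \<in> \<Delta>1" "\<beta> \<in> \<Delta>1" "\<beta> - \<alpha> \<in> P"
  shows "rank \<alpha> < rank \<beta>"
  unfolding rank_def
proof (rule psubset_card_mono)
  show "finite {\<alpha> \<in> \<Delta>1. below \<alpha> \<beta>}" using finite_\<Delta>1 by simp
  have "below \<alpha> \<beta>" using assms(3) by (simp add: below_def)
  then show "{\<gamma> \<in> \<Delta>1. below \<gamma> \<alpha>} \<subset> {\<gamma> \<in> \<Delta>1. below \<gamma> \<beta>}"
    using below_irrefl[of \<alpha>] below_step[OF _ assms(1,2) _ assms(3)] assms(1) by blast
qed

lemma rank_bound: "\<beta> \<in> \<Delta>1 \<Longrightarrow> rank \<beta> < card \<Delta>1"
  unfolding rank_def using below_irrefl finite_\<Delta>1 by (intro psubset_card_mono) blast+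

end

section \<open>The group of the positive roots of degree zero\<close>

context lie_algebra
begin

lemma root_sum_component:
  assumes L: "finite \<Lambda>" "\<Lambda> \<subseteq> dual \<aa>" "\<forall>\<phi>\<in>\<Lambda>. v \<phi> \<in> root_space \<aa> \<phi>"
    and S: "S \<subseteq> dual \<aa>" "sum v \<Lambda> \<in> root_space_sum \<aa> S" and p: "\<phi> \<in> \<Lambda>" "\<phi> \<notin> S"
  shows "v \<phi> = 0"
proof -
  obtain J f where J: "finite J" "J \<subseteq> S" "\<forall>\<phi>\<in>J. f \<phi> \<in> root_space \<aa> \<phi>" "sum v \<Lambda> = sum f J"
    using span_UN_sum[of "root_space \<aa>" "sum v \<Lambda>" S, OF subspace_root_space] S(2)
    unfolding root_space_sum_def by blast
  let ?v = "\<lambda>\<phi>. (if \<phi> \<in> \<Lambda> then v \<phi> else 0) - (if \<phi> \<in> J then f \<phi> else 0)"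
  have "(\<Sum>\<phi>\<in>\<Lambda> \<union> J. if \<phi> \<in> \<Lambda> then v \<phi> else 0) = sum v \<Lambda>"
    "(\<Sum>\<phi>\<in>\<Lambda> \<union> J. if \<phi> \<in> J then f \<phi> else 0) = sum f J"
    by (rule sum.mono_neutral_cong_right; use L(1) J(1) in auto)+
  then have z: "sum ?v (\<Lambda> \<union> J) = 0" by (simp only: sum_subtractf J(4) diff_self)
  have "?v \<phi> = 0"
  proof (rule root_spaces_independent[of "\<Lambda> \<union> J" \<aa> ?v])
    show "\<forall>\<phi>\<in>\<Lambda> \<union> J. ?v \<phi> \<in> root_space \<aa> \<phi>"
      by (intro ballI subspace_diff[OF subspace_root_space])
        (use L(3) J(3) subspace_0[OF subspace_root_space] in auto)
  qed (use L(1,2) J(1,2) S(1) p z in auto)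
  then show ?thesis using p J(2) by (auto split: if_splits)
qed

lemma subspace_root_space_sum: "subspace (root_space_sum \<aa> S)"
  unfolding root_space_sum_def by (rule subspace_span)

lemma root_space_sum_base: "x \<in> root_space \<aa> \<phi> \<Longrightarrow> \<phi> \<in> S \<Longrightarrow> x \<in> root_space_sum \<aa> S"
  unfolding root_space_sum_def by (rule span_base) blast

lemma root_space_sum_induct:
  assumes A: "lin A" and W: "subspace W" and base: "\<And>\<phi> x. \<phi> \<in> S \<Longrightarrow> x \<in> root_space \<aa> \<phi> \<Longrightarrow> A x \<in> W"
    and x: "x \<in> root_space_sum \<aa> S"
  shows "A x \<in> W"
  by (rule lin_span_subset[OF A W _ x[unfolded root_space_sum_def]]) (use base in blast)

lemma root_space_sum_mono: "S \<subseteq> S' \<Longrightarrow> root_space_sum \<aa> S \<subseteq> root_space_sum \<aa> S'"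
  unfolding root_space_sum_def by (rule span_mono) blast

lemma root_space_sum_empty: "root_space_sum \<aa> {} = {0}"
  by (simp add: root_space_sum_def)

end

context short_graded_roots
begin

abbreviation P0 :: "('g \<Rightarrow> 'k) set" where "P0 \<equiv> roots_deg \<aa> H 0 \<inter> P"

definition \<nn> :: "'g set" where "\<nn> = root_space_sum \<aa> P0"

lemma subspace_nn: "subspace \<nn>"
  by (simp add: \<nn>_def subspace_root_space_sum)

lemma P0D: "\<phi> \<in> P0 \<Longrightarrow> \<phi> \<in> P \<and> \<phi> \<in> \<Delta> \<and> \<phi> \<in> dual \<aa> \<and> \<phi> H = 0"
  using roots_degD[of \<phi> 0] by auto

lemma nn_deg: "u \<in> \<nn> \<Longrightarrow> u \<in> deg 0"
  unfolding \<nn>_def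
proof (rule root_space_sum_induct[of "\<lambda>x. x"])
  show "x \<in> deg 0" if "\<phi> \<in> P0" "x \<in> rs \<phi>" for \<phi> x
    using P0D[OF that(1)] root_space_deg[OF that(2)] by simp
qed (auto intro: linI subspace_deg)

lemma bracket_nn:
  assumes "u \<in> \<nn>" "v \<in> \<nn>"
  shows "bracket u v \<in> \<nn>"
proof (rule root_space_sum_induct[OF lin_bracket subspace_nn _ assms(2)[unfolded \<nn>_def]])
  fix \<psi> y assume y: "\<psi> \<in> P0" "y \<in> rs \<psi>"
  show "bracket u y \<in> \<nn>"
  proof (rule root_space_sum_induct[OF lin_bracket_left subspace_nn _ assms(1)[unfolded \<nn>_def]])
    fix \<phi> x assume x: "\<phi> \<in> P0" "x \<in> rs \<phi>"
    show "bracket x y \<in> \<nn>"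
    proof (cases "bracket x y = 0")
      case True
      then show ?thesis by (simp add: subspace_0 subspace_nn)
    next
      case False
      have b: "bracket x y \<in> rs (\<phi> + \<psi>)" by (rule root_space_bracket[OF x(2) y(2)])
      have "\<phi> + \<psi> \<noteq> 0"
        using P_uminus[of \<phi>] P0D[OF x(1)] P0D[OF y(1)] by (auto simp: add_eq_0_iff)
      then have r: "\<phi> + \<psi> \<in> \<Delta>"
        using rootI[OF b False] dual_add P0D[OF x(1)] P0D[OF y(1)] by blast
      then have "\<phi> + \<psi> \<in> P" using P_add P0D[OF x(1)] P0D[OF y(1)] by blast
      moreover have "(\<phi> + \<psi>) H = 0" using P0D[OF x(1)] P0D[OF y(1)] by simp
      ultimately have "\<phi> + \<psi> \<in> P0" using r by (simp add: roots_deg_def)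
      then show ?thesis unfolding \<nn>_def by (rule root_space_sum_base[OF b])
    qed
  qed
qed

lemma bracket_nn_a:
  assumes "u \<in> \<nn>" "h \<in> \<aa>"
  shows "bracket u h \<in> \<nn>"
proof (rule root_space_sum_induct[OF lin_bracket_left subspace_nn _ assms(1)[unfolded \<nn>_def]])
  fix \<phi> x assume x: "\<phi> \<in> P0" "x \<in> rs \<phi>"
  then have "x \<in> \<nn>" unfolding \<nn>_def using root_space_sum_base by blast
  then have "- (\<phi> h *s x) \<in> \<nn>" by (intro subspace_neg subspace_scale subspace_nn)
  then show "bracket x h \<in> \<nn>"
    using root_spaceD[OF x(2) assms(2)] by (simp add: bracket_anti[of x h])
qed

text \<open>A descending filtration of degree 1 that every element of \<open>\<nn>\<close> shifts by
  at least one stage; it reaches 0 after \<open>card \<Delta>1\<close> stages.\<close>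

definition rank_filtration :: "nat \<Rightarrow> 'g set" where
  "rank_filtration k = root_space_sum \<aa> {\<beta> \<in> \<Delta>1. k \<le> rank \<beta>}"

lemma rank_filtration_0: "x \<in> deg 1 \<Longrightarrow> x \<in> rank_filtration 0"
proof -
  assume "x \<in> deg 1"
  then obtain \<Lambda> v where L: "finite \<Lambda>" "\<Lambda> \<subseteq> {\<phi> \<in> dual \<aa>. \<phi> H = 1}"
    "\<forall>\<phi>\<in>\<Lambda>. v \<phi> \<in> rs \<phi> \<and> v \<phi> \<noteq> 0" "x = sum v \<Lambda>"
    by (rule deg_decomposition)
  then have "v \<phi> \<in> rank_filtration 0" if "\<phi> \<in> \<Lambda>" for \<phi>
    using that roots_degI[of "v \<phi>" \<phi>] unfolding rank_filtration_def by (intro root_space_sum_base) auto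
  then show ?thesis
    unfolding L(4) rank_filtration_def by (intro subspace_sum[OF subspace_root_space_sum])
qed

lemma rank_filtration_antimono: "k \<le> l \<Longrightarrow> rank_filtration l \<subseteq> rank_filtration k"
  unfolding rank_filtration_def by (rule root_space_sum_mono) auto

lemma rank_filtration_trivial: "card \<Delta>1 \<le> k \<Longrightarrow> rank_filtration k = {0}"
proof -
  assume k: "card \<Delta>1 \<le> k"
  have e: "{\<beta> \<in> \<Delta>1. k \<le> rank \<beta>} = {}" using rank_bound k by fastforce
  show ?thesis unfolding rank_filtration_def e by (rule root_space_sum_empty)
qed

lemma subspace_rank_filtration: "subspace (rank_filtration k)"
  by (simp add: rank_filtration_def subspace_root_space_sum)

lemma bracket_nn_rank_filtration:
  assumes "u \<in> \<nn>" "w \<in> rank_filtration k"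
  shows "bracket u w \<in> rank_filtration (Suc k)"
proof (rule root_space_sum_induct[OF lin_bracket subspace_rank_filtration _ assms(2)[unfolded rank_filtration_def]])
  fix \<beta> w assume w: "\<beta> \<in> {\<beta> \<in> \<Delta>1. k \<le> rank \<beta>}" "w \<in> rs \<beta>"
  show "bracket u w \<in> rank_filtration (Suc k)"
  proof (rule root_space_sum_induct[OF lin_bracket_left subspace_rank_filtration _ assms(1)[unfolded \<nn>_def]])
    fix \<phi> x assume x: "\<phi> \<in> P0" "x \<in> rs \<phi>"
    show "bracket x w \<in> rank_filtration (Suc k)"
    proof (cases "bracket x w = 0")
      case True
      then show ?thesis by (simp add: subspace_0 subspace_rank_filtration)
    next
      case False
      have b: "bracket x w \<in> rs (\<phi> + \<beta>)" by (rule root_space_bracket[OF x(2) w(2)])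
      have \<beta>: "\<beta> \<in> \<Delta>1" "\<beta> \<in> dual \<aa>" "\<beta> H = 1" using w(1) roots_degD[of \<beta> 1] by auto
      then have "\<phi> + \<beta> \<in> \<Delta>1"
        using P0D[OF x(1)] by (intro roots_degI[OF b False] dual_add) auto
      moreover from this have "rank \<beta> < rank (\<phi> + \<beta>)"
        using P0D[OF x(1)] by (intro rank_less \<beta>(1)) auto
      ultimately have "\<phi> + \<beta> \<in> {\<beta> \<in> \<Delta>1. Suc k \<le> rank \<beta>}" using w(1) by auto
      then show ?thesis unfolding rank_filtration_def by (rule root_space_sum_base[OF b])
    qed
  qed
qed

text \<open>Words in different elements of \<open>\<nn>\<close> are needed, not just powers of a
  single one: the filtration in \<open>unipotent_nilpotent\<close> is built from such words.\<close>

definition nilpotent_on :: "'g set \<Rightarrow> nat \<Rightarrow> bool" where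
  "nilpotent_on A m \<longleftrightarrow>
     (\<forall>us x. set us \<subseteq> \<nn> \<longrightarrow> x \<in> A \<longrightarrow> m \<le> length us \<longrightarrow> foldr bracket us x = 0)"

lemma lin_foldr: "lin (foldr bracket us)"
  by (induction us) (auto intro!: linI simp: lin_add lin_scale bracket_add_right bracket_scale_right)

lemma nilpotent_on_deg_1: "nilpotent_on (deg 1) (card \<Delta>1)"
proof -
  have "foldr bracket us x \<in> rank_filtration (length us)" if "set us \<subseteq> \<nn>" "x \<in> deg 1" for us x
    using that by (induction us) (auto simp: rank_filtration_0 bracket_nn_rank_filtration)
  then show ?thesis unfolding nilpotent_on_def using rank_filtration_trivial by blast
qed

text \<open>Moving factors across the bracket of \<open>A\<close> with \<open>deg 1\<close> by the Leibniz rule, nilpotency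
  passes to any space on which \<open>deg 1\<close> acts faithfully.\<close>

lemma nilpotent_on_transfer:
  assumes p: "nilpotent_on (deg 1) p" and q: "nilpotent_on C q"
    and AC: "\<And>y w. y \<in> A \<Longrightarrow> w \<in> deg 1 \<Longrightarrow> bracket y w \<in> C"
    and A: "\<And>u y. u \<in> deg 0 \<Longrightarrow> y \<in> A \<Longrightarrow> bracket u y \<in> A"
    and faithful: "\<And>y. y \<in> A \<Longrightarrow> (\<And>w. w \<in> deg 1 \<Longrightarrow> bracket y w = 0) \<Longrightarrow> y = 0"
  shows "nilpotent_on A (p + q)"
proof -
  have deg1: "foldr bracket us w \<in> deg 1" if "set us \<subseteq> \<nn>" "w \<in> deg 1" for us w
    using that
  proof (induction us)
    case (Cons u us)
    then show ?case using deg_bracket[of u 0 "foldr bracket us w" 1 1] nn_deg by auto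
  qed simp
  have inA: "foldr bracket us y \<in> A" if "set us \<subseteq> \<nn>" "y \<in> A" for us y
    using that by (induction us) (auto intro: A nn_deg)
  \<comment> \<open>The words \<open>us\<close>, \<open>us1\<close>, \<open>us2\<close> act on
    \<open>y\<close>, on the bracket and on \<open>w\<close>. The Leibniz rule moves one letter out
    of \<open>us\<close> into one of the other two and keeps the total length; once
    \<open>us\<close> is empty, \<open>us1\<close> has length at least \<open>q\<close> or
    \<open>us2\<close> at least \<open>p\<close>.\<close>
  have claim: "foldr bracket us1 (bracket (foldr bracket us y) (foldr bracket us2 w)) = 0"
    if "set us \<subseteq> \<nn>" "set us1 \<subseteq> \<nn>" "set us2 \<subseteq> \<nn>" "y \<in> A" "w \<in> deg 1"
      "p + q \<le> length us1 + length us + length us2" for us us1 us2 y w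
    using that
  proof (induction us arbitrary: us1 us2)
    case Nil
    then consider "p \<le> length us2" | "q \<le> length us1" by force
    then show ?case
    proof cases
      case 1
      then have "foldr bracket us2 w = 0" using p Nil by (auto simp: nilpotent_on_def)
      then show ?thesis by (simp add: lin_zero[OF lin_foldr])
    next
      case 2
      then show ?thesis using q Nil AC deg1 by (auto simp: nilpotent_on_def)
    qed
  next
    case (Cons u us)
    let ?Y = "foldr bracket us y" and ?W = "foldr bracket us2 w"
    have "foldr bracket (us1 @ [u]) (bracket ?Y ?W) = 0"
      by (rule Cons.IH) (use Cons.prems in auto)
    moreover have "foldr bracket us1 (bracket ?Y (foldr bracket (u # us2) w)) = 0"
      by (rule Cons.IH) (use Cons.prems in auto)
    ultimately show ?case
      by (simp add: bracket_bracket_left lin_diff[OF lin_foldr])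
  qed
  show ?thesis
    unfolding nilpotent_on_def
  proof (intro allI impI)
    fix us y assume us: "set us \<subseteq> \<nn>" "y \<in> A" "p + q \<le> length us"
    show "foldr bracket us y = 0"
      by (rule faithful[OF inA[OF us(1,2)]]) (use claim[of us "[]" "[]" y] us in auto)
  qed
qed

text \<open>With \<open>m = card \<Delta>1\<close> the bounds in degrees 1, 0, -1 are
  \<open>m\<close>, \<open>2 m\<close>, \<open>3 m\<close>, since bracketing with degree 1 takes
  degree 0 to degree 1 and degree -1 to degree 0.\<close>

lemma nilpotent_on_UNIV: "\<exists>m. nilpotent_on UNIV m"
proof -
  let ?m = "card \<Delta>1"
  have 0: "nilpotent_on (deg 0) (?m + ?m)"
    by (rule nilpotent_on_transfer[OF nilpotent_on_deg_1 nilpotent_on_deg_1])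
      (auto intro: deg_bracket deg_zero_faithful)
  have m: "nilpotent_on (deg (-1)) (?m + (?m + ?m))"
    by (rule nilpotent_on_transfer[OF nilpotent_on_deg_1 0])
      (auto intro: deg_bracket deg_minus_faithful)
  have "foldr bracket us x = 0" if us: "set us \<subseteq> \<nn>" "?m + (?m + ?m) \<le> length us" for us x
  proof -
    obtain a b c where x: "x = a + b + c" "a \<in> deg (-1)" "b \<in> deg 0" "c \<in> deg 1" by (rule deg_cases)
    have "foldr bracket us a = 0" "foldr bracket us b = 0" "foldr bracket us c = 0"
      using m 0 nilpotent_on_deg_1 us x unfolding nilpotent_on_def by auto
    then show ?thesis by (simp add: x(1) lin_add[OF lin_foldr])
  qed
  then show ?thesis unfolding nilpotent_on_def by blast
qed

lemma nn_nilpotent: "\<exists>K>0. \<forall>u\<in>\<nn>. \<forall>x. (bracket u ^^ K) x = 0"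
proof -
  obtain m where m: "nilpotent_on UNIV m" using nilpotent_on_UNIV by blast
  have "(bracket u ^^ k) x = foldr bracket (replicate k u) x" for u x k
    by (induction k) auto
  moreover have "foldr bracket (replicate (Suc m) u) x = 0" if "u \<in> \<nn>" for u x
    by (rule m[unfolded nilpotent_on_def, rule_format]) (use that in auto)
  ultimately have "(bracket u ^^ Suc m) x = 0" if "u \<in> \<nn>" for u x
    using that by metis
  then show ?thesis by blast
qed

text \<open>The condition on pairs \<open>W' \<subseteq> W\<close> is stable under composition and under taking logarithms, so it
  replaces the Baker--Campbell--Hausdorff formula in showing that \<open>exp (ad \<nn>)\<close> is a group.\<close>

definition unipotent :: "('g \<Rightarrow> 'g) \<Rightarrow> bool" where
  "unipotent T \<longleftrightarrow> automorphism T \<and>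
     (\<forall>W W'. subspace W \<longrightarrow> subspace W' \<longrightarrow> W' \<subseteq> W \<longrightarrow> (\<forall>u\<in>\<nn>. \<forall>w\<in>W. bracket u w \<in> W') \<longrightarrow>
       (\<forall>w\<in>W. T w - w \<in> W'))"

lemma unipotentD:
  assumes "unipotent T" "subspace W" "subspace W'" "W' \<subseteq> W"
    "\<And>u w. u \<in> \<nn> \<Longrightarrow> w \<in> W \<Longrightarrow> bracket u w \<in> W'" "w \<in> W"
  shows "T w - w \<in> W'"
  using assms(1)[unfolded unipotent_def, THEN conjunct2, rule_format, OF assms(2-5)] assms(6) by blast

lemma unipotent_exp:
  assumes u: "u \<in> \<nn>"
  shows "unipotent (exp_ad u)"
proof -
  obtain K where K: "K > 0" "\<And>x. (bracket u ^^ K) x = 0" using nn_nilpotent u by blast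
  have e: "exp_ad u = fps_eval K (bracket u) (fps_exp 1)" by (rule exp_ad_eq_fps_eval[OF K(2)])
  have "exp_ad u w - w = fps_eval K (bracket u) (fps_exp 1 - 1) w" for w
    by (simp add: e fps_eval_diff fps_eval_1[OF K(1)])
  then have main: "exp_ad u w - w \<in> W'" if "subspace W'" "W' \<subseteq> W" "\<forall>u\<in>\<nn>. \<forall>w\<in>W. bracket u w \<in> W'" "w \<in> W" for W W' w
    using fps_eval_in_subspace[of W' W "bracket u" "fps_exp 1 - 1" w K] that u by simp
  have "automorphism (exp_ad u)"
    unfolding e by (rule exp_derivation_automorphism[OF derivation_bracket K(2)])
  show ?thesis
    unfolding unipotent_def
  proof (intro conjI allI impI ballI)
    fix W W' w
    assume "subspace W" "subspace W'" "W' \<subseteq> W" "\<forall>u\<in>\<nn>. \<forall>w\<in>W. bracket u w \<in> W'" "w \<in> W"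
    then show "exp_ad u w - w \<in> W'" by (intro main)
  qed fact
qed

lemma unipotent_comp:
  assumes S: "unipotent S" and T: "unipotent T"
  shows "unipotent (\<lambda>x. S (T x))"
proof -
  have main: "S (T w) - w \<in> W'" if W: "subspace W" "subspace W'" "W' \<subseteq> W" "\<forall>u\<in>\<nn>. \<forall>w\<in>W. bracket u w \<in> W'" "w \<in> W" for W W' w
  proof -
    have Tw: "T w - w \<in> W'" by (rule unipotentD[OF T W(1-3)]) (use W in auto)
    then have "T w - w + w \<in> W" using W by (intro subspace_add) auto
    then have "S (T w) - T w \<in> W'" by (intro unipotentD[OF S W(1-3)]) (use W in auto)
    from subspace_add[OF W(2) this Tw] show ?thesis by simp
  qed
  have "automorphism S" "automorphism T" using S T by (simp_all add: unipotent_def)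
  then have "automorphism (\<lambda>x. S (T x))" by (rule automorphism_comp)
  show ?thesis
    unfolding unipotent_def
  proof (intro conjI allI impI ballI)
    fix W W' w
    assume "subspace W" "subspace W'" "W' \<subseteq> W" "\<forall>u\<in>\<nn>. \<forall>w\<in>W. bracket u w \<in> W'" "w \<in> W"
    then show "S (T w) - w \<in> W'" by (intro main)
  qed fact
qed

text \<open>The spans \<open>W k\<close> of words of length at least \<open>k\<close> form a
  decreasing chain in which \<open>\<nn>\<close> maps each term into the next, so
  \<open>T - 1\<close> does the same, and the chain ends at 0.\<close>

lemma unipotent_nilpotent:
  assumes T: "unipotent T"
  shows "\<exists>K. \<forall>x. ((\<lambda>x. T x - x) ^^ K) x = 0"
proof -
  let ?M = "\<lambda>x. T x - x"
  obtain m where m: "nilpotent_on UNIV m" using nilpotent_on_UNIV by blast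
  define W where "W k = span {foldr bracket us x | us x. set us \<subseteq> \<nn> \<and> k \<le> length us}" for k
  have sub: "subspace (W k)" for k by (simp add: W_def)
  have mono: "W (Suc k) \<subseteq> W k" for k unfolding W_def by (rule span_mono) auto
  have step: "bracket u w \<in> W (Suc k)" if u: "u \<in> \<nn>" and w: "w \<in> W k" for u w k
  proof (rule lin_span_subset[OF lin_bracket sub _ w[unfolded W_def]])
    fix y assume "y \<in> {foldr bracket us x | us x. set us \<subseteq> \<nn> \<and> k \<le> length us}"
    then obtain us x where "y = foldr bracket us x" "set us \<subseteq> \<nn>" "k \<le> length us" by blast
    then show "bracket u y \<in> W (Suc k)"
      unfolding W_def using u by (intro span_base CollectI exI[of _ "u # us"] exI[of _ x]) auto
  qed
  have "(?M ^^ k) x \<in> W k" for k x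
  proof (induction k)
    case 0
    show ?case unfolding W_def by (intro span_base CollectI exI[of _ "[]"] exI[of _ x]) auto
  next
    case (Suc k)
    have "?M ((?M ^^ k) x) \<in> W (Suc k)"
      by (rule unipotentD[OF T sub sub mono step Suc])
    then show ?case by simp
  qed
  moreover have "W m = {0}"
  proof -
    have "{foldr bracket us x | us x. set us \<subseteq> \<nn> \<and> m \<le> length us} \<subseteq> {0}"
      using m by (auto simp: nilpotent_on_def)
    then have "W m \<subseteq> {0}" unfolding W_def by (rule span_minimal) simp
    then show ?thesis using subspace_0[OF sub] by blast
  qed
  ultimately show ?thesis by blast
qed

text \<open>The logarithm of \<open>T\<close> is an inner derivation \<open>ad w\<close>; it maps \<open>\<aa>\<close> into \<open>\<nn>\<close>, so \<open>w\<close> lies in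
  \<open>\<nn>\<close> up to a summand commuting with \<open>\<aa>\<close>, which vanishes because \<open>T\<close> acts unipotently on \<open>deg 1\<close>.\<close>

lemma unipotent_is_exp:
  assumes T: "unipotent T"
  shows "\<exists>w\<in>\<nn>. T = exp_ad w"
proof -
  obtain K where K: "\<And>x. ((\<lambda>x. T x - x) ^^ K) x = 0" using unipotent_nilpotent[OF T] by blast
  have "automorphism T" using T by (simp add: unipotent_def)
  then obtain D F N where D: "derivation D" "\<forall>x. (D ^^ N) x = 0" "fps_nth F 0 = 0"
    "D = fps_eval N (\<lambda>x. T x - x) F" "T = fps_eval N D (fps_exp 1)"
    by (rule unipotent_automorphism_log[OF _ K])
  obtain w where w: "D = bracket w" using derivation_inner[OF D(1)] by blast
  have DW: "D x \<in> W'" if W: "subspace W" "subspace W'" "W' \<subseteq> W" "\<And>u w. u \<in> \<nn> \<Longrightarrow> w \<in> W \<Longrightarrow> bracket u w \<in> W'" "x \<in> W" for W W' x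
    unfolding D(4)
    by (rule fps_eval_in_subspace[OF W(2,3) unipotentD[OF T W(1-4)] D(3) W(5)])
  \<comment> \<open>\<open>\<nn>\<close> inside \<open>span (insert h \<nn>)\<close> is an
    admissible pair, because \<open>\<nn>\<close> is a subalgebra normalized by
    \<open>\<aa>\<close>.\<close>
  have wh: "bracket w h \<in> \<nn>" if h: "h \<in> \<aa>" for h
    unfolding w[symmetric]
  proof (rule DW[of "span (insert h \<nn>)" \<nn>])
    show "\<nn> \<subseteq> span (insert h \<nn>)" using span_superset[of "insert h \<nn>"] by blast
    show "bracket u x \<in> \<nn>" if u: "u \<in> \<nn>" and x: "x \<in> span (insert h \<nn>)" for u x
      by (rule lin_span_subset[OF lin_bracket subspace_nn _ x]) (use u h bracket_nn bracket_nn_a in blast)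
  qed (auto intro: subspace_nn span_base)
  obtain \<Lambda> v where L: "finite \<Lambda>" "\<Lambda> \<subseteq> dual \<aa>" "\<forall>\<phi>\<in>\<Lambda>. v \<phi> \<in> rs \<phi>" "w = sum v \<Lambda>"
    by (rule root_decomposition[OF split_abelian_a])
  have P0d: "P0 \<subseteq> dual \<aa>" using P0D by blast
  \<comment> \<open>The component of weight \<phi> in \<open>[h, w] = - [w, h]\<close> is
    \<open>\<phi>(h) v(\<phi>)\<close>, while this bracket lies in \<open>\<nn>\<close>.\<close>
  have vz: "v \<phi> = 0" if p: "\<phi> \<in> \<Lambda>" "\<phi> \<notin> P0" "\<phi> \<noteq> 0" for \<phi>
  proof -
    have "\<exists>h\<in>\<aa>. \<phi> h \<noteq> 0 h" by (rule dual_neqD[OF _ dual_zero p(3)]) (use L(2) p(1) in blast)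
    then obtain h where h: "h \<in> \<aa>" "\<phi> h \<noteq> 0" by auto
    have vl: "bracket h (v \<psi>) = \<psi> h *s v \<psi>" if "\<psi> \<in> \<Lambda>" for \<psi> using L(3) that h(1) root_spaceD by blast
    have "(\<Sum>\<psi>\<in>\<Lambda>. \<psi> h *s v \<psi>) = bracket h w"
      unfolding L(4) bracket_sum_right by (rule sum.cong) (simp_all add: vl)
    also have "\<dots> = - bracket w h" by (rule bracket_anti)
    also have "\<dots> \<in> \<nn>" by (rule subspace_neg[OF subspace_nn wh[OF h(1)]])
    finally have s: "(\<Sum>\<psi>\<in>\<Lambda>. \<psi> h *s v \<psi>) \<in> root_space_sum \<aa> P0" by (simp add: \<nn>_def)
    have "\<phi> h *s v \<phi> = 0"
      by (rule root_sum_component[OF L(1,2) _ P0d s p(1,2)])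
        (use L(3) subspace_scale[OF subspace_root_space] in blast)
    then show ?thesis using h(2) by simp
  qed
  define w' where "w' = sum v (\<Lambda> \<inter> P0)"
  define w0 where "w0 = sum v (\<Lambda> \<inter> {0})"
  have "0 \<notin> P0" using P0D root_neq_zero by blast
  have "w = sum v (\<Lambda> \<inter> P0 \<union> \<Lambda> \<inter> {0})"
    unfolding L(4) by (rule sum.mono_neutral_right) (use L(1) vz in auto)
  also have "\<dots> = w' + w0"
    unfolding w'_def w0_def by (rule sum.union_disjoint) (use L(1) \<open>0 \<notin> P0\<close> in auto)
  finally have ww: "w = w' + w0" .
  have w': "w' \<in> \<nn>"
    unfolding w'_def \<nn>_def using L(3)
    by (intro subspace_sum[OF subspace_root_space_sum]) (auto intro: root_space_sum_base)
  have w0: "w0 \<in> rs 0"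
    unfolding w0_def using L(3) by (intro subspace_sum[OF subspace_root_space]) auto
  \<comment> \<open>On a vector of weight \<beta> both \<open>D\<close> and \<open>ad w'\<close>
    raise the rank, whereas their difference \<open>ad w0\<close> preserves the weight; hence the
    difference is zero.\<close>
  have w0x: "bracket w0 x = 0" if \<beta>: "\<beta> \<in> \<Delta>1" and x: "x \<in> rs \<beta>" for \<beta> x
  proof -
    let ?k = "rank \<beta>"
    have xk: "x \<in> rank_filtration ?k" unfolding rank_filtration_def by (rule root_space_sum_base[OF x]) (use \<beta> in simp)
    have "D x \<in> rank_filtration (Suc ?k)"
      by (rule DW[OF subspace_rank_filtration subspace_rank_filtration rank_filtration_antimono bracket_nn_rank_filtration xk]) simp_all
    moreover have "bracket w' x \<in> rank_filtration (Suc ?k)" by (rule bracket_nn_rank_filtration[OF w' xk])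
    ultimately have "D x - bracket w' x \<in> rank_filtration (Suc ?k)" by (rule subspace_diff[OF subspace_rank_filtration])
    moreover have "D x - bracket w' x = bracket w0 x" by (simp add: w ww bracket_add_left)
    ultimately have f: "bracket w0 x \<in> root_space_sum \<aa> {\<beta> \<in> \<Delta>1. Suc ?k \<le> rank \<beta>}" by (simp add: rank_filtration_def)
    have "bracket w0 x \<in> rs \<beta>" using root_space_bracket[OF w0 x] by simp
    then show ?thesis
      using root_sum_component[of "{\<beta>}" \<aa> "\<lambda>_. bracket w0 x" "{\<beta> \<in> \<Delta>1. Suc ?k \<le> rank \<beta>}" \<beta>]
        f \<beta> roots_degD by auto
  qed
  have "w0 = 0"
  proof (rule deg_zero_faithful)
    show "w0 \<in> deg 0" using root_space_deg[OF w0] by simp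
    fix x assume "x \<in> deg 1"
    then have "x \<in> root_space_sum \<aa> {\<beta> \<in> \<Delta>1. 0 \<le> rank \<beta>}" using rank_filtration_0 by (simp add: rank_filtration_def)
    then have "bracket w0 x \<in> {0}"
      by (rule root_space_sum_induct[OF lin_bracket subspace_single_0, rotated]) (use w0x in auto)
    then show "bracket w0 x = 0" by simp
  qed
  then have "w \<in> \<nn>" using ww w' by simp
  moreover have "exp_ad w = fps_eval N (bracket w) (fps_exp 1)"
    by (rule exp_ad_eq_fps_eval) (use D(2) w in simp)
  then have "T = exp_ad w" using D(5) w by simp
  ultimately show ?thesis by blast
qed

lemma N_group_eq: "N_group \<aa> H P = {T. unipotent T}"
  unfolding N_group_def \<nn>_def[symmetric] using unipotent_exp unipotent_is_exp by blast

end

section \<open>Elimination\<close>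

context lie_algebra
begin

lemma exp_ad_second_order:
  assumes nil: "\<And>x. (bracket u ^^ K) x = 0" and W: "subspace W"
    and x: "bracket u (bracket u x) \<in> W" and u: "\<And>w. w \<in> W \<Longrightarrow> bracket u w \<in> W"
  shows "exp_ad u x - (x + bracket u x) \<in> W"
proof -
  \<comment> \<open>Two extra terms guarantee that the constant and the linear term can be split off
    even when \<open>K\<close> is 0 or 1.\<close>
  let ?N = "Suc (Suc K)"
  have nil': "(bracket u ^^ ?N) x = 0" for x
    by (rule funpow_zero_mono[OF lin_bracket nil]) simp
  have p: "(bracket u ^^ Suc (Suc k)) x \<in> W" for k
    by (induction k) (use x u in auto)
  have "exp_ad u x = (\<Sum>k<?N. inverse (fact k) *s (bracket u ^^ k) x)"
    unfolding exp_ad_eq_fps_eval[of ?N, OF nil'] by (simp add: fps_eval_def divide_inverse)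
  also have "\<dots> = x + (bracket u x + (\<Sum>k<K. inverse (fact (Suc (Suc k))) *s (bracket u ^^ Suc (Suc k)) x))"
    by (simp only: sum.lessThan_Suc_shift) simp
  finally have "exp_ad u x - (x + bracket u x) =
      (\<Sum>k<K. inverse (fact (Suc (Suc k))) *s (bracket u ^^ Suc (Suc k)) x)"
    by (simp add: algebra_simps)
  also have "\<dots> \<in> W" by (intro subspace_sum[OF W] subspace_scale[OF W] p)
  finally show ?thesis .
qed

end

context short_graded_roots
begin

lemma unipotent_id: "unipotent (\<lambda>x. x)"
  unfolding unipotent_def automorphism_def by (auto intro!: linI simp: subspace_0)

lemma not_root_trivial: "\<phi> \<in> dual \<aa> \<Longrightarrow> \<phi> \<notin> \<Delta> \<union> {0} \<Longrightarrow> x \<in> rs \<phi> \<Longrightarrow> x = 0"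
  using rootI by blast

text \<open>With \<open>hs\<close> the coroots already chosen, these are the roots of degree 1 that
  may still occur: vanishing on a coroot gives strong orthogonality to its root.\<close>

definition annihilated :: "'g set \<Rightarrow> ('g \<Rightarrow> 'k) set" where
  "annihilated hs = {\<beta> \<in> \<Delta>1. \<forall>h\<in>hs. \<beta> h = 0}"

text \<open>The weights allowed at stage \<open>k\<close> of a round. Those not annihilated by
  \<open>h\<close> must lie above \<alpha> and have rank at least \<open>k\<close>; at
  \<open>k = card \<Delta>1\<close> none of these is left.\<close>

definition remaining :: "'g set \<Rightarrow> ('g \<Rightarrow> 'k) \<Rightarrow> 'g \<Rightarrow> nat \<Rightarrow> ('g \<Rightarrow> 'k) set" where
  "remaining hs \<alpha> h k = {\<beta> \<in> annihilated hs. \<beta> h = 0 \<or> \<beta> - \<alpha> \<in> P \<and> k \<le> rank \<beta>}"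

text \<open>The pool of exponents for one round. Requiring \<beta> to vanish on \<open>hs\<close>
  ensures that adding \<open>\<beta> - \<alpha>\<close> to a weight does not disturb its vanishing
  on the earlier coroots.\<close>

definition lowered :: "'g set \<Rightarrow> ('g \<Rightarrow> 'k) \<Rightarrow> 'g \<Rightarrow> 'g \<Rightarrow> 'g set" where
  "lowered hs \<alpha> h f = span {bracket f w | w \<beta>. w \<in> rs \<beta> \<and> \<beta> \<in> annihilated hs \<and> \<beta> h \<noteq> 0 \<and> \<beta> - \<alpha> \<in> P}"

text \<open>One elimination round: conjugation by \<open>exp (ad u)\<close> with \<open>u \<in> [f, g\<^sub>1]\<close> removes from the element
  \<open>z + e + \<dots>\<close> all components on which the coroot of \<open>\<alpha>\<close> does not vanish. It fixes the part \<open>z\<close>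
  treated before, since \<open>[f, z] = 0\<close>.\<close>

context
  fixes hs S z \<alpha> e h f
  assumes S: "S \<subseteq> \<Delta>1" and z: "z \<in> root_space_sum \<aa> S"
    and so: "\<And>\<beta> \<sigma>. \<beta> \<in> annihilated hs \<Longrightarrow> \<sigma> \<in> S \<Longrightarrow> strongly_orthogonal \<aa> \<sigma> \<beta>"
    and \<alpha>: "\<alpha> \<in> annihilated hs" and e: "e \<in> rs \<alpha>" and t: "sl2_triple e h f" and h: "h \<in> \<aa>"
    and f: "f \<in> rs (- \<alpha>)" and \<alpha>h: "\<alpha> h = 2"
begin

lemma \<alpha>_\<Delta>1: "\<alpha> \<in> \<Delta>1"
  using \<alpha> by (simp add: annihilated_def)

lemmas coroot = coroot_values[OF \<alpha>_\<Delta>1 e t h f \<alpha>h] coroot_nonzero[OF \<alpha>_\<Delta>1 e t h f \<alpha>h]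

lemma remaining_D: "\<beta> \<in> remaining hs \<alpha> h k \<Longrightarrow> \<beta> \<in> \<Delta>1 \<and> \<beta> \<in> dual \<aa> \<and> \<beta> H = 1"
  using roots_degD[of \<beta> 1] by (simp add: remaining_def annihilated_def)

lemma lowered_nn: "u \<in> lowered hs \<alpha> h f \<Longrightarrow> u \<in> \<nn>"
proof -
  assume u: "u \<in> lowered hs \<alpha> h f"
  have "{bracket f w | w \<beta>. w \<in> rs \<beta> \<and> \<beta> \<in> annihilated hs \<and> \<beta> h \<noteq> 0 \<and> \<beta> - \<alpha> \<in> P} \<subseteq> \<nn>"
  proof safe
    fix w \<beta> assume w: "w \<in> rs \<beta>" "\<beta> \<in> annihilated hs" "\<beta> - \<alpha> \<in> P"
    have b: "bracket f w \<in> rs (\<beta> - \<alpha>)" using root_space_bracket[OF f w(1)] by simp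
    have "(\<beta> - \<alpha>) H = 0" using w(2) \<alpha> roots_degD[of \<alpha> 1] roots_degD[of \<beta> 1] by (simp add: annihilated_def)
    then have "\<beta> - \<alpha> \<in> P0" using w(3) P_roots by (simp add: roots_deg_def)
    then show "bracket f w \<in> \<nn>" unfolding \<nn>_def by (rule root_space_sum_base[OF b])
  qed
  then show ?thesis using u span_minimal[OF _ subspace_nn] unfolding lowered_def by blast
qed

lemma lowered_z:
  assumes u: "u \<in> lowered hs \<alpha> h f"
  shows "bracket u z = 0"
proof -
  have "bracket u z \<in> {0}"
  proof (rule lin_span_subset[OF lin_bracket_left subspace_single_0 _ u[unfolded lowered_def]])
    fix x assume "x \<in> {bracket f w | w \<beta>. w \<in> rs \<beta> \<and> \<beta> \<in> annihilated hs \<and> \<beta> h \<noteq> 0 \<and> \<beta> - \<alpha> \<in> P}"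
    then obtain w \<beta> where x: "x = bracket f w" "w \<in> rs \<beta>" "\<beta> \<in> annihilated hs" by blast
    have w1: "w \<in> deg 1" using root_space_deg[OF x(2)] x(3) roots_degD[of \<beta> 1] by (simp add: annihilated_def)
    show "bracket x z \<in> {0}"
    proof (rule root_space_sum_induct[OF lin_bracket subspace_single_0 _ z])
      fix \<sigma> s assume s: "\<sigma> \<in> S" "s \<in> rs \<sigma>"
      have \<sigma>: "\<sigma> \<in> \<Delta>1" using s(1) S by blast
      have s1: "s \<in> deg 1" using root_space_deg[OF s(2)] roots_degD[OF \<sigma>] by simp
      have "bracket f s \<in> rs (\<sigma> - \<alpha>)" using root_space_bracket[OF f s(2)] by simp
      moreover have "\<sigma> - \<alpha> \<notin> \<Delta> \<union> {0}" using so[OF \<alpha> s(1)] by (simp add: strongly_orthogonal_def)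
      moreover have "\<sigma> - \<alpha> \<in> dual \<aa>" using dual_diff roots_degD[OF \<sigma>] roots_degD[OF \<alpha>_\<Delta>1] by blast
      ultimately have "bracket f s = 0" using not_root_trivial by blast
      then show "bracket x s \<in> {0}"
        by (simp add: x(1) bracket_bracket_left deg_1_commute[OF w1 s1])
    qed
  qed
  then show ?thesis by simp
qed

text \<open>The bracket of a vector of weight \<gamma> has weight
  \<open>\<delta> = \<beta> - \<alpha> + \<gamma>\<close>. Either \<open>\<delta>(h) = 0\<close>,
  which is harmless, or \<gamma> was itself among the weights above \<alpha>; then \<delta> is above
  \<alpha> too and has larger rank.\<close>

lemma lowered_remaining:
  assumes u: "u \<in> lowered hs \<alpha> h f" and q: "q \<in> root_space_sum \<aa> (remaining hs \<alpha> h k)"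
  shows "bracket u q \<in> root_space_sum \<aa> (remaining hs \<alpha> h (Suc k))"
proof (rule lin_span_subset[OF lin_bracket_left subspace_root_space_sum _ u[unfolded lowered_def]])
  fix x assume "x \<in> {bracket f w | w \<beta>. w \<in> rs \<beta> \<and> \<beta> \<in> annihilated hs \<and> \<beta> h \<noteq> 0 \<and> \<beta> - \<alpha> \<in> P}"
  then obtain w \<beta> where x: "x = bracket f w" "w \<in> rs \<beta>" "\<beta> \<in> annihilated hs" "\<beta> h \<noteq> 0" "\<beta> - \<alpha> \<in> P" by blast
  have \<beta>: "\<beta> \<in> \<Delta>1" "\<beta> \<in> dual \<aa>" "\<beta> H = 1" using x(3) roots_degD[of \<beta> 1] by (simp_all add: annihilated_def)
  have xr: "x \<in> rs (\<beta> - \<alpha>)" using root_space_bracket[OF f x(2)] x(1) by simp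
  show "bracket x q \<in> root_space_sum \<aa> (remaining hs \<alpha> h (Suc k))"
  proof (rule root_space_sum_induct[OF lin_bracket subspace_root_space_sum _ q])
    fix \<gamma> y assume y: "\<gamma> \<in> remaining hs \<alpha> h k" "y \<in> rs \<gamma>"
    show "bracket x y \<in> root_space_sum \<aa> (remaining hs \<alpha> h (Suc k))"
    proof (cases "bracket x y = 0")
      case True
      then show ?thesis by (simp add: subspace_0 subspace_root_space_sum)
    next
      case False
      let ?\<delta> = "\<beta> - \<alpha> + \<gamma>"
      note \<gamma> = remaining_D[OF y(1)]
      have b: "bracket x y \<in> rs ?\<delta>" by (rule root_space_bracket[OF xr y(2)])
      have \<delta>: "?\<delta> \<in> \<Delta>1"
        using \<beta> \<gamma> roots_degD[OF \<alpha>_\<Delta>1] by (intro roots_degI[OF b False] dual_add dual_diff) auto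
      have ann: "?\<delta> \<in> annihilated hs"
        using \<delta> x(3) \<alpha> y(1) by (simp add: annihilated_def remaining_def)
      have dg: "?\<delta> - \<gamma> \<in> P" using x(5) by simp
      have "?\<delta> \<in> remaining hs \<alpha> h (Suc k)"
      proof (cases "?\<delta> h = 0")
        case True
        then show ?thesis using ann by (simp add: remaining_def)
      next
        case False
        \<comment> \<open>If \<open>\<gamma>(h) = 0\<close>, then
          \<open>\<delta>(h) = \<beta>(h) - 2\<close> is -1 or 0; the former is not a coroot value,
          the latter is the excluded case.\<close>
        have "\<gamma> h \<noteq> 0"
        proof
          assume "\<gamma> h = 0"
          then have d: "?\<delta> h = \<beta> h - 2" using \<alpha>h by simp
          have "\<beta> h = 1 \<or> \<beta> h = 2" using coroot(1)[OF \<beta>(1)] x(4) by blast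
          then show False using coroot(1)[OF \<delta>] False unfolding d by auto
        qed
        then have g: "\<gamma> - \<alpha> \<in> P" "k \<le> rank \<gamma>" using y(1) by (auto simp: remaining_def)
        have "?\<delta> - \<alpha> \<in> P" by (rule P_trans[OF g(1) dg coroot(2)[OF \<delta> False]])
        moreover have "rank \<gamma> < rank ?\<delta>" using rank_less[OF _ \<delta> dg] \<gamma> by blast
        ultimately show ?thesis using ann g(2) by (simp add: remaining_def)
      qed
      then show ?thesis by (rule root_space_sum_base[OF b])
    qed
  qed
qed

text \<open>The condition on \<open>q\<close> is linear, so it is checked on root vectors. That
  \<open>[u, e]\<close> itself stays in stage \<open>k\<close> is recorded because it controls the
  second-order term of the exponential.\<close>

lemma remaining_split:
  assumes q: "q \<in> root_space_sum \<aa> (remaining hs \<alpha> h k)"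
  shows "\<exists>u\<in>lowered hs \<alpha> h f. bracket u e \<in> root_space_sum \<aa> (remaining hs \<alpha> h k) \<and>
    q + bracket u e \<in> root_space_sum \<aa> (remaining hs \<alpha> h (Suc k))"
proof -
  let ?Z = "\<lambda>k. root_space_sum \<aa> (remaining hs \<alpha> h k)"
  let ?V = "{q \<in> ?Z k. \<exists>u\<in>lowered hs \<alpha> h f. bracket u e \<in> ?Z k \<and> q + bracket u e \<in> ?Z (Suc k)}"
  have sl: "subspace (lowered hs \<alpha> h f)" by (simp add: lowered_def)
  note sZ = subspace_root_space_sum[of \<aa>]
  have "subspace ?V"
  proof (rule subspaceI)
    show "0 \<in> ?V" using subspace_0[OF sZ] subspace_0[OF sl] by (auto intro: bexI[of _ 0])
  next
    fix q q' assume "q \<in> ?V" "q' \<in> ?V"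
    then obtain u u' where q: "q \<in> ?Z k" "u \<in> lowered hs \<alpha> h f" "bracket u e \<in> ?Z k" "q + bracket u e \<in> ?Z (Suc k)"
      and q': "q' \<in> ?Z k" "u' \<in> lowered hs \<alpha> h f" "bracket u' e \<in> ?Z k" "q' + bracket u' e \<in> ?Z (Suc k)" by blast
    have e: "q + q' + bracket (u + u') e = (q + bracket u e) + (q' + bracket u' e)"
      by (simp add: bracket_add_left)
    have "q + q' + bracket (u + u') e \<in> ?Z (Suc k)"
      unfolding e by (rule subspace_add[OF sZ q(4) q'(4)])
    moreover have "bracket (u + u') e \<in> ?Z k"
      using subspace_add[OF sZ q(3) q'(3)] by (simp add: bracket_add_left)
    ultimately show "q + q' \<in> ?V"
      using subspace_add[OF sZ q(1) q'(1)] subspace_add[OF sl q(2) q'(2)] by blast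
  next
    fix c q assume "q \<in> ?V"
    then obtain u where q: "q \<in> ?Z k" "u \<in> lowered hs \<alpha> h f" "bracket u e \<in> ?Z k" "q + bracket u e \<in> ?Z (Suc k)" by blast
    have "c *s q + bracket (c *s u) e \<in> ?Z (Suc k)" "bracket (c *s u) e \<in> ?Z k"
      using subspace_scale[OF sZ q(4), of c] subspace_scale[OF sZ q(3), of c]
      by (simp_all add: bracket_scale_left scale_right_distrib)
    then show "c *s q \<in> ?V"
      using subspace_scale[OF sZ q(1)] subspace_scale[OF sl q(2)] by blast
  qed
  moreover have "w \<in> ?V" if \<beta>: "\<beta> \<in> remaining hs \<alpha> h k" and w: "w \<in> rs \<beta>" for \<beta> w
  proof -
    have wZ: "w \<in> ?Z k" by (rule root_space_sum_base[OF w \<beta>])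
    show ?thesis
    proof (cases "\<beta> h = 0")
      case True
      then have "\<beta> \<in> remaining hs \<alpha> h (Suc k)" using \<beta> by (simp add: remaining_def)
      then have "w \<in> ?Z (Suc k)" by (rule root_space_sum_base[OF w])
      then show ?thesis using wZ subspace_0[OF sZ] subspace_0[OF sl] by (auto intro: bexI[of _ 0])
    next
      case False
      let ?u = "inverse (\<beta> h) *s bracket f w"
      have "?u \<in> lowered hs \<alpha> h f"
        unfolding lowered_def using False \<beta> w
        by (intro span_scale span_base) (auto simp: remaining_def)
      moreover have "w \<in> deg 1" using root_space_deg[OF w] remaining_D[OF \<beta>] by simp
      then have "bracket e (bracket f w) = \<beta> h *s w"
        using deg_1_commute[OF triple_deg(1)[OF t]] by (simp add: triple_e_f[OF t] root_spaceD[OF w h])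
      then have ue: "bracket ?u e = - w"
        using False by (simp add: bracket_scale_left bracket_anti[of "bracket f w" e])
      ultimately show ?thesis
        using wZ subspace_0[OF sZ] subspace_neg[OF sZ wZ] by (auto intro!: bexI[of _ ?u] simp: ue)
    qed
  qed
  then have "(\<Union>\<beta>\<in>remaining hs \<alpha> h k. rs \<beta>) \<subseteq> ?V" by blast
  ultimately have "?Z k \<subseteq> ?V" unfolding root_space_sum_def[of _ "remaining hs \<alpha> h k"]
    by (rule span_minimal[rotated])
  then show ?thesis using q by blast
qed

lemma remaining_antimono: "remaining hs \<alpha> h (Suc k) \<subseteq> remaining hs \<alpha> h k"
  by (auto simp: remaining_def)

lemma elimination_step:
  assumes q: "q \<in> root_space_sum \<aa> (remaining hs \<alpha> h k)"
  shows "\<exists>T q'. unipotent T \<and> q' \<in> root_space_sum \<aa> (remaining hs \<alpha> h (Suc k)) \<and> T (z + (e + q)) = z + (e + q')"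
proof -
  let ?Z = "\<lambda>k. root_space_sum \<aa> (remaining hs \<alpha> h k)"
  note sZ = subspace_root_space_sum[of \<aa> "remaining hs \<alpha> h (Suc k)"]
  obtain u where u: "u \<in> lowered hs \<alpha> h f" "bracket u e \<in> ?Z k" "q + bracket u e \<in> ?Z (Suc k)"
    using remaining_split[OF q] by blast
  have un: "u \<in> \<nn>" by (rule lowered_nn[OF u(1)])
  obtain K where K: "\<And>x. (bracket u ^^ K) x = 0" using nn_nilpotent un by blast
  have uZ: "bracket u w \<in> ?Z (Suc k)" if "w \<in> ?Z k" for w by (rule lowered_remaining[OF u(1) that])
  have Zm: "?Z (Suc k) \<subseteq> ?Z k" by (rule root_space_sum_mono[OF remaining_antimono])
  \<comment> \<open>Both \<open>[u, e]\<close> and \<open>q\<close> lie in stage \<open>k\<close>,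
    so one more bracket with \<open>u\<close> reaches stage \<open>k + 1\<close>. Only the
    first-order term \<open>[u, e]\<close> remains in stage \<open>k\<close>, and it was chosen to
    cancel \<open>q\<close> modulo the next stage.\<close>
  have "bracket u (bracket u (e + q)) \<in> ?Z (Suc k)"
    using uZ[OF u(2)] uZ[of "bracket u q"] uZ[OF q] Zm
    by (simp add: bracket_add_right) (metis subsetD subspace_add[OF sZ])
  then have d: "exp_ad u (e + q) - (e + q + bracket u (e + q)) \<in> ?Z (Suc k)" (is "?d \<in> _")
    by (rule exp_ad_second_order[OF K sZ]) (use uZ Zm in blast)
  \<comment> \<open>The remainder estimate with the zero subspace says that \<open>exp_ad u\<close>
    fixes \<open>z\<close>, as \<open>[u, z] = 0\<close>.\<close>
  have "exp_ad u z - (z + bracket u z) \<in> {0}"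
    by (rule exp_ad_second_order[OF K subspace_single_0]) (simp_all add: lowered_z[OF u(1)])
  then have uz: "exp_ad u z = z" by (simp add: lowered_z[OF u(1)])
  have lin: "lin (exp_ad u)" using unipotent_exp[OF un] by (simp add: unipotent_def automorphism_def)
  let ?q = "(q + bracket u e) + bracket u q + ?d"
  have "exp_ad u (z + (e + q)) = z + exp_ad u (e + q)" by (simp only: lin_add[OF lin] uz)
  also have "\<dots> = z + (e + ?q)" by (simp add: bracket_add_right algebra_simps)
  finally have "exp_ad u (z + (e + q)) = z + (e + ?q)" .
  moreover have "?q \<in> ?Z (Suc k)" by (intro subspace_add[OF sZ] u(3) uZ q d)
  ultimately show ?thesis using unipotent_exp[OF un] by blast
qed

lemma elimination:
  assumes q: "q \<in> root_space_sum \<aa> (remaining hs \<alpha> h 0)"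
  shows "\<exists>T q'. unipotent T \<and> q' \<in> root_space_sum \<aa> (annihilated (insert h hs)) \<and>
    T (z + (e + q)) = z + (e + q')"
proof -
  have "\<exists>T q'. unipotent T \<and> q' \<in> root_space_sum \<aa> (remaining hs \<alpha> h k) \<and> T (z + (e + q)) = z + (e + q')" for k
  proof (induction k)
    case 0
    then show ?case using q unipotent_id by blast
  next
    case (Suc k)
    then obtain T q' where T: "unipotent T" "q' \<in> root_space_sum \<aa> (remaining hs \<alpha> h k)"
      "T (z + (e + q)) = z + (e + q')" by blast
    obtain T' q'' where T': "unipotent T'" "q'' \<in> root_space_sum \<aa> (remaining hs \<alpha> h (Suc k))"
      "T' (z + (e + q')) = z + (e + q'')" using elimination_step[OF T(2)] by blast
    show ?case using unipotent_comp[OF T'(1) T(1)] T' T(3) by metis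
  qed
  moreover have "remaining hs \<alpha> h (card \<Delta>1) \<subseteq> annihilated (insert h hs)"
    using rank_bound by (fastforce simp: remaining_def annihilated_def)
  ultimately show ?thesis using root_space_sum_mono by blast
qed

end

text \<open>The form needed for induction: \<open>z\<close> is the settled part, supported on
  \<open>S\<close>, and \<open>r\<close> is supported on the roots killed by the coroots in
  \<open>hs\<close>. Each round adds a coroot \<open>h\<close> with \<open>\<alpha>(h) = 2\<close>,
  so \<alpha> leaves \<open>annihilated hs\<close> and the measure drops. Both orders of strong
  orthogonality are assumed because \<open>pairwise\<close> asks for both.\<close>

lemma orthogonal_representative:
  assumes "S \<subseteq> \<Delta>1" "pairwise (strongly_orthogonal \<aa>) S" "z \<in> root_space_sum \<aa> S"
    and "r \<in> root_space_sum \<aa> (annihilated hs)"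
    and "\<And>\<beta> \<sigma>. \<beta> \<in> annihilated hs \<Longrightarrow> \<sigma> \<in> S \<Longrightarrow>
      strongly_orthogonal \<aa> \<sigma> \<beta> \<and> strongly_orthogonal \<aa> \<beta> \<sigma>"
  shows "\<exists>T S'. unipotent T \<and> S' \<subseteq> \<Delta>1 \<and> pairwise (strongly_orthogonal \<aa>) S' \<and>
    T (z + r) \<in> root_space_sum \<aa> S'"
  using assms
proof (induction "card (annihilated hs)" arbitrary: hs S z r rule: less_induct)
  case less
  note S = less.prems(1) and so = less.prems(5)
  obtain J w where J: "finite J" "J \<subseteq> annihilated hs" "\<forall>\<beta>\<in>J. w \<beta> \<in> rs \<beta>" "r = sum w J"
    using span_UN_sum[of rs r "annihilated hs", OF subspace_root_space] less.prems(4)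
    unfolding root_space_sum_def by blast
  define \<Lambda> where "\<Lambda> = {\<beta> \<in> J. w \<beta> \<noteq> 0}"
  have L: "finite \<Lambda>" "\<Lambda> \<subseteq> annihilated hs" "\<And>\<beta>. \<beta> \<in> \<Lambda> \<Longrightarrow> w \<beta> \<in> rs \<beta> \<and> w \<beta> \<noteq> 0" "r = sum w \<Lambda>"
    using J by (auto simp: \<Lambda>_def intro!: sum.mono_neutral_right)
  show ?case
  proof (cases "\<Lambda> = {}")
    case True
    then have "r = 0" using L(4) by simp
    then show ?thesis using unipotent_id less.prems(1-3) by (metis add_0_right)
  next
    case False
    obtain \<alpha> where \<alpha>: "\<alpha> \<in> \<Lambda>" and min: "\<And>\<beta>. \<beta> \<in> \<Lambda> \<Longrightarrow> rank \<alpha> \<le> rank \<beta>"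
      using False L(1) ex_min_if_finite[of "rank ` \<Lambda>"]
      by (metis arg_min_if_finite(1) arg_min_least)
    have \<alpha>a: "\<alpha> \<in> annihilated hs" and \<alpha>1: "\<alpha> \<in> \<Delta>1" using \<alpha> L(2) by (auto simp: annihilated_def)
    obtain h f where t: "sl2_triple (w \<alpha>) h f" "h \<in> \<aa>" "f \<in> rs (- \<alpha>)" "\<alpha> h = 2"
      using root_triple[OF \<alpha>1, of "w \<alpha>"] L(3)[OF \<alpha>] by metis
    have e: "w \<alpha> \<in> rs \<alpha>" using L(3)[OF \<alpha>] by blast
    note ctx = S less.prems(3) so[THEN conjunct1] \<alpha>a e t
    have "\<beta> \<in> remaining hs \<alpha> h 0" if \<beta>: "\<beta> \<in> \<Lambda> - {\<alpha>}" for \<beta>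
    proof (cases "\<beta> h = 0")
      case True
      then show ?thesis using \<beta> L(2) unfolding remaining_def by blast
    next
      case False
      have \<beta>1: "\<beta> \<in> \<Delta>1" using \<beta> L(2) by (auto simp: annihilated_def)
      have "\<beta> - \<alpha> \<in> \<Delta>" using coroot_nonzero[OF \<alpha>1 e t \<beta>1 False] \<beta> by auto
      \<comment> \<open>A positive \<open>\<alpha> - \<beta>\<close> would make the rank of \<beta>
        smaller than that of \<alpha>, against the choice of \<alpha>; so the root
        \<open>\<beta> - \<alpha>\<close> is the positive one.\<close>
      moreover have "\<alpha> - \<beta> \<notin> P" using rank_less[OF \<beta>1 \<alpha>1] min[of \<beta>] \<beta> by force
      ultimately have "\<beta> - \<alpha> \<in> P" using P_uminus[of "\<beta> - \<alpha>"] by simp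
      then show ?thesis using \<beta> L(2) unfolding remaining_def by blast
    qed
    then have "sum w (\<Lambda> - {\<alpha>}) \<in> root_space_sum \<aa> (remaining hs \<alpha> h 0)"
      using L(3) by (intro subspace_sum[OF subspace_root_space_sum]) (auto intro: root_space_sum_base)
    then obtain T q where T: "unipotent T" "q \<in> root_space_sum \<aa> (annihilated (insert h hs))"
      "T (z + (w \<alpha> + sum w (\<Lambda> - {\<alpha>}))) = z + (w \<alpha> + q)"
      using elimination[OF ctx] by blast
    have r: "r = w \<alpha> + sum w (\<Lambda> - {\<alpha>})" using L(1,4) \<alpha> by (simp add: sum.remove)
    have sub: "annihilated (insert h hs) \<subseteq> annihilated hs" by (auto simp: annihilated_def)
    have "\<alpha> \<notin> annihilated (insert h hs)" using t(4) by (simp add: annihilated_def)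
    then have psub: "annihilated (insert h hs) \<subset> annihilated hs" using sub \<alpha>a by blast
    have fin: "finite (annihilated hs)" using finite_\<Delta>1 by (simp add: annihilated_def)
    have "\<exists>T S'. unipotent T \<and> S' \<subseteq> \<Delta>1 \<and> pairwise (strongly_orthogonal \<aa>) S' \<and>
        T ((z + w \<alpha>) + q) \<in> root_space_sum \<aa> S'"
    proof (rule less.hyps[of "insert h hs" "insert \<alpha> S"])
      show "card (annihilated (insert h hs)) < card (annihilated hs)"
        by (rule psubset_card_mono[OF fin psub])
      show "insert \<alpha> S \<subseteq> \<Delta>1" using S \<alpha>1 by blast
      show "pairwise (strongly_orthogonal \<aa>) (insert \<alpha> S)"
        using less.prems(2) so[OF \<alpha>a] by (simp add: pairwise_insert)
      have "z \<in> root_space_sum \<aa> (insert \<alpha> S)"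
        using less.prems(3) root_space_sum_mono[of S "insert \<alpha> S"] by blast
      moreover have "w \<alpha> \<in> root_space_sum \<aa> (insert \<alpha> S)" by (rule root_space_sum_base[OF e]) simp
      ultimately show "z + w \<alpha> \<in> root_space_sum \<aa> (insert \<alpha> S)"
        by (rule subspace_add[OF subspace_root_space_sum])
      show "q \<in> root_space_sum \<aa> (annihilated (insert h hs))" by (rule T(2))
      fix \<beta> \<sigma> assume \<beta>: "\<beta> \<in> annihilated (insert h hs)" and \<sigma>: "\<sigma> \<in> insert \<alpha> S"
      have "\<beta> \<in> \<Delta>1" "\<beta> h = 0" using \<beta> by (auto simp: annihilated_def)
      from coroot_zero_strongly_orthogonal[OF \<alpha>1 e t this] so[of \<beta> \<sigma>] \<beta> \<sigma> sub
      show "strongly_orthogonal \<aa> \<sigma> \<beta> \<and> strongly_orthogonal \<aa> \<beta> \<sigma>" by blast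
    qed
    then obtain T' S' where T': "unipotent T'" "S' \<subseteq> \<Delta>1" "pairwise (strongly_orthogonal \<aa>) S'"
      "T' ((z + w \<alpha>) + q) \<in> root_space_sum \<aa> S'" by blast
    have "T' (T (z + r)) \<in> root_space_sum \<aa> S'"
      unfolding r T(3) using T'(4) by (simp only: add.assoc)
    then show ?thesis using unipotent_comp[OF T'(1) T(1)] T'(2,3) by blast
  qed
qed

lemma deg_1_orthogonal_representative:
  assumes x: "x \<in> deg 1"
  shows "\<exists>S \<subseteq> \<Delta>1. pairwise (strongly_orthogonal \<aa>) S \<and>
    (\<lambda>g. g x) ` N_group \<aa> H P \<inter> root_space_sum \<aa> S \<noteq> {}"
proof -
  have "{\<beta> \<in> \<Delta>1. 0 \<le> rank \<beta>} = annihilated {}" by (simp add: annihilated_def)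
  then have "x \<in> root_space_sum \<aa> (annihilated {})" using rank_filtration_0[OF x] by (simp add: rank_filtration_def)
  then obtain T S where "unipotent T" "S \<subseteq> \<Delta>1" "pairwise (strongly_orthogonal \<aa>) S"
    "T (0 + x) \<in> root_space_sum \<aa> S"
    using orthogonal_representative[of "{}" 0 x "{}"] by (auto simp: root_space_sum_empty)
  then show ?thesis unfolding N_group_eq by (intro exI[of _ S]) auto
qed

end

theorem proposition2p3p1:
  fixes scale :: "'k::field_char_0 \<Rightarrow> 'g::ab_group_add \<Rightarrow> 'g"
    and Basis :: "'g set"
    and bracket :: "'g \<Rightarrow> 'g \<Rightarrow> 'g"
    and gr :: "int \<Rightarrow> 'g set"
    and H\<^sub>0 :: 'g
    and \<aa> :: "'g set"
    and P :: "('g \<Rightarrow> 'k) set"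
    and i :: int
    and x :: 'g
  assumes "lie_algebra scale Basis bracket"
    and "lie_algebra.absolutely_simple scale Basis bracket"
    and "lie_algebra.short_grading scale bracket gr"
    and "lie_algebra.grading_element scale bracket gr H\<^sub>0"
    and "lie_algebra.absolutely_simple_submodule scale Basis bracket (gr 0) (gr 1)"
    and "lie_algebra.one_simple bracket gr (scale 2 H\<^sub>0)"
    and "lie_algebra.maximal_split_abelian scale bracket \<aa>"
    and "H\<^sub>0 \<in> \<aa>"
    and "lie_algebra.positive_roots scale bracket \<aa> P"
    and "lie_algebra.roots_deg scale bracket \<aa> H\<^sub>0 1 \<subseteq> P"
    and "i = 1 \<or> i = -1"
    and "x \<in> gr i"
  shows "\<exists>S \<subseteq> lie_algebra.roots_deg scale bracket \<aa> H\<^sub>0 i.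
           pairwise (lie_algebra.strongly_orthogonal scale bracket \<aa>) S \<and>
           (\<lambda>g. g x) ` lie_algebra.N_group scale bracket \<aa> H\<^sub>0 P
             \<inter> lie_algebra.root_space_sum scale bracket \<aa> S \<noteq> {}"
proof -
  interpret lie_algebra scale Basis bracket by (rule assms(1))
  note grading = assms(3)[unfolded short_grading_def] and H = assms(4)[unfolded grading_element_def]
  have gr: "gr (-1) = {x. bracket H\<^sub>0 x = - x}" "gr 0 = {x. bracket H\<^sub>0 x = 0}" "gr 1 = {x. bracket H\<^sub>0 x = x}"
    using H by auto
  have pos: "short_graded_roots scale Basis bracket H\<^sub>0 \<aa> P"
  proof unfold_locales
    fix x
    obtain p where p: "p \<in> gr (-1) \<times> gr 0 \<times> gr 1" "x = fst p + fst (snd p) + snd (snd p)"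
      using grading by blast
    then show "\<exists>a b c. x = a + b + c \<and> bracket H\<^sub>0 a = - a \<and> bracket H\<^sub>0 b = 0 \<and> bracket H\<^sub>0 c = c"
      unfolding gr by (intro exI[of _ "fst p"] exI[of _ "fst (snd p)"] exI[of _ "snd (snd p)"]) auto
  next
    have "subspace (gr 1)" "gr 1 \<noteq> {0}" using grading by blast+
    then obtain y where "y \<in> gr 1" "y \<noteq> 0" using subspace_0 by blast
    then show "\<exists>x. bracket H\<^sub>0 x \<noteq> 0" unfolding gr by (intro exI[of _ y]) simp
  qed (use assms absolutely_simple_ideal in auto)
  interpret p: short_graded_roots scale Basis bracket H\<^sub>0 \<aa> P by (rule pos)
  have sa: "- H\<^sub>0 \<in> \<aa>" using p.H_in p.subspace_a subspace_neg by blast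
  \<comment> \<open>The same \<open>P\<close> is used for the opposite grading, so that the positive
    roots of degree 0, and with them the group, do not change.\<close>
  interpret m: short_graded_roots scale Basis bracket "- H\<^sub>0" \<aa> P
    by (intro short_graded_roots.intro p.short_graded_minus short_graded_roots_axioms.intro
        p.maximal p.positive sa)
  have "\<phi> (- H\<^sub>0) = of_int j \<longleftrightarrow> \<phi> H\<^sub>0 = of_int (- j)" if "\<phi> \<in> roots \<aa>" for \<phi> j
  proof -
    have "\<phi> (scale (-1) H\<^sub>0) = (-1) * \<phi> H\<^sub>0" using root_dual[OF that] p.H_in unfolding dual_def by blast
    then have "\<phi> (- H\<^sub>0) = - \<phi> H\<^sub>0" by simp
    then show ?thesis by (metis of_int_minus minus_minus)
  qed
  then have deg: "roots_deg \<aa> (- H\<^sub>0) j = roots_deg \<aa> H\<^sub>0 (- j)" for j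
    unfolding roots_deg_def by blast
  from assms(11) show ?thesis
  proof
    assume "i = 1"
    then show ?thesis using p.deg_1_orthogonal_representative[of x] assms(12) by (simp add: p.deg_def gr)
  next
    assume i: "i = -1"
    then have "x \<in> m.deg 1" using assms(12) by (simp add: m.deg_def gr)
    \<comment> \<open>The group only depends on the roots of degree 0, and 0 is its own
      negative.\<close>
    moreover have "N_group \<aa> (- H\<^sub>0) P = N_group \<aa> H\<^sub>0 P" by (simp add: N_group_def deg)
    ultimately show ?thesis using m.deg_1_orthogonal_representative[of x] by (simp add: deg i)
  qed
qed

end
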